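(* Let $G$ be a finite group with exponent $n_1=2^mp_1^{m_1}\cdots p_r^{m_r}$ ($p_i$ distinct odd primes) and conjugacy class scheme $\mathcal{A}$. Let $\Delta=2^{w_0}(-1)^w\prod_{k=1}^r\big((-1)^{(p_k-1)/2}p_k\big)^{w_k}$ with $w,w_0,\ldots,w_r\in\{0,1\}$, $w_0=0$ if $m<3$, $w=0$ if $m<2$, and let $H_\Delta=\{k\in\mathbb{Z}_{n_1}^*:\chi(k)^{w_0}\left(\frac k4\right)^w\prod_{j=1}^r\left(\frac k{p_j}\right)^{w_j}=1\}$. Define $g\sim_\Delta h$ iff $g$ is conjugate to $h^k$ for some $k\in H_\Delta$. Let $C_1,C_2\subseteq G$ be disjoint unions of conjugacy classes with $1\notin C_1\cup C_2$, and let $M=A_{C_1}-A_{C_2}$. Then: (i) all eigenvalues of $M$ lie in $\mathbb{Q}(\sqrt\Delta)$ iff $C_1$ and $C_2$ are both unions of equivalence classes of $\sim_\Delta$; (ii) all eigenvalues of $M$ are integer multiples of $\sqrt\Delta$ iff either $\Delta=1$ and $C_1,C_2$ are unions of $\sim_1$ classes, or $\Delta\ne1$, $C_1$ is a union of $\sim_\Delta$ classes, and $C_2=C_1^k:=\{g^k:g\in C_1\}$ for some $k\in\mathbb{Z}_{n_1}^*\setminus H_\Delta$. Furthermore, in case (ii) with $\Delta\neq 1$: if $\Delta<0$ then $M$ is the skew-symmetric adjacency matrix of an oriented normal Cayley graph, and if $\Delta>0$ then $M$ is the symmetric adjacency matrix of a signed normal Cayley graph.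
   Context: For a finite group $G$ (multiplicative, identity $1$), $A_g$ is the permutation matrix with $(A_g)_{a,b}=1$ iff $ba^{-1}=g$, and $A_C=\sum_{g\in C}A_g$. The conjugacy class scheme is $\{A_{K_0},\ldots,A_{K_d}\}$ for the conjugacy classes $K_i$. The exponent $n_1$ is the least positive integer with $g^{n_1}=1$ for all $g$; for $k\in\mathbb{Z}_{n_1}^*$, $g^k$ is well defined. $\left(\frac kp\right)$ is the Legendre symbol; for odd $k$, $\left(\frac k4\right)=\pm1$ according as $k\equiv\pm1\pmod 4$; $\chi(k)=1$ if $k\equiv\pm1\pmod 8$ and $-1$ if $k\equiv\pm3\pmod8$. A normal Cayley graph is one whose connection set(s) are unions of conjugacy classes. An oriented Cayley graph $X(G,C)$ ($C\cap C^{-1}=\emptyset$) has skew-symmetric adjacency matrix $A_C-A_C^T$; a signed Cayley graph $X(G,C(1),C(-1))$ with disjoint inverse-closed $C(\pm1)$ has adjacency matrix $A_{C(1)}-A_{C(-1)}$. *)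

theory Defs
  imports "HOL-Algebra.Group" "HOL-Number_Theory.Number_Theory" "HOL-Analysis.Analysis"
begin

definition grp_exponent :: "('a, 'b) monoid_scheme \<Rightarrow> nat" where
  "grp_exponent G = (LEAST n. 0 < n \<and> (\<forall>g\<in>carrier G. g [^]\<^bsub>G\<^esub> n = \<one>\<^bsub>G\<^esub>))"

definition units_mod :: "nat \<Rightarrow> nat set" where
  "units_mod n = {k. k < n \<and> coprime k n}"

definition adjA :: "('a, 'b) monoid_scheme \<Rightarrow> 'a set \<Rightarrow> 'a \<Rightarrow> 'a \<Rightarrow> int" where
  "adjA G C a b = (if b \<otimes>\<^bsub>G\<^esub> inv\<^bsub>G\<^esub> a \<in> C then 1 else 0)"

definition normal_set :: "('a, 'b) monoid_scheme \<Rightarrow> 'a set \<Rightarrow> bool" where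
  "normal_set G C \<longleftrightarrow> C \<subseteq> carrier G \<and>
     (\<forall>g\<in>C. \<forall>x\<in>carrier G. x \<otimes>\<^bsub>G\<^esub> g \<otimes>\<^bsub>G\<^esub> inv\<^bsub>G\<^esub> x \<in> C)"

definition conjugate :: "('a, 'b) monoid_scheme \<Rightarrow> 'a \<Rightarrow> 'a \<Rightarrow> bool" where
  "conjugate G g h \<longleftrightarrow> (\<exists>x\<in>carrier G. g = x \<otimes>\<^bsub>G\<^esub> h \<otimes>\<^bsub>G\<^esub> inv\<^bsub>G\<^esub> x)"

definition eigenvalue_on :: "'a set \<Rightarrow> ('a \<Rightarrow> 'a \<Rightarrow> int) \<Rightarrow> complex \<Rightarrow> bool" where
  "eigenvalue_on V M \<mu> \<longleftrightarrow> (\<exists>v :: 'a \<Rightarrow> complex. (\<exists>x\<in>V. v x \<noteq> 0) \<and>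
     (\<forall>a\<in>V. (\<Sum>b\<in>V. of_int (M a b) * v b) = \<mu> * v a))"

text \<open>chi(k) and (k/4) for odd k.\<close>
definition chi8 :: "nat \<Rightarrow> int" where
  "chi8 k = (if k mod 8 = 1 \<or> k mod 8 = 7 then 1 else -1)"

definition sym4 :: "nat \<Rightarrow> int" where
  "sym4 k = (if k mod 4 = 1 then 1 else -1)"

definition odd_prime_divs :: "nat \<Rightarrow> nat set" where
  "odd_prime_divs n = {p. prime p \<and> odd p \<and> p dvd n}"

text \<open>Delta = 2^w0 (-1)^w prod_{p in W} ((-1)^((p-1)/2) p); W = {p_k : w_k = 1}.\<close>
definition Delta :: "nat \<Rightarrow> nat \<Rightarrow> nat set \<Rightarrow> int" where
  "Delta w0 w W = 2 ^ w0 * (-1) ^ w * (\<Prod>p\<in>W. (-1) ^ ((p - 1) div 2) * int p)"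

definition H_Delta :: "nat \<Rightarrow> nat \<Rightarrow> nat \<Rightarrow> nat set \<Rightarrow> nat set" where
  "H_Delta n1 w0 w W = {k \<in> units_mod n1.
      chi8 k ^ w0 * sym4 k ^ w * (\<Prod>p\<in>W. Legendre (int k) (int p)) = 1}"

definition sim_Delta :: "('a, 'b) monoid_scheme \<Rightarrow> nat \<Rightarrow> nat \<Rightarrow> nat set \<Rightarrow> 'a \<Rightarrow> 'a \<Rightarrow> bool" where
  "sim_Delta G w0 w W g h \<longleftrightarrow>
     (\<exists>k\<in>H_Delta (grp_exponent G) w0 w W. conjugate G g (h [^]\<^bsub>G\<^esub> k))"

definition union_of_classes :: "('a, 'b) monoid_scheme \<Rightarrow> nat \<Rightarrow> nat \<Rightarrow> nat set \<Rightarrow> 'a set \<Rightarrow> bool" where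
  "union_of_classes G w0 w W C \<longleftrightarrow> C \<subseteq> carrier G \<and>
     (\<forall>g\<in>carrier G. \<forall>h\<in>carrier G. sim_Delta G w0 w W g h \<longrightarrow> (g \<in> C \<longleftrightarrow> h \<in> C))"

definition quad_field :: "int \<Rightarrow> complex set" where
  "quad_field d = {of_rat a + of_rat b * csqrt (of_int d) | a b. True}"

end

theory Submission
  imports Defs "HOL-Computational_Algebra.Squarefree"
    "Jordan_Normal_Form.Schur_Decomposition" "Berlekamp_Zassenhaus.Factorize_Rat_Poly"
begin

text \<open>
  Regard \<open>f = 1_{C1} - 1_{C2}\<close> as a central element of the group algebra; its eigenvalues are those
  of \<open>M\<close>. For an idempotent class function \<open>e\<close> with \<open>f * e = \<theta> e\<close>, the number \<open>\<theta>\<close> is, up to a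
  nonzero rational factor, the sum over \<open>g\<close> of \<open>f g\<close> times the trace of \<open>g\<close> on the ideal generated
  by \<open>e\<close>. That trace is a rational combination of \<open>n\<close>-th roots of unity, \<open>n\<close> being the exponent, and
  replacing \<open>g\<close> by \<open>g^k\<close> raises these roots to the \<open>k\<close>-th power. Hence for \<open>k\<close> coprime to \<open>n\<close> the
  Galois automorphism \<open>\<sigma>_k\<close> acts on the eigenvalues as \<open>g \<mapsto> g^k\<close> acts on \<open>f\<close>, while
  products of Gauss sums show that it multiplies \<open>\<surd>\<Delta>\<close> by the value at \<open>k\<close> of the character
  defining \<open>H_\<Delta>\<close>. Averaging over \<open>H_\<Delta>\<close> gives one direction; the other uses a joint eigenspace of
  \<open>f\<close> and of the class function that is to vanish.
\<close>

section \<open>Integer and idempotent matrices\<close>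

text \<open>Neither representation theory nor a Galois group is set up. In place of irreducible
  characters stand central idempotents of the group algebra; they exist because the involution
  \<open>star\<close> is positive: \<open>u \<star> star u\<close> at the identity is a sum of
  squares, so no nonzero class function is nilpotent. The same positivity makes
  \<open>e \<one>\<close> nonzero, and this is the rational factor that scales the eigenvalue.
  Traces are rational combinations of roots of unity because an idempotent matrix has integer trace,
  which is applied to \<open>e\<close> times each spectral idempotent of \<open>g\<close>. In place
  of an automorphism stands the fact that a rational linear relation between powers of a root of
  unity survives multiplication of all exponents by a coprime k. The square root of Delta takes part
  in such relations as the value of an integer polynomial. Integrality in (ii) needs two more facts:
  eigenvalues of integer matrices are algebraic integers, and Delta is squarefree, so that b^2 Delta
  is an integer only for integer b. Squarefreeness also makes 1 the only perfect square among the
  values of Delta, which is why that case stands apart.\<close>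

lemma eigenvalue_on_imp_algebraic_int:
  assumes "finite V" and ev: "eigenvalue_on V M \<mu>"
  shows "algebraic_int \<mu>"
proof -
  obtain v x where x: "x \<in> V" "v x \<noteq> 0"
    and v: "\<And>a. a \<in> V \<Longrightarrow> (\<Sum>b\<in>V. of_int (M a b) * v b) = \<mu> * v a"
    using ev unfolding eigenvalue_on_def by blast
  define N where "N = card V"
  obtain h where h: "bij_betw h {0..<N} V"
    using ex_bij_betw_nat_finite[OF \<open>finite V\<close>] unfolding N_def by blast
  define A where "A = mat N N (\<lambda>(i, j). M (h i) (h j))"
  define w where "w = vec N (\<lambda>i. v (h i))"
  have A: "A \<in> carrier_mat N N" by (simp add: A_def)
  then have A': "map_mat of_int A \<in> carrier_mat N N" by simp
  obtain i where i: "i < N" "h i = x"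
    using x h unfolding bij_betw_def by (metis atLeastLessThan_iff imageE)
  have "eigenvector (map_mat of_int A) w \<mu>"
    unfolding eigenvector_def
  proof (intro conjI)
    show "w \<in> carrier_vec (dim_row (map_mat of_int A))" by (simp add: w_def A_def)
    show "w \<noteq> 0\<^sub>v (dim_row (map_mat of_int A))"
    proof
      assume "w = 0\<^sub>v (dim_row (map_mat of_int A))"
      then have "vec_index w i = vec_index (0\<^sub>v N) i" by (simp add: A_def)
      then show False using i x by (simp add: w_def)
    qed
    show "map_mat of_int A *\<^sub>v w = \<mu> \<cdot>\<^sub>v w"
    proof (rule eq_vecI)
      fix j assume "j < dim_vec (\<mu> \<cdot>\<^sub>v w)"
      then have j: "j < N" by (simp add: w_def)
      have "vec_index (map_mat of_int A *\<^sub>v w) j = (\<Sum>i\<in>{0..<N}. of_int (M (h j) (h i)) * v (h i))"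
        using j by (simp add: A_def w_def scalar_prod_def)
      also have "\<dots> = (\<Sum>b\<in>V. of_int (M (h j) b) * v b)"
        by (rule sum.reindex_bij_betw[OF h])
      also have "\<dots> = \<mu> * v (h j)"
        using v h j by (auto simp: bij_betw_def)
      finally show "vec_index (map_mat of_int A *\<^sub>v w) j = vec_index (\<mu> \<cdot>\<^sub>v w) j"
        using j by (simp add: w_def)
    qed (simp add: A_def w_def)
  qed
  then have "eigenvalue (map_mat of_int A) \<mu>" unfolding eigenvalue_def by blast
  then have "poly (map_poly of_int (char_poly A)) \<mu> = 0"
    using eigenvalue_root_char_poly[OF A'] of_int_hom.char_poly_hom[OF A] by metis
  moreover have "lead_coeff (char_poly A) = 1"
    using degree_monic_char_poly[OF A] by simp
  ultimately show ?thesis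
    unfolding algebraic_int_altdef_ipoly by blast
qed

lemma mat_trace_commute:
  fixes A B :: "'a::comm_semiring_0 mat"
  assumes "A \<in> carrier_mat n n" "B \<in> carrier_mat n n"
  shows "(\<Sum>i<n. (A * B) $$ (i, i)) = (\<Sum>i<n. (B * A) $$ (i, i))"
proof -
  have "(\<Sum>i<n. (A * B) $$ (i, i)) = (\<Sum>i<n. \<Sum>j<n. A $$ (i, j) * B $$ (j, i))"
    using assms by (intro sum.cong) (auto simp: scalar_prod_def atLeast0LessThan)
  also have "\<dots> = (\<Sum>j<n. \<Sum>i<n. B $$ (j, i) * A $$ (i, j))"
    by (subst sum.swap) (simp add: mult.commute)
  also have "\<dots> = (\<Sum>i<n. (B * A) $$ (i, i))"
    using assms by (intro sum.cong) (auto simp: scalar_prod_def atLeast0LessThan)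
  finally show ?thesis .
qed

text \<open>Schur decomposition makes \<open>A\<close> similar to an upper triangular
  \<open>B\<close>. \<open>B\<close> inherits idempotency, which forces its diagonal entries to be 0
  or 1, and the trace is a similarity invariant.\<close>

lemma idempotent_mat_trace_Ints:
  fixes A :: "complex mat"
  assumes A: "A \<in> carrier_mat n n" and idem: "A * A = A"
  shows "(\<Sum>i<n. A $$ (i, i)) \<in> \<int>"
proof -
  obtain as where "char_poly A = (\<Prod>a\<leftarrow>as. [:- a, 1:])"
    using char_poly_factorized[OF A] by blast
  then obtain B where B: "B \<in> carrier_mat n n" "upper_triangular B" "similar_mat A B"
    using schur_decomposition_exists[OF A] by blast
  then obtain P Q where "similar_mat_wit A B P Q"
    unfolding similar_mat_def by blast
  from similar_mat_witD2[OF A this]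
  have PQ: "P * Q = 1\<^sub>m n" "Q * P = 1\<^sub>m n" "A = P * B * Q" "P \<in> carrier_mat n n" "Q \<in> carrier_mat n n"
    by auto
  have QAP: "Q * A * P = B"
  proof -
    have "Q * A * P = Q * (P * B * Q) * P" by (simp add: PQ(3))
    also have "\<dots> = (Q * P) * B * (Q * P)"
      using PQ(4,5) B(1) by (simp add: assoc_mult_mat[of _ n n _ n _ n])
    finally show ?thesis using PQ B by simp
  qed
  have "B * B = (Q * A * P) * (Q * A * P)" by (simp add: QAP)
  also have "\<dots> = Q * A * ((P * Q) * (A * P))"
    using PQ(4,5) A by (simp add: assoc_mult_mat[of _ n n _ n _ n])
  also have "\<dots> = Q * A * (A * P)"
    using PQ(1,4) A by simp
  also have "\<dots> = Q * (A * A) * P"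
    using PQ(4,5) A by (simp add: assoc_mult_mat[of _ n n _ n _ n])
  finally have BB: "B * B = B" using idem QAP by simp
  have diag: "B $$ (i, i) \<in> {0, 1}" if i: "i < n" for i
  proof -
    have "B $$ (i, i) = (\<Sum>j\<in>{0..<n}. B $$ (i, j) * B $$ (j, i))"
      using arg_cong[OF BB, of "\<lambda>X. X $$ (i, i)"] i B(1) by (simp add: scalar_prod_def)
    \<comment> \<open>For \<open>j \<noteq> i\<close> one of the positions (i, j) and (j, i) lies
      below the diagonal, so the product vanishes.\<close>
    also have "\<dots> = (\<Sum>j\<in>{i}. B $$ (i, j) * B $$ (j, i))"
    proof (rule sum.mono_neutral_right)
      show "\<forall>j\<in>{0..<n} - {i}. B $$ (i, j) * B $$ (j, i) = 0"
      proof
        fix j assume "j \<in> {0..<n} - {i}"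
        then have "j < n" "j < i \<or> i < j" by auto
        then show "B $$ (i, j) * B $$ (j, i) = 0"
          using upper_triangularD[OF B(2)] B(1) i by auto
      qed
    qed (use i in auto)
    finally have "B $$ (i, i) * (B $$ (i, i) - 1) = 0" by (simp add: algebra_simps)
    then show ?thesis by auto
  qed
  have "(\<Sum>i<n. A $$ (i, i)) = (\<Sum>i<n. (P * (B * Q)) $$ (i, i))"
    using PQ(3-5) B(1) by (simp add: assoc_mult_mat[of _ n n _ n _ n])
  also have "\<dots> = (\<Sum>i<n. (B * Q * P) $$ (i, i))"
    using PQ B(1) by (intro mat_trace_commute) auto
  also have "B * Q * P = B"
    using PQ B(1) by (simp add: assoc_mult_mat[of _ n n _ n _ n])
  finally have "(\<Sum>i<n. A $$ (i, i)) = (\<Sum>i<n. B $$ (i, i))" .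
  also have "\<dots> \<in> \<int>"
  proof (rule Ints_sum)
    fix i assume "i \<in> {..<n}"
    then show "B $$ (i, i) \<in> \<int>" using diag[of i] by auto
  qed
  finally show ?thesis .
qed

lemma idempotent_kernel_trace_Ints:
  fixes K :: "'a \<Rightarrow> 'a \<Rightarrow> complex"
  assumes "finite V"
    and idem: "\<And>x z. x \<in> V \<Longrightarrow> z \<in> V \<Longrightarrow> (\<Sum>y\<in>V. K x y * K y z) = K x z"
  shows "(\<Sum>x\<in>V. K x x) \<in> \<int>"
proof -
  define N where "N = card V"
  obtain h where h: "bij_betw h {0..<N} V"
    using ex_bij_betw_nat_finite[OF \<open>finite V\<close>] unfolding N_def by blast
  define A where "A = mat N N (\<lambda>(i, j). K (h i) (h j))"
  have A: "A \<in> carrier_mat N N" by (simp add: A_def)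
  have "A * A = A"
  proof (rule eq_matI)
    fix i j assume "i < dim_row A" "j < dim_col A"
    then have ij: "i < N" "j < N" by (auto simp: A_def)
    then have "(A * A) $$ (i, j) = (\<Sum>k\<in>{0..<N}. K (h i) (h k) * K (h k) (h j))"
      by (simp add: A_def scalar_prod_def)
    also have "\<dots> = (\<Sum>y\<in>V. K (h i) y * K y (h j))"
      by (rule sum.reindex_bij_betw[OF h])
    also have "\<dots> = K (h i) (h j)"
      using ij h by (intro idem) (auto simp: bij_betw_def)
    finally show "(A * A) $$ (i, j) = A $$ (i, j)" using ij by (simp add: A_def)
  qed (use A in auto)
  from idempotent_mat_trace_Ints[OF A this]
  have "(\<Sum>i<N. K (h i) (h i)) \<in> \<int>" by (simp add: A_def)
  also have "(\<Sum>i<N. K (h i) (h i)) = (\<Sum>x\<in>V. K x x)"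
    using sum.reindex_bij_betw[OF h, of "\<lambda>x. K x x"] by (simp add: atLeast0LessThan)
  finally show ?thesis .
qed

section \<open>The group algebra of a finite group\<close>

locale finite_group = group G for G (structure) +
  assumes fin [simp, intro]: "finite (carrier G)"
begin

text \<open>Elements of the group algebra are total functions on the type; vanishing outside the
  carrier makes the representatives unique, so that identities can be stated as equations of
  functions.\<close>

definition supp :: "('a \<Rightarrow> complex) \<Rightarrow> bool" where
  "supp u \<longleftrightarrow> (\<forall>x. x \<notin> carrier G \<longrightarrow> u x = 0)"

definition class_fun :: "('a \<Rightarrow> complex) \<Rightarrow> bool" where
  "class_fun u \<longleftrightarrow> supp u \<and>
     (\<forall>g\<in>carrier G. \<forall>x\<in>carrier G. u (x \<otimes> g \<otimes> inv x) = u g)"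

definition conv :: "('a \<Rightarrow> complex) \<Rightarrow> ('a \<Rightarrow> complex) \<Rightarrow> 'a \<Rightarrow> complex" (infixl \<open>\<star>\<close> 70) where
  "(u \<star> v) x = (if x \<in> carrier G then \<Sum>y\<in>carrier G. u y * v (inv y \<otimes> x) else 0)"

definition delta :: "'a \<Rightarrow> 'a \<Rightarrow> complex" where
  "delta g x = (if x = g then 1 else 0)"

text \<open>Left convolution by \<open>star u\<close> is the adjoint of left convolution by
  \<open>u\<close> for the standard Hermitian form on functions on the group.\<close>

definition star :: "('a \<Rightarrow> complex) \<Rightarrow> 'a \<Rightarrow> complex" where
  "star u x = (if x \<in> carrier G then cnj (u (inv x)) else 0)"

lemma mult_inv_cancel [simp]:
  assumes "x \<in> carrier G" "y \<in> carrier G"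
  shows "inv x \<otimes> (x \<otimes> y) = y" "x \<otimes> (inv x \<otimes> y) = y"
  using assms by (simp_all flip: m_assoc)

lemma class_fun_supp: "class_fun u \<Longrightarrow> supp u"
  by (simp add: class_fun_def)

lemma supp_conv [simp, intro]: "supp (u \<star> v)"
  by (simp add: supp_def conv_def)

lemma supp_delta [simp, intro]: "g \<in> carrier G \<Longrightarrow> supp (delta g)"
  by (auto simp: supp_def delta_def)

lemma conv_add_left: "(\<lambda>x. u x + v x) \<star> w = (\<lambda>x. (u \<star> w) x + (v \<star> w) x)"
  by (rule ext) (simp add: conv_def algebra_simps sum.distrib)

lemma conv_add_right: "w \<star> (\<lambda>x. u x + v x) = (\<lambda>x. (w \<star> u) x + (w \<star> v) x)"
  by (rule ext) (simp add: conv_def algebra_simps sum.distrib)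

lemma conv_scale_left: "(\<lambda>x. c * u x) \<star> w = (\<lambda>x. c * (u \<star> w) x)"
  by (rule ext) (simp add: conv_def algebra_simps sum_distrib_left)

lemma conv_scale_right: "w \<star> (\<lambda>x. c * u x) = (\<lambda>x. c * (w \<star> u) x)"
  by (rule ext) (simp add: conv_def algebra_simps sum_distrib_left)

lemma conv_zero_left [simp]: "(\<lambda>x. 0) \<star> w = (\<lambda>x. 0)"
  by (rule ext) (simp add: conv_def)

lemma conv_zero_right [simp]: "w \<star> (\<lambda>x. 0) = (\<lambda>x. 0)"
  by (rule ext) (simp add: conv_def)

lemma conv_sum_left: "(\<lambda>x. \<Sum>i\<in>I. u i x) \<star> w = (\<lambda>x. \<Sum>i\<in>I. (u i \<star> w) x)"
proof (rule ext)
  fix x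
  show "((\<lambda>x. \<Sum>i\<in>I. u i x) \<star> w) x = (\<Sum>i\<in>I. (u i \<star> w) x)"
    unfolding conv_def using sum.swap[of "\<lambda>y i. u i y * w (inv y \<otimes> x)" I "carrier G"]
    by (simp add: sum_distrib_right)
qed

lemma conv_sum_right: "w \<star> (\<lambda>x. \<Sum>i\<in>I. u i x) = (\<lambda>x. \<Sum>i\<in>I. (w \<star> u i) x)"
proof (rule ext)
  fix x
  show "(w \<star> (\<lambda>x. \<Sum>i\<in>I. u i x)) x = (\<Sum>i\<in>I. (w \<star> u i) x)"
    unfolding conv_def using sum.swap[of "\<lambda>y i. w y * u i (inv y \<otimes> x)" I "carrier G"]
    by (simp add: sum_distrib_left)
qed

lemma bij_inv: "bij_betw (\<lambda>x. inv x) (carrier G) (carrier G)"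
  by (rule bij_betw_byWitness[where f' = "\<lambda>x. inv x"]) auto

lemma bij_mult_left: "a \<in> carrier G \<Longrightarrow> bij_betw (\<lambda>x. a \<otimes> x) (carrier G) (carrier G)"
  by (rule bij_betw_byWitness[where f' = "\<lambda>x. inv a \<otimes> x"]) (auto simp: m_assoc[symmetric])

lemma bij_mult_right: "a \<in> carrier G \<Longrightarrow> bij_betw (\<lambda>x. x \<otimes> a) (carrier G) (carrier G)"
  by (rule bij_betw_byWitness[where f' = "\<lambda>x. x \<otimes> inv a"]) (auto simp: m_assoc)

lemma conv_assoc: "(u \<star> v) \<star> w = u \<star> (v \<star> w)"
proof (rule ext)
  fix x
  show "((u \<star> v) \<star> w) x = (u \<star> (v \<star> w)) x"
  proof (cases "x \<in> carrier G")
    case x: True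
    have "((u \<star> v) \<star> w) x = (\<Sum>y\<in>carrier G. \<Sum>z\<in>carrier G. u z * v (inv z \<otimes> y) * w (inv y \<otimes> x))"
      using x by (simp add: conv_def sum_distrib_right)
    also have "\<dots> = (\<Sum>z\<in>carrier G. \<Sum>y\<in>carrier G. u z * v (inv z \<otimes> y) * w (inv y \<otimes> x))"
      by (rule sum.swap)
    also have "\<dots> = (\<Sum>z\<in>carrier G. \<Sum>y\<in>carrier G. u z * v (inv z \<otimes> (z \<otimes> y)) * w (inv (z \<otimes> y) \<otimes> x))"
      by (intro sum.cong refl sum.reindex_bij_betw[symmetric] bij_mult_left)
    also have "\<dots> = (\<Sum>z\<in>carrier G. \<Sum>y\<in>carrier G. u z * (v y * w (inv y \<otimes> (inv z \<otimes> x))))"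
    proof (intro sum.cong refl)
      fix z y assume zy: "z \<in> carrier G" "y \<in> carrier G"
      have "inv z \<otimes> (z \<otimes> y) = y" using zy by (simp add: m_assoc[symmetric])
      moreover have "inv (z \<otimes> y) \<otimes> x = inv y \<otimes> (inv z \<otimes> x)"
        using zy x by (simp add: inv_mult_group m_assoc)
      ultimately show "u z * v (inv z \<otimes> (z \<otimes> y)) * w (inv (z \<otimes> y) \<otimes> x)
          = u z * (v y * w (inv y \<otimes> (inv z \<otimes> x)))" by simp
    qed
    also have "\<dots> = (u \<star> (v \<star> w)) x"
      using x by (simp add: conv_def sum_distrib_left)
    finally show ?thesis .
  qed (simp add: conv_def)
qed

lemma delta_conv:
  assumes "g \<in> carrier G" "x \<in> carrier G"
  shows "(delta g \<star> u) x = u (inv g \<otimes> x)"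
  using assms by (simp add: conv_def delta_def if_distrib[of "\<lambda>c. c * _"] sum.delta cong: if_cong)

lemma conv_delta_one: "supp u \<Longrightarrow> u \<star> delta \<one> = u"
proof (rule ext)
  fix x assume u: "supp u"
  show "(u \<star> delta \<one>) x = u x"
  proof (cases "x \<in> carrier G")
    case True
    have "(u \<star> delta \<one>) x = (\<Sum>y\<in>carrier G. u y * (if y = x then 1 else 0))"
      using True by (auto simp: conv_def delta_def intro!: sum.cong)
        (metis inv_equality inv_inv inv_closed)+
    also have "\<dots> = (\<Sum>y\<in>carrier G. if y = x then u y else 0)"
      by (intro sum.cong) auto
    also have "\<dots> = u x" using True by simp
    finally show ?thesis .
  qed (use u in \<open>auto simp: conv_def supp_def\<close>)
qed

lemma delta_one_conv: "supp u \<Longrightarrow> delta \<one> \<star> u = u"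
  using delta_conv[of \<one>] by (intro ext) (auto simp: conv_def supp_def)

lemma conv_delta_delta:
  assumes "g \<in> carrier G" "h \<in> carrier G"
  shows "delta g \<star> delta h = delta (g \<otimes> h)"
proof (rule ext)
  fix x
  show "(delta g \<star> delta h) x = delta (g \<otimes> h) x"
  proof (cases "x \<in> carrier G")
    case True
    then show ?thesis using assms by (simp add: delta_conv) (auto simp: delta_def inv_solve_left')
  qed (use assms in \<open>auto simp: conv_def delta_def\<close>)
qed

text \<open>Class functions are central. After the substitution of \<open>x \<otimes> inv z\<close>
  for \<open>y\<close> the two factors of each summand change places, because
  \<open>x \<otimes> inv z\<close> and \<open>inv z \<otimes> x\<close> are conjugate by
  \<open>z\<close>.\<close>

lemma class_fun_conv_commute:
  assumes u: "class_fun u"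
  shows "u \<star> v = v \<star> u"
proof (rule ext)
  fix x
  show "(u \<star> v) x = (v \<star> u) x"
  proof (cases "x \<in> carrier G")
    case x: True
    have bij: "bij_betw (\<lambda>z. x \<otimes> inv z) (carrier G) (carrier G)"
      using bij_betw_trans[OF bij_inv bij_mult_left[OF x]] by (simp add: o_def)
    have "(u \<star> v) x = (\<Sum>y\<in>carrier G. u y * v (inv y \<otimes> x))"
      using x by (simp add: conv_def)
    also have "\<dots> = (\<Sum>z\<in>carrier G. u (x \<otimes> inv z) * v (inv (x \<otimes> inv z) \<otimes> x))"
      by (rule sum.reindex_bij_betw[OF bij, symmetric])
    also have "\<dots> = (\<Sum>z\<in>carrier G. v z * u (inv z \<otimes> x))"
    proof (rule sum.cong[OF refl])
      fix z assume z: "z \<in> carrier G"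
      have "inv (x \<otimes> inv z) \<otimes> x = z"
        using x z by (simp add: inv_mult_group m_assoc)
      moreover have "u (x \<otimes> inv z) = u (inv z \<otimes> x)"
      proof -
        have "u (z \<otimes> (inv z \<otimes> x) \<otimes> inv z) = u (inv z \<otimes> x)"
          using u x z unfolding class_fun_def by blast
        then show ?thesis using x z by simp
      qed
      ultimately show "u (x \<otimes> inv z) * v (inv (x \<otimes> inv z) \<otimes> x) = v z * u (inv z \<otimes> x)"
        by (simp add: mult.commute)
    qed
    finally show ?thesis using x by (simp add: conv_def)
  qed (simp add: conv_def)
qed

lemma class_fun_delta_one: "class_fun (delta \<one>)"
proof -
  have "x \<otimes> g \<otimes> inv x = \<one> \<longleftrightarrow> g = \<one>" if "x \<in> carrier G" "g \<in> carrier G" for x g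
  proof
    assume "x \<otimes> g \<otimes> inv x = \<one>"
    then have "x \<otimes> g = x" using that by (metis inv_equality inv_inv m_closed inv_closed)
    then show "g = \<one>" using that by simp
  qed (use that in simp)
  then show ?thesis by (auto simp: class_fun_def delta_def supp_def)
qed

lemma class_fun_add: "class_fun u \<Longrightarrow> class_fun v \<Longrightarrow> class_fun (\<lambda>x. u x + v x)"
  by (auto simp: class_fun_def supp_def)

lemma class_fun_scale: "class_fun u \<Longrightarrow> class_fun (\<lambda>x. c * u x)"
  by (auto simp: class_fun_def supp_def)

lemma class_fun_zero: "class_fun (\<lambda>x. 0)"
  by (auto simp: class_fun_def supp_def)

lemma class_fun_conv:
  assumes u: "class_fun u" and v: "class_fun v"
  shows "class_fun (u \<star> v)"
  unfolding class_fun_def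
proof (intro conjI ballI)
  fix g x assume g: "g \<in> carrier G" and x: "x \<in> carrier G"
  have bij: "bij_betw (\<lambda>y. x \<otimes> y \<otimes> inv x) (carrier G) (carrier G)"
    using bij_betw_trans[OF bij_mult_left[OF x] bij_mult_right[OF inv_closed[OF x]]]
    by (simp add: o_def)
  have "(u \<star> v) (x \<otimes> g \<otimes> inv x) = (\<Sum>y\<in>carrier G. u y * v (inv y \<otimes> (x \<otimes> g \<otimes> inv x)))"
    using g x by (simp add: conv_def)
  also have "\<dots> = (\<Sum>y\<in>carrier G. u (x \<otimes> y \<otimes> inv x) * v (inv (x \<otimes> y \<otimes> inv x) \<otimes> (x \<otimes> g \<otimes> inv x)))"
    by (rule sum.reindex_bij_betw[OF bij, symmetric])
  also have "\<dots> = (\<Sum>y\<in>carrier G. u y * v (inv y \<otimes> g))"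
  proof (rule sum.cong[OF refl])
    fix y assume y: "y \<in> carrier G"
    have "inv (x \<otimes> y \<otimes> inv x) \<otimes> (x \<otimes> g \<otimes> inv x) = x \<otimes> inv y \<otimes> (inv x \<otimes> x) \<otimes> g \<otimes> inv x"
      using x y g by (simp add: inv_mult_group m_assoc del: l_inv)
    also have "\<dots> = x \<otimes> (inv y \<otimes> g) \<otimes> inv x"
      using x y g by (simp add: m_assoc)
    finally show "u (x \<otimes> y \<otimes> inv x) * v (inv (x \<otimes> y \<otimes> inv x) \<otimes> (x \<otimes> g \<otimes> inv x)) = u y * v (inv y \<otimes> g)"
      using u v x y g unfolding class_fun_def by simp
  qed
  finally show "(u \<star> v) (x \<otimes> g \<otimes> inv x) = (u \<star> v) g"
    using g by (simp add: conv_def)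
qed simp

lemma class_fun_star: 
  assumes u: "class_fun u"
  shows "class_fun (star u)"
  unfolding class_fun_def
proof (intro conjI ballI)
  show "supp (star u)" by (simp add: supp_def star_def)
  fix g x assume g: "g \<in> carrier G" and x: "x \<in> carrier G"
  have "inv (x \<otimes> g \<otimes> inv x) = x \<otimes> inv g \<otimes> inv x"
    using g x by (simp add: inv_mult_group m_assoc)
  then show "star u (x \<otimes> g \<otimes> inv x) = star u g"
    using u g x by (simp add: star_def class_fun_def)
qed

lemma star_conv: "star (u \<star> v) = star v \<star> star u"
proof (rule ext)
  fix x
  show "star (u \<star> v) x = (star v \<star> star u) x"
  proof (cases "x \<in> carrier G")
    case x: True
    have "star (u \<star> v) x = (\<Sum>y\<in>carrier G. cnj (u y) * cnj (v (inv y \<otimes> inv x)))"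
      using x by (simp add: star_def conv_def)
    also have "\<dots> = (\<Sum>y\<in>carrier G. cnj (u (inv x \<otimes> y)) * cnj (v (inv (inv x \<otimes> y) \<otimes> inv x)))"
      by (rule sum.reindex_bij_betw[OF bij_mult_left, symmetric]) (use x in simp)
    also have "\<dots> = (\<Sum>y\<in>carrier G. star v y * star u (inv y \<otimes> x))"
      using x by (intro sum.cong refl) (simp add: star_def inv_mult_group m_assoc mult.commute)
    finally show ?thesis using x by (simp add: conv_def)
  qed (simp add: star_def conv_def)
qed

lemma star_star: "supp u \<Longrightarrow> star (star u) = u"
  by (rule ext) (auto simp: star_def supp_def)

section \<open>Positivity of the involution and its consequences for class functions\<close>

lemma conv_star_one: "(u \<star> star u) \<one> = (\<Sum>x\<in>carrier G. of_real ((cmod (u x))\<^sup>2))"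
  using complex_norm_square by (simp add: conv_def star_def)

lemma conv_star_eq_zero:
  assumes "supp u" "u \<star> star u = (\<lambda>x. 0)"
  shows "u = (\<lambda>x. 0)"
proof (rule ext)
  fix x
  have "of_real (\<Sum>x\<in>carrier G. (cmod (u x))\<^sup>2) = (0 :: complex)"
    using conv_star_one[of u] assms(2) by simp
  then have "(\<Sum>x\<in>carrier G. (cmod (u x))\<^sup>2) = 0" by (simp only: of_real_eq_0_iff)
  then have "\<forall>x\<in>carrier G. (cmod (u x))\<^sup>2 = 0"
    by (subst (asm) sum_nonneg_eq_0_iff) auto
  then show "u x = 0" using assms(1) by (cases "x \<in> carrier G") (auto simp: supp_def)
qed

text \<open>Positivity is used twice. The function \<open>w\<close> is self-adjoint and, since
  \<open>u\<close> commutes with its adjoint, squares to zero; so \<open>w\<close> convolved with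
  its own adjoint is zero, hence \<open>w\<close> vanishes, and then \<open>u\<close> does.\<close>

lemma class_fun_square_eq_zero:
  assumes u: "class_fun u" and sq: "u \<star> u = (\<lambda>x. 0)"
  shows "u = (\<lambda>x. 0)"
proof -
  define w where "w = u \<star> star u"
  have cs: "class_fun (star u)" by (rule class_fun_star[OF u])
  have "star w = w"
    unfolding w_def star_conv star_star[OF class_fun_supp[OF u]] ..
  moreover have "w \<star> w = (\<lambda>x. 0)"
  proof -
    have "w \<star> w = u \<star> (star u \<star> u) \<star> star u" by (simp add: w_def conv_assoc)
    also have "\<dots> = u \<star> (u \<star> star u) \<star> star u" by (simp add: class_fun_conv_commute[OF cs])
    also have "\<dots> = (u \<star> u) \<star> star u \<star> star u" by (simp add: conv_assoc)
    finally show ?thesis by (simp add: sq)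
  qed
  ultimately have "w = (\<lambda>x. 0)"
    using conv_star_eq_zero[of w] by (simp add: w_def)
  then show ?thesis
    using conv_star_eq_zero[OF class_fun_supp[OF u]] by (simp add: w_def)
qed

text \<open>With y = e - e s, commutativity and idempotency make \<open>y \<star> star y\<close>
  vanish. Positivity then gives e = e s, whose value at the identity is the squared norm of
  \<open>e\<close>. This value is the factor that is divided out of the trace identities
  later.\<close>

lemma class_fun_idempotent_at_one:
  assumes e: "class_fun e" and idem: "e \<star> e = e" and nz: "e \<noteq> (\<lambda>x. 0)"
  shows "e \<one> \<noteq> 0"
proof -
  define s where "s = star e"
  have s: "class_fun s" unfolding s_def by (rule class_fun_star[OF e])
  have ss: "s \<star> s = s"
    unfolding s_def by (metis idem star_conv)
  define y where "y = (\<lambda>x. e x + (-1) * (e \<star> s) x)"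
  have cy: "class_fun y"
    unfolding y_def by (intro class_fun_add class_fun_scale class_fun_conv e s)
  have ces: "s \<star> e = e \<star> s" by (rule class_fun_conv_commute[OF s])
  have ees: "e \<star> (e \<star> s) = e \<star> s" by (simp add: conv_assoc[symmetric] idem)
  have ess: "e \<star> s \<star> s = e \<star> s" by (simp add: conv_assoc ss)
  have eses: "e \<star> s \<star> (e \<star> s) = e \<star> s"
    by (metis conv_assoc ces ess ees)
  have "star y = (\<lambda>x. s x + (-1) * (e \<star> s) x)"
  proof -
    have "star y = (\<lambda>x. star e x + (-1) * star (e \<star> s) x)"
      by (rule ext) (simp add: y_def star_def)
    also have "star (e \<star> s) = e \<star> s"
      by (simp add: s_def star_conv star_star class_fun_supp[OF e])
    finally show ?thesis by (simp add: s_def)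
  qed
  then have "y \<star> star y = (\<lambda>x. 0)"
    unfolding y_def
    by (simp only: conv_add_left conv_add_right conv_scale_left conv_scale_right ees ess eses) simp
  then have "y = (\<lambda>x. 0)"
    by (rule conv_star_eq_zero[OF class_fun_supp[OF cy]])
  then have "e = e \<star> s"
    by (auto simp: y_def fun_eq_iff)
  then have one: "e \<one> = of_real (\<Sum>x\<in>carrier G. (cmod (e x))\<^sup>2)"
    using conv_star_one[of e] unfolding s_def by simp
  show ?thesis
  proof
    assume "e \<one> = 0"
    then have "(\<Sum>x\<in>carrier G. (cmod (e x))\<^sup>2) = 0" using one by (simp only: of_real_eq_0_iff)
    then have "\<forall>x\<in>carrier G. (cmod (e x))\<^sup>2 = 0"
      by (subst (asm) sum_nonneg_eq_0_iff) auto
    then have "e = (\<lambda>x. 0)"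
      using class_fun_supp[OF e] by (intro ext) (auto simp: supp_def)
    with nz show False by simp
  qed
qed

text \<open>The regular trace of \<open>u\<close> is \<open>card (carrier G) * u \<one>\<close>, and the trace of an idempotent is its rank.\<close>

lemma idempotent_at_one_Ints:
  assumes idem: "u \<star> u = u"
  shows "of_nat (card (carrier G)) * u \<one> \<in> \<int>"
proof -
  have "(\<Sum>x\<in>carrier G. u (x \<otimes> inv x)) \<in> \<int>"
  \<comment> \<open>This kernel is the matrix of left convolution by \<open>u\<close>; all its
    diagonal entries equal \<open>u \<one>\<close>.\<close>
  proof (rule idempotent_kernel_trace_Ints[where K = "\<lambda>x y. u (x \<otimes> inv y)"])
    fix x z assume x: "x \<in> carrier G" and z: "z \<in> carrier G"
    have bij: "bij_betw (\<lambda>y. inv y \<otimes> x) (carrier G) (carrier G)"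
      using bij_betw_trans[OF bij_inv bij_mult_right[OF x]] by (simp add: o_def)
    have "(\<Sum>y\<in>carrier G. u (x \<otimes> inv y) * u (y \<otimes> inv z))
        = (\<Sum>y\<in>carrier G. u (x \<otimes> inv (inv y \<otimes> x)) * u (inv y \<otimes> x \<otimes> inv z))"
      by (rule sum.reindex_bij_betw[OF bij, symmetric])
    also have "\<dots> = (u \<star> u) (x \<otimes> inv z)"
      using x z by (simp add: conv_def inv_mult_group m_assoc[symmetric])
    finally show "(\<Sum>y\<in>carrier G. u (x \<otimes> inv y) * u (y \<otimes> inv z)) = u (x \<otimes> inv z)"
      by (simp add: idem)
  qed simp
  then show ?thesis by simp
qed

end

section \<open>Idempotents and traces\<close>

definition unity_root :: "nat \<Rightarrow> complex" where
  "unity_root n = cis (2 * pi / real n)"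

lemma unity_root_power_eq_iff:
  assumes "n > 0"
  shows "unity_root n ^ j = unity_root n ^ k \<longleftrightarrow> [j = k] (mod n)"
proof -
  have "unity_root n ^ j = exp (2 * of_real pi * \<i> * of_nat j / of_nat n)" for j
    unfolding unity_root_def Complex.DeMoivre by (simp add: cis_conv_exp mult_ac)
  then show ?thesis
    using complex_root_unity_eq[of n j k] assms by (simp add: Cong.cong_def)
qed

lemma unity_root_power_self [simp]: "n > 0 \<Longrightarrow> unity_root n ^ n = 1"
  using unity_root_power_eq_iff[of n n 0] by (simp add: Cong.cong_def)

lemma unity_root_nonzero [simp]: "unity_root n \<noteq> 0"
  by (simp add: unity_root_def)

lemma sum_powers_unity:
  fixes x :: "'a::field"
  assumes "x ^ n = 1"
  shows "(\<Sum>j<n. x ^ j) = (if x = 1 then of_nat n else 0)"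
  using assms geometric_sum[of x n] by auto

lemma sum_periodic_shift:
  fixes F :: "nat \<Rightarrow> 'a::comm_monoid_add"
  assumes "\<And>m. F (m + n) = F m"
  shows "(\<Sum>i<n. F (i + k)) = (\<Sum>i<n. F i)"
proof (induction k)
  case (Suc k)
  show ?case
  proof (cases n)
    case (Suc m)
    have "(\<Sum>i<n. F (i + Suc k)) = (\<Sum>i<m. F (Suc i + k)) + F (n + k)"
      by (simp add: Suc)
    also have "F (n + k) = F (0 + k)" using assms[of k] by (simp add: add.commute)
    also have "(\<Sum>i<m. F (Suc i + k)) + F (0 + k) = (\<Sum>i<n. F (i + k))"
      unfolding Suc sum.lessThan_Suc_shift by (simp add: add.commute)
    finally show ?thesis using Suc.IH by simp
  qed simp
qed simp

text \<open>Gaussian elimination, one equation at a time: an unknown \<open>i0\<close> with nonzero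
  coefficient in equation \<open>x\<close> is eliminated, which costs one equation and one unknown
  and so keeps the unknowns in excess. An equation with only zero coefficients is dropped.\<close>

lemma homogeneous_system_nontrivial:
  fixes v :: "'i \<Rightarrow> 'b \<Rightarrow> 'c::field"
  assumes "finite S" "finite I" "card S < card I"
  shows "\<exists>c. (\<exists>i\<in>I. c i \<noteq> 0) \<and> (\<forall>x\<in>S. (\<Sum>i\<in>I. c i * v i x) = 0)"
  using assms
proof (induction S arbitrary: I v rule: finite_induct)
  case empty
  then obtain i where "i \<in> I" by fastforce
  then show ?case by (intro exI[of _ "\<lambda>_. 1"]) auto
next
  case (insert x S)
  show ?case
  proof (cases "\<forall>i\<in>I. v i x = 0")
    case True
    obtain c where "\<exists>i\<in>I. c i \<noteq> 0" "\<forall>x\<in>S. (\<Sum>i\<in>I. c i * v i x) = 0"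
      using insert.IH[of I v] insert.prems insert.hyps by auto
    then show ?thesis using True by (intro exI[of _ c]) auto
  next
    case False
    then obtain i0 where i0: "i0 \<in> I" "v i0 x \<noteq> 0" by blast
    define J where "J = I - {i0}"
    have J: "finite J" "card S < card J" "i0 \<notin> J" "I = insert i0 J"
      using insert.prems insert.hyps i0 by (auto simp: J_def)
    obtain c where c: "\<exists>i\<in>J. c i \<noteq> 0"
      "\<And>y. y \<in> S \<Longrightarrow> (\<Sum>i\<in>J. c i * (v i y - v i x / v i0 x * v i0 y)) = 0"
      using insert.IH[OF J(1,2), of "\<lambda>i y. v i y - v i x / v i0 x * v i0 y"] by blast
    \<comment> \<open>Equation \<open>x\<close> forces this value of the eliminated unknown.\<close>
    define d where "d = c(i0 := - (\<Sum>i\<in>J. c i * v i x / v i0 x))"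
    have d: "(\<Sum>i\<in>I. d i * v i y) = (\<Sum>i\<in>J. c i * (v i y - v i x / v i0 x * v i0 y))" for y
    proof -
      have "(\<Sum>i\<in>J. d i * v i y) = (\<Sum>i\<in>J. c i * v i y)"
        using J(3) by (intro sum.cong) (auto simp: d_def)
      then show ?thesis
        unfolding J(4) using J(1,3)
        by (simp add: d_def algebra_simps sum_subtractf sum_distrib_left sum_distrib_right)
    qed
    have "(\<Sum>i\<in>I. d i * v i x) = 0"
      unfolding d using i0(2) by simp
    moreover have "\<exists>i\<in>I. d i \<noteq> 0"
      using c(1) J(3,4) by (auto simp: d_def)
    ultimately show ?thesis
      using c(2) by (intro exI[of _ d]) (auto simp: d)
  qed
qed

section \<open>Polynomials in a central element and the idempotents they produce\<close>

context finite_group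
begin

text \<open>The element p(a) u by Horner's scheme, with \<open>u\<close> in the place of the unit.
  For a central idempotent \<open>u\<close> this is evaluation of polynomials inside the ideal
  generated by \<open>u\<close>, whose identity is \<open>u\<close>.\<close>

definition pev :: "('a \<Rightarrow> complex) \<Rightarrow> ('a \<Rightarrow> complex) \<Rightarrow> complex poly \<Rightarrow> 'a \<Rightarrow> complex" where
  "pev a u p = fold_coeffs (\<lambda>c v x. c * u x + (a \<star> v) x) p (\<lambda>x. 0)"

lemma pev_0 [simp]: "pev a u 0 = (\<lambda>x. 0)"
  by (simp add: pev_def)

lemma pev_pCons: "pev a u (pCons c p) = (\<lambda>x. c * u x + (a \<star> pev a u p) x)"
proof (cases "p = 0 \<and> c = 0")
  case False
  then have "pCons c p = 0 \<longleftrightarrow> False" by auto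
  then show ?thesis using False by (auto simp: pev_def fold_coeffs_pCons_not_0_0_eq fold_coeffs_pCons_coeff_not_0_eq)
qed auto

lemma pev_add: "pev a u (p + q) = (\<lambda>x. pev a u p x + pev a u q x)"
  by (induction p q rule: poly_induct2) (simp_all add: pev_pCons conv_add_right algebra_simps)

lemma pev_smult: "pev a u (Polynomial.smult c p) = (\<lambda>x. c * pev a u p x)"
  by (induction p) (simp_all add: pev_pCons conv_scale_right algebra_simps)

lemma pev_class_fun: "class_fun a \<Longrightarrow> class_fun u \<Longrightarrow> class_fun (pev a u p)"
  by (induction p) (simp_all add: pev_pCons class_fun_zero class_fun_add class_fun_scale class_fun_conv)

lemma conv_pev: 
  assumes "class_fun a" "class_fun u" "u \<star> u = u"
  shows "u \<star> pev a u p = pev a u p"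
proof (induction p)
  case (pCons c p)
  have "u \<star> (a \<star> pev a u p) = a \<star> (u \<star> pev a u p)"
    by (metis assms(1) class_fun_conv_commute conv_assoc)
  then show ?case using pCons.IH assms(3) by (simp add: pev_pCons conv_add_right conv_scale_right)
qed simp

text \<open>Applied to \<open>v\<close> of the form \<open>pev a u r\<close> it computes a square,
  which is how idempotents arise from a factor of the minimal polynomial; applied to an eigenvector
  it shows that the eigenvalue is a root.\<close>

lemma pev_conv_eigen:
  assumes "u \<star> v = v" "a \<star> v = (\<lambda>x. \<theta> * v x)"
  shows "pev a u p \<star> v = (\<lambda>x. poly p \<theta> * v x)"
proof (induction p)
  case (pCons c p)
  have "a \<star> pev a u p \<star> v = (\<lambda>x. poly p \<theta> * (\<theta> * v x))"
    by (simp add: conv_assoc pCons.IH conv_scale_right assms(2))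
  then show ?case using assms(1)
    by (simp add: pev_pCons conv_add_left conv_scale_left algebra_simps)
qed simp

text \<open>The functions a^i u for i up to \<open>card (carrier G)\<close> are one more in number
  than the points of the carrier, so they are linearly dependent there; outside the carrier all of
  them vanish.\<close>

lemma exists_annihilating_poly:
  "\<exists>p. p \<noteq> 0 \<and> pev a u p = (\<lambda>x. 0)" if "supp u"
proof -
  let ?N = "card (carrier G)"
  define v where "v i = pev a u (monom 1 i)" for i
  obtain c where c: "\<exists>i\<in>{..?N}. c i \<noteq> 0" "\<forall>x\<in>carrier G. (\<Sum>i\<in>{..?N}. c i * v i x) = 0"
    using homogeneous_system_nontrivial[of "carrier G" "{..?N}" v] by auto
  define p where "p = (\<Sum>i\<in>{..?N}. monom (c i) i)"
  have pev_sum: "pev a u (\<Sum>i\<in>I. monom (c i) i) = (\<lambda>x. \<Sum>i\<in>I. c i * v i x)" if "finite I" for I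
    using that
  proof (induction I)
    case (insert i I)
    have "pev a u (monom (c i) i) = (\<lambda>x. c i * v i x)"
      using pev_smult[of a u "c i" "monom 1 i"] by (simp add: smult_monom v_def)
    then show ?case using insert by (simp add: pev_add)
  qed simp
  have supp: "supp (pev a u q)" for q
    using that by (induction q) (auto simp: pev_pCons supp_def conv_def)
  have "pev a u p x = 0" for x
  proof (cases "x \<in> carrier G")
    case True
    then show ?thesis using c(2) by (simp add: p_def pev_sum)
  next
    case False
    then show ?thesis using supp by (auto simp: supp_def)
  qed
  moreover obtain i where "i \<le> ?N" "c i \<noteq> 0" using c(1) by auto
  then have "coeff p i \<noteq> 0" by (simp add: p_def coeff_sum if_distrib sum.delta cong: if_cong)
  then have "p \<noteq> 0" by auto
  ultimately show ?thesis by blast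
qed

text \<open>Since class functions contain no nilpotents, a root \<open>\<theta>\<close> of the minimal polynomial is simple,
  and dividing out its linear factor leaves a multiple of an idempotent.\<close>

lemma minimal_poly_idempotents:
  assumes a: "class_fun a" and u: "class_fun u" "u \<star> u = u" "u \<noteq> (\<lambda>x. 0)"
  obtains p where "pev a u p = (\<lambda>x. 0)" and "degree p > 0"
    and "\<And>\<theta>. poly p \<theta> = 0 \<Longrightarrow>
       \<exists>e. class_fun e \<and> e \<star> e = e \<and> e \<noteq> (\<lambda>x. 0) \<and> u \<star> e = e \<and> a \<star> e = (\<lambda>x. \<theta> * e x)"
    and "a \<star> u \<noteq> (\<lambda>x. 0) \<Longrightarrow> \<exists>\<theta>. \<theta> \<noteq> 0 \<and> poly p \<theta> = 0"
proof -
  define P where "P = (\<lambda>p. p \<noteq> 0 \<and> pev a u p = (\<lambda>x. 0))"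
  have "\<exists>p. P p"
    using exists_annihilating_poly[OF class_fun_supp[OF u(1)]] by (auto simp: P_def)
  \<comment> \<open>Least degree means that \<open>p\<close> is, up to a scalar, the minimal
    polynomial of \<open>a\<close> on the ideal generated by \<open>u\<close>.\<close>
  then obtain p where p: "P p" and min: "\<And>q. P q \<Longrightarrow> degree p \<le> degree q"
    using ex_has_least_nat[of P _ degree] by blast
  have pz: "p \<noteq> 0" "pev a u p = (\<lambda>x. 0)" using p by (auto simp: P_def)
  have deg: "degree p > 0"
  proof (rule ccontr)
    assume "\<not> degree p > 0"
    then obtain c where c: "p = [:c:]" using degree_eq_zeroE by blast
    then have "c \<noteq> 0" using pz by auto
    moreover have "(\<lambda>x. c * u x) = (\<lambda>x. 0)" using pz c by (simp add: pev_pCons)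
    ultimately show False using u(3) by (auto simp: fun_eq_iff)
  qed
  have factor: "\<exists>r. p = [:-\<theta>, 1:] * r \<and> poly r \<theta> \<noteq> 0 \<and> class_fun (pev a u r) \<and> pev a u r \<noteq> (\<lambda>x. 0) \<and>
      u \<star> pev a u r = pev a u r \<and> a \<star> pev a u r = (\<lambda>x. \<theta> * pev a u r x) \<and>
      pev a u r \<star> pev a u r = (\<lambda>x. poly r \<theta> * pev a u r x)"
    if root: "poly p \<theta> = 0" for \<theta>
  proof -
    obtain r where r: "p = [:-\<theta>, 1:] * r" using root unfolding poly_eq_0_iff_dvd by (elim dvdE)
    have r0: "r \<noteq> 0" using r pz by auto
    have "degree p = Suc (degree r)" using r0 unfolding r by (subst degree_mult_eq) auto
    then have nz: "pev a u r \<noteq> (\<lambda>x. 0)" using min[of r] r0 by (auto simp: P_def)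
    have cf: "class_fun (pev a u r)" by (rule pev_class_fun[OF a u(1)])
    have ue: "u \<star> pev a u r = pev a u r" by (rule conv_pev[OF a u(1,2)])
    have "p = Polynomial.smult (-\<theta>) r + pCons 0 r" by (simp add: r)
    then have "pev a u p = (\<lambda>x. -\<theta> * pev a u r x + (a \<star> pev a u r) x)"
      by (simp only: pev_add pev_smult pev_pCons) simp
    then have ae: "a \<star> pev a u r = (\<lambda>x. \<theta> * pev a u r x)"
      using pz by (auto simp: fun_eq_iff)
    have ee: "pev a u r \<star> pev a u r = (\<lambda>x. poly r \<theta> * pev a u r x)"
      by (rule pev_conv_eigen[OF ue ae])
    \<comment> \<open>Otherwise the nonzero class function \<open>pev a u r\<close> would square to
      zero.\<close>
    have "poly r \<theta> \<noteq> 0"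
      using class_fun_square_eq_zero[OF cf] nz ee by auto
    then show ?thesis using r nz cf ue ae ee by blast
  qed
  show thesis
  proof (rule that[OF pz(2) deg])
    fix \<theta> assume "poly p \<theta> = 0"
    from factor[OF this] obtain r where r: "poly r \<theta> \<noteq> 0" "class_fun (pev a u r)"
      "pev a u r \<noteq> (\<lambda>x. 0)" "u \<star> pev a u r = pev a u r"
      "a \<star> pev a u r = (\<lambda>x. \<theta> * pev a u r x)"
      "pev a u r \<star> pev a u r = (\<lambda>x. poly r \<theta> * pev a u r x)" by blast
    define e where "e = (\<lambda>x. (1 / poly r \<theta>) * pev a u r x)"
    have "class_fun e" unfolding e_def by (rule class_fun_scale[OF r(2)])
    moreover have "e \<star> e = e"
      unfolding e_def conv_scale_left conv_scale_right r(6) using r(1) by (auto simp: fun_eq_iff)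
    moreover have "e \<noteq> (\<lambda>x. 0)" using r(1,3) by (auto simp: e_def fun_eq_iff)
    moreover have "u \<star> e = e" unfolding e_def conv_scale_right r(4) ..
    moreover have "a \<star> e = (\<lambda>x. \<theta> * e x)"
      unfolding e_def conv_scale_right r(5) by (simp add: fun_eq_iff)
    ultimately show "\<exists>e. class_fun e \<and> e \<star> e = e \<and> e \<noteq> (\<lambda>x. 0) \<and> u \<star> e = e \<and> a \<star> e = (\<lambda>x. \<theta> * e x)"
      by blast
  next
    assume au: "a \<star> u \<noteq> (\<lambda>x. 0)"
    \<comment> \<open>If 0 is the only root, it is a simple one, so the cofactor \<open>r\<close>
      has no roots and is constant; then \<open>p\<close> is a nonzero multiple of X and
      \<open>a \<star> u\<close> vanishes.\<close>
    show "\<exists>\<theta>. \<theta> \<noteq> 0 \<and> poly p \<theta> = 0"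
    proof (rule ccontr)
      assume no: "\<nexists>\<theta>. \<theta> \<noteq> 0 \<and> poly p \<theta> = 0"
      have "\<exists>z. poly p z = 0"
        using deg fundamental_theorem_of_algebra[of p] constant_degree[of p] by simp
      then have "poly p 0 = 0" using no by metis
      from factor[OF this] obtain r where r: "p = [:0, 1:] * r" "poly r 0 \<noteq> 0" by auto
      have "poly r z \<noteq> 0" for z
      proof (cases "z = 0")
        case False
        then have "poly p z \<noteq> 0" using no by blast
        then show ?thesis unfolding r(1) by simp
      qed (use r(2) in simp)
      then have "degree r = 0"
        using fundamental_theorem_of_algebra[of r] constant_degree[of r] by blast
      then obtain c where c: "r = [:c:]" using degree_eq_zeroE by blast
      then have "c \<noteq> 0" using r by auto
      moreover have "(\<lambda>x. c * (a \<star> u) x) = (\<lambda>x. 0)"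
        using pz(2) unfolding r(1) c by (simp add: pev_pCons conv_scale_right)
      ultimately show False using au by (auto simp: fun_eq_iff)
    qed
  qed
qed

text \<open>As \<open>delta \<one>\<close> is the unit of the algebra, \<open>p\<close> annihilates
  \<open>a\<close> itself; applied to \<open>v\<close>, this makes \<open>\<theta>\<close> a root of
  \<open>p\<close>.\<close>

lemma eigenvalue_idempotent:
  assumes a: "class_fun a" and v: "supp v" "v \<noteq> (\<lambda>x. 0)" "a \<star> v = (\<lambda>x. \<theta> * v x)"
  obtains e where "class_fun e" "e \<star> e = e" "e \<noteq> (\<lambda>x. 0)" "a \<star> e = (\<lambda>x. \<theta> * e x)"
proof -
  have d: "delta \<one> \<noteq> (\<lambda>x. 0)" by (auto simp: delta_def fun_eq_iff)
  obtain p where p: "pev a (delta \<one>) p = (\<lambda>x. 0)"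
    "\<And>\<theta>. poly p \<theta> = 0 \<Longrightarrow>
       \<exists>e. class_fun e \<and> e \<star> e = e \<and> e \<noteq> (\<lambda>x. 0) \<and> delta \<one> \<star> e = e \<and> a \<star> e = (\<lambda>x. \<theta> * e x)"
    by (rule minimal_poly_idempotents[OF a class_fun_delta_one _ d])
       (use conv_delta_one in auto)
  have "(\<lambda>x. poly p \<theta> * v x) = (\<lambda>x. 0)"
    using pev_conv_eigen[OF delta_one_conv[OF v(1)] v(3), of p] p(1) by simp
  then have "poly p \<theta> = 0" using v(2) by (auto simp: fun_eq_iff)
  then show thesis using p(2) that by blast
qed

text \<open>An idempotent \<open>u\<close> for a nonzero eigenvalue of \<open>d\<close> is split off
  first, which is possible because \<open>d\<close> is not zero. Then \<open>a\<close> is decomposed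
  inside the ideal of \<open>u\<close>, where \<open>d\<close> still acts as the scalar
  \<open>\<nu>\<close>.\<close>

lemma joint_eigenvalue_idempotent:
  assumes a: "class_fun a" and d: "class_fun d" "d \<noteq> (\<lambda>x. 0)"
  obtains e \<nu> \<theta> where "class_fun e" "e \<star> e = e" "e \<noteq> (\<lambda>x. 0)" "a \<star> e = (\<lambda>x. \<theta> * e x)"
    "d \<star> e = (\<lambda>x. \<nu> * e x)" "\<nu> \<noteq> 0"
proof -
  have one: "delta \<one> \<noteq> (\<lambda>x. 0)" by (auto simp: delta_def fun_eq_iff)
  have "d \<star> delta \<one> \<noteq> (\<lambda>x. 0)" using d conv_delta_one class_fun_supp by auto
  then obtain u \<nu> where u: "class_fun u" "u \<star> u = u" "u \<noteq> (\<lambda>x. 0)" "d \<star> u = (\<lambda>x. \<nu> * u x)" "\<nu> \<noteq> 0"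
    by (rule_tac minimal_poly_idempotents[OF d(1) class_fun_delta_one _ one])
       (use conv_delta_one in \<open>auto, metis\<close>)
  obtain p where p: "degree p > 0"
    "\<And>\<theta>. poly p \<theta> = 0 \<Longrightarrow>
       \<exists>e. class_fun e \<and> e \<star> e = e \<and> e \<noteq> (\<lambda>x. 0) \<and> u \<star> e = e \<and> a \<star> e = (\<lambda>x. \<theta> * e x)"
    by (rule minimal_poly_idempotents[OF a u(1-3)]) auto
  obtain \<theta> where "poly p \<theta> = 0"
    using p(1) fundamental_theorem_of_algebra[of p] constant_degree[of p] by auto
  then obtain e where e: "class_fun e" "e \<star> e = e" "e \<noteq> (\<lambda>x. 0)" "u \<star> e = e" "a \<star> e = (\<lambda>x. \<theta> * e x)"
    using p(2) by blast
  have "d \<star> e = d \<star> u \<star> e" by (simp add: conv_assoc e(4))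
  also have "\<dots> = (\<lambda>x. \<nu> * e x)" by (simp add: u(4) conv_scale_left e(4))
  finally show thesis using that e u(5) by blast
qed

text \<open>Up to the factor \<open>card (carrier G)\<close>, \<open>e (inv g)\<close> is the trace of \<open>g\<close> on the left ideal
  generated by \<open>e\<close>, and the coefficients below are the multiplicities of its eigenvalues.\<close>

lemma idempotent_trace_expansion:
  assumes e: "class_fun e" "e \<star> e = e" and g: "g \<in> carrier G" and n: "n > 0" "g [^] n = \<one>"
  shows "\<exists>c :: nat \<Rightarrow> rat. \<forall>k::nat. e (inv (g [^] k)) = (\<Sum>j<n. of_rat (c j) * unity_root n ^ (j * k))"
proof -
  define \<zeta> where "\<zeta> = unity_root n"
  define \<eta> where "\<eta> = inverse \<zeta>"
  have z: "\<zeta> ^ n = 1" "\<zeta> \<noteq> 0" "\<eta> ^ n = 1" "\<eta> \<noteq> 0" using n by (simp_all add: \<zeta>_def \<eta>_def power_inverse)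
  \<comment> \<open>The projection onto the eigenspace of \<open>g\<close> for the eigenvalue
    \<open>\<zeta> ^ j\<close>, obtained as a discrete Fourier coefficient of the powers of
    \<open>g\<close>.\<close>
  define s where "s j = (\<lambda>x. \<Sum>i<n. (1 / of_nat n) * \<eta> ^ (i * j) * delta (g [^] i) x)" for j
  have per: "g [^] (m + n) = g [^] m" for m
    using g n by (simp add: nat_pow_mult[symmetric])
  have idem: "s j \<star> s j = s j" for j
  proof -
    define F where "F = (\<lambda>x m. (1 / of_nat n) * \<eta> ^ (m * j) * delta (g [^] m) x)"
    have Fper: "F x (m + n) = F x m" for x m
    proof -
      have "\<eta> ^ ((m + n) * j) = \<eta> ^ (m * j)"
        using z(3) by (simp add: add_mult_distrib power_add power_mult)
      then show ?thesis by (simp add: F_def per)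
    qed
    have "s j \<star> s j = (\<lambda>x. \<Sum>i<n. \<Sum>i'<n. (1 / of_nat n) * F x (i' + i))"
    proof (rule ext)
      fix x
      have "(s j \<star> s j) x = (\<Sum>i<n. (1 / of_nat n) * \<eta> ^ (i * j) *
          (\<Sum>i'<n. (1 / of_nat n) * \<eta> ^ (i' * j) * (delta (g [^] i) \<star> delta (g [^] i')) x))"
        unfolding s_def
        by (simp only: conv_sum_left conv_sum_right conv_scale_left conv_scale_right sum_distrib_left)
      also have "\<dots> = (\<Sum>i<n. \<Sum>i'<n. (1 / of_nat n) * F x (i' + i))"
        using g by (intro sum.cong refl)
          (simp add: sum_distrib_left conv_delta_delta nat_pow_mult F_def add.commute algebra_simps power_add)
      finally show "(s j \<star> s j) x = (\<Sum>i<n. \<Sum>i'<n. (1 / of_nat n) * F x (i' + i))" .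
    qed
    \<comment> \<open>By periodicity the shift by \<open>i\<close> drops out of the inner sum,
      leaving \<open>n\<close> equal terms.\<close>
    also have "\<dots> = (\<lambda>x. \<Sum>i<n. (1 / of_nat n) * (\<Sum>i'<n. F x i'))"
      using sum_periodic_shift[of "F x" n for x, OF Fper]
      by (simp only: sum_distrib_left[symmetric])
    also have "\<dots> = s j"
      using n by (simp add: s_def F_def)
    finally show ?thesis .
  qed
  \<comment> \<open>\<open>C j\<close> is the value of \<open>e \<star> s j\<close> at the identity.
    As \<open>e\<close> is central, this product is again idempotent, so \<open>C j\<close> times
    the group order is an integer.\<close>
  define C where "C j = (\<Sum>i<n. (1 / of_nat n) * \<eta> ^ (i * j) * e (inv (g [^] i)))" for j
  have "C j \<in> \<rat>" for j
  proof -
    have one: "(e \<star> s j) \<one> = C j"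
    proof -
      have "e \<star> s j = s j \<star> e" by (rule class_fun_conv_commute[OF e(1)])
      also have "\<dots> = (\<lambda>x. \<Sum>i<n. (1 / of_nat n) * \<eta> ^ (i * j) * (delta (g [^] i) \<star> e) x)"
        unfolding s_def by (simp only: conv_sum_left conv_scale_left)
      finally show ?thesis using g by (simp add: C_def delta_conv)
    qed
    have "(e \<star> s j) \<star> (e \<star> s j) = e \<star> (s j \<star> e) \<star> s j" by (simp add: conv_assoc)
    also have "\<dots> = e \<star> (e \<star> s j) \<star> s j" by (simp add: class_fun_conv_commute[OF e(1), of "s j"])
    also have "\<dots> = (e \<star> e) \<star> (s j \<star> s j)" by (simp add: conv_assoc)
    finally have "(e \<star> s j) \<star> (e \<star> s j) = e \<star> s j" by (simp add: e(2) idem)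
    from idempotent_at_one_Ints[OF this]
    have "of_nat (card (carrier G)) * C j \<in> \<int>" by (simp add: one)
    then have "of_nat (card (carrier G)) * C j / of_nat (card (carrier G)) \<in> \<rat>"
      using Ints_subset_Rats by (intro Rats_divide) auto
    moreover have "card (carrier G) \<noteq> 0" using fin one_closed by (metis card_0_eq empty_iff)
    ultimately show ?thesis by simp
  qed
  then have "\<forall>j. \<exists>c. C j = of_rat c" by (auto elim: Rats_cases)
  then obtain c where c: "\<And>j. C j = of_rat (c j)" by metis
  have "e (inv (g [^] k)) = (\<Sum>j<n. of_rat (c j) * \<zeta> ^ (j * k))" for k :: nat
  proof -
    \<comment> \<open>Fourier inversion modulo \<open>n\<close> recovers the values of
      \<open>e\<close> from the numbers \<open>C j\<close>.\<close>
    have "(\<Sum>j<n. C j * \<zeta> ^ (j * k))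
        = (\<Sum>j<n. \<Sum>i<n. e (inv (g [^] i)) * (1 / of_nat n) * (\<zeta> ^ k * \<eta> ^ i) ^ j)"
      by (simp add: C_def sum_distrib_right sum_distrib_left power_mult_distrib mult_ac flip: power_mult)
    also have "\<dots> = (\<Sum>i<n. e (inv (g [^] i)) * (1 / of_nat n) * (\<Sum>j<n. (\<zeta> ^ k * \<eta> ^ i) ^ j))"
      by (subst sum.swap) (simp only: sum_distrib_left)
    also have "\<dots> = (\<Sum>i<n. if i = k mod n then e (inv (g [^] i)) else 0)"
    proof (intro sum.cong refl)
      fix i assume "i \<in> {..<n}"
      then have i: "i < n" by simp
      have "(\<zeta> ^ k * \<eta> ^ i) ^ n = 1"
        by (metis z(1,3) power_mult_distrib power_commutes power_mult mult.commute mult_1 power_one)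
      moreover have "\<zeta> ^ k * \<eta> ^ i = 1 \<longleftrightarrow> i = k mod n"
      proof -
        have "\<zeta> ^ k * \<eta> ^ i = 1 \<longleftrightarrow> \<zeta> ^ k = \<zeta> ^ i"
          using z by (simp add: \<eta>_def field_simps)
        also have "\<dots> \<longleftrightarrow> i = k mod n"
          unfolding \<zeta>_def unity_root_power_eq_iff[OF n(1)] using i by (auto simp: Cong.cong_def)
        finally show ?thesis .
      qed
      ultimately show "e (inv (g [^] i)) * (1 / of_nat n) * (\<Sum>j<n. (\<zeta> ^ k * \<eta> ^ i) ^ j)
          = (if i = k mod n then e (inv (g [^] i)) else 0)"
        using n by (simp add: sum_powers_unity)
    qed
    also have "\<dots> = e (inv (g [^] (k mod n)))" using n by simp
    also have "g [^] (k mod n) = g [^] k"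
    proof -
      have "g [^] k = g [^] (k div n * n + k mod n)" by simp
      also have "\<dots> = (g [^] n) [^] (k div n) \<otimes> g [^] (k mod n)"
        using g by (simp add: nat_pow_mult nat_pow_pow mult.commute)
      finally show ?thesis using g n by simp
    qed
    finally show ?thesis by (simp add: c)
  qed
  then show ?thesis unfolding \<zeta>_def by blast
qed

end

section \<open>Rational relations between roots of unity\<close>

abbreviation ipoly_at :: "int poly \<Rightarrow> complex \<Rightarrow> complex" where
  "ipoly_at p x \<equiv> poly (map_poly of_int p) x"

lemma of_nat_prime_dvd_freshman:
  fixes a b :: "'a::comm_ring_1"
  assumes "prime q"
  shows "of_nat q dvd (a + b) ^ q - a ^ q - b ^ q"
proof -
  have q: "q > 0" using assms by (rule prime_gt_0_nat)
  have "(a + b) ^ q = (\<Sum>k\<in>{..q}. of_nat (q choose k) * a ^ k * b ^ (q - k))"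
    by (rule binomial_ring)
  also have "{..q} = insert 0 (insert q {0<..<q})" using q by auto
  also have "(\<Sum>k\<in>insert 0 (insert q {0<..<q}). of_nat (q choose k) * a ^ k * b ^ (q - k))
      = b ^ q + (a ^ q + (\<Sum>k\<in>{0<..<q}. of_nat (q choose k) * a ^ k * b ^ (q - k)))"
    using q by simp
  finally have "(a + b) ^ q - a ^ q - b ^ q = (\<Sum>k\<in>{0<..<q}. of_nat (q choose k) * a ^ k * b ^ (q - k))"
    by simp
  also have "of_nat q dvd \<dots>"
  proof (rule dvd_sum)
    fix k assume "k \<in> {0<..<q}"
    then have "q dvd (q choose k)" using assms by (intro dvd_choose_prime) auto
    then have "(of_nat q :: 'a) dvd of_nat (q choose k)" by (auto elim!: dvdE simp: of_nat_mult)
    then show "of_nat q dvd of_nat (q choose k) * a ^ k * b ^ (q - k)" by simp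
  qed
  finally show ?thesis .
qed

lemma int_prime_dvd_power_minus_self:
  fixes c :: int
  assumes "prime q"
  shows "int q dvd c ^ q - c"
proof -
  have nat_case: "int q dvd (int m) ^ q - int m" for m :: nat
  proof (induction m)
    case 0
    then show ?case using prime_gt_0_nat[OF assms] by (simp add: power_0_left)
  next
    case (Suc m)
    have "int q dvd (int m + 1) ^ q - int m ^ q - 1 ^ q"
      using of_nat_prime_dvd_freshman[OF assms, of "int m" 1] by simp
    from dvd_add[OF this Suc.IH] show ?case by (simp add: algebra_simps)
  qed
  define r where "r = nat (c mod int q)"
  have r: "int r = c mod int q" using prime_gt_0_nat[OF assms] by (simp add: r_def)
  have "[c = int r] (mod int q)" by (simp add: r Cong.cong_def)
  then have "[c ^ q - c = int r ^ q - int r] (mod int q)" by (intro cong_diff cong_pow)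
  then show ?thesis using nat_case[of r] cong_dvd_iff by blast
qed

text \<open>Frobenius modulo \<open>q\<close>, one coefficient at a time: \<open>pCons c p\<close>
  is c + X p, the inner binomial coefficients are divisible by \<open>q\<close>, and c^q is
  congruent to c by Fermat.\<close>

lemma poly_power_prime:
  fixes p :: "int poly"
  assumes "prime q"
  shows "\<exists>s. p ^ q = p \<circ>\<^sub>p monom 1 q + of_nat q * s"
proof -
  have "of_nat q dvd p ^ q - p \<circ>\<^sub>p monom 1 q"
  proof (induction p)
    case 0
    then show ?case using prime_gt_0_nat[OF assms] by (simp add: power_0_left)
  next
    case (pCons c p)
    have "pCons c p = [:c:] + monom 1 1 * p" by (simp add: monom_Suc)
    then have "of_nat q dvd (pCons c p) ^ q - [:c:] ^ q - (monom 1 1 * p) ^ q"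
      using of_nat_prime_dvd_freshman[OF assms] by metis
    moreover have "of_nat q dvd [:c:] ^ q - [:c:]"
    proof -
      obtain d where "c ^ q - c = int q * d" using int_prime_dvd_power_minus_self[OF assms, of c] by (elim dvdE)
      then have "[:c:] ^ q - [:c:] = of_nat q * [:d:]"
        by (simp add: poly_const_pow of_nat_poly)
      then show ?thesis by (metis dvd_triv_left)
    qed
    moreover have "of_nat q dvd (monom 1 1 * p) ^ q - monom 1 q * (p \<circ>\<^sub>p monom 1 q)"
    proof -
      have "(monom 1 1 * p) ^ q - monom 1 q * (p \<circ>\<^sub>p monom 1 q) = monom 1 q * (p ^ q - p \<circ>\<^sub>p monom 1 q)"
        by (simp add: power_mult_distrib monom_power algebra_simps)
      then show ?thesis using pCons.IH by simp
    qed
    ultimately have "of_nat q dvd ((pCons c p) ^ q - [:c:] ^ q - (monom 1 1 * p) ^ q)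
        + ([:c:] ^ q - [:c:]) + ((monom 1 1 * p) ^ q - monom 1 q * (p \<circ>\<^sub>p monom 1 q))"
      by (intro dvd_add)
    moreover have "(a - b - c) + (b - d) + (c - f) = a - (d + f)" for a b c d f :: "int poly"
      by simp
    ultimately show ?case unfolding pcompose_pCons by (simp only:)
  qed
  then show ?thesis by (elim dvdE) (metis add.commute diff_eq_eq)
qed

text \<open>Multiplication by \<open>p\<close> modulo X^n - 1 has the integer matrix
  \<open>M\<close> in the basis of powers of X, and the vector of powers of \<open>x\<close> is an
  eigenvector of it with eigenvalue p(x).\<close>

lemma ipoly_at_root_of_unity_algebraic_int:
  assumes "x ^ n = 1" "n > 0"
  shows "algebraic_int (ipoly_at p x)"
proof -
  have per: "x ^ (m mod n) = x ^ m" for m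
    using assms(1) by (metis mult_div_mod_eq power_add power_mult power_one mult_1)
  define M where "M a b = (\<Sum>i\<le>degree p. if (i + a) mod n = b then coeff p i else 0)" for a b
  have "eigenvalue_on {..<n} M (ipoly_at p x)"
    unfolding eigenvalue_on_def
  proof (intro exI[of _ "\<lambda>b. x ^ b"] conjI ballI)
    show "\<exists>a\<in>{..<n}. x ^ a \<noteq> 0" using assms(2) by (intro bexI[of _ 0]) auto
    fix a assume "a \<in> {..<n}"
    have "(\<Sum>b<n. of_int (M a b) * x ^ b)
        = (\<Sum>i\<le>degree p. \<Sum>b<n. if (i + a) mod n = b then of_int (coeff p i) * x ^ b else 0)"
      unfolding M_def of_int_sum sum_distrib_right
      by (subst sum.swap) (intro sum.cong refl, auto)
    also have "\<dots> = (\<Sum>i\<le>degree p. of_int (coeff p i) * x ^ (i + a))"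
      using assms(2) by (intro sum.cong refl) (simp add: per)
    also have "\<dots> = ipoly_at p x * x ^ a"
      by (simp add: poly_altdef degree_map_poly coeff_map_poly sum_distrib_right power_add mult.assoc)
    finally show "(\<Sum>b<n. of_int (M a b) * x ^ b) = ipoly_at p x * x ^ a" .
  qed
  then show ?thesis by (rule eigenvalue_on_imp_algebraic_int[rotated]) simp
qed

text \<open>Irreducibility of the cyclotomic polynomials, in the form that raising roots of unity to a
  coprime power preserves rational relations. With \<open>X^n - 1 = p * r\<close>, differentiating at \<open>x ^ q\<close>
  shows that \<open>n\<close> is a multiple of \<open>p (x ^ q)\<close>, which is divisible by \<open>q\<close> by Frobenius.\<close>

lemma rat_poly_root_of_unity_prime_power:
  fixes f :: "rat poly"
  assumes "prime q" "\<not> q dvd n" "n > 0" "x ^ n = 1"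
    and root: "poly (map_poly of_rat f) (x :: complex) = 0"
  shows "poly (map_poly of_rat f) (x ^ q) = 0"
proof (rule ccontr)
  assume nz: "poly (map_poly of_rat f) (x ^ q) \<noteq> 0"
  interpret rat_hom: map_poly_comm_ring_hom "of_rat :: rat \<Rightarrow> complex" ..
  define X :: "int poly" where "X = monom 1 n - 1"
  have Xdeg: "coeff X n = 1" using assms(3) by (simp add: X_def)
  have X_at: "ipoly_at X y = y ^ n - 1" for y
    by (simp add: X_def of_int_hom.map_poly_hom_monom hom_distribs poly_monom)
  have rat_int: "map_poly of_rat (map_poly of_int p :: rat poly) = (map_poly of_int p :: complex poly)" for p
    by (simp add: map_poly_map_poly o_def)
  \<comment> \<open>Passing to the gcd replaces \<open>f\<close> by a divisor of X^n - 1 that still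
    vanishes at \<open>x\<close> but, as a divisor of \<open>f\<close>, not at
    \<open>x ^ q\<close>.\<close>
  define d where "d = gcd f (map_poly of_int X)"
  have Xnz: "(map_poly of_int X :: rat poly) \<noteq> 0"
    using Xdeg by (metis coeff_0 coeff_map_poly of_int_0 of_int_1 zero_neq_one)
  then have dnz: "d \<noteq> 0" by (simp add: d_def)
  obtain s t where st: "d = s * f + t * map_poly of_int X"
    using bezout_coefficients_fst_snd[of f "map_poly of_int X"] unfolding d_def by metis
  have d0: "poly (map_poly of_rat d) x = 0"
    unfolding st using root X_at[of x] assms(4) by (simp add: hom_distribs rat_int)
  obtain c p where cp: "rat_to_normalized_int_poly d = (c, p)" by force
  note p = rat_to_normalized_int_poly[OF cp]
  have d_at: "poly (map_poly of_rat d) y = of_rat c * ipoly_at p y" for y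
    by (subst p(1)) (simp add: hom_distribs rat_int)
  have c: "c \<noteq> 0" using p(2) by simp
  have p0: "ipoly_at p x = 0" using d0 c by (simp add: d_at)
  have "d dvd f" by (simp add: d_def)
  then have "poly (map_poly of_rat d) (x ^ q) \<noteq> 0"
    using nz by (auto elim!: dvdE simp: hom_distribs)
  then have pq: "ipoly_at p (x ^ q) \<noteq> 0" by (simp add: d_at)
  have "map_poly of_int p dvd d"
    using p(1) c by (metis dvd_refl smult_dvd_iff)
  then have "map_poly rat_of_int p dvd map_poly of_int X"
    unfolding d_def using dvd_trans gcd_dvd2 by blast
  \<comment> \<open>Gauss's lemma: \<open>p\<close> is primitive, so divisibility over the rationals
    descends to the integers.\<close>
  then have "p dvd X" using dvd_poly_int_content_1[OF p(3)[OF dnz]] by blast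
  then obtain r where r: "X = p * r" by (elim dvdE)
  define y where "y = x ^ q"
  have y: "y ^ n = 1" unfolding y_def using assms(4) by (metis power_mult mult.commute power_one)
  have "ipoly_at p y * ipoly_at r y = ipoly_at X y"
    by (simp add: r hom_distribs)
  then have r0: "ipoly_at r y = 0" using pq y by (simp add: X_at y_def)
  have "ipoly_at (pderiv X) y = of_nat n * y ^ (n - 1)"
    by (simp add: X_def pderiv_diff pderiv_monom of_int_hom.map_poly_hom_monom hom_distribs poly_monom)
  moreover have "ipoly_at (pderiv X) y = ipoly_at p y * ipoly_at (pderiv r) y"
    unfolding r pderiv_mult using r0 by (simp add: hom_distribs)
  ultimately have n1: "of_nat n * y ^ (n - 1) = ipoly_at p y * ipoly_at (pderiv r) y" by simp
  have n2: "of_nat n = ipoly_at p y * ipoly_at (pderiv r) y * y"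
  proof -
    have "of_nat n * y ^ (n - 1) * y = of_nat n"
      using assms(3) y by (simp add: mult.assoc flip: power_Suc2)
    then show ?thesis unfolding n1 by (rule sym)
  qed
  obtain s where s: "p ^ q = p \<circ>\<^sub>p monom 1 q + of_nat q * s"
    using poly_power_prime[OF assms(1)] by blast
  have comp: "ipoly_at (g \<circ>\<^sub>p monom 1 q) x = ipoly_at g y" for g
    by (simp add: of_int_hom.map_poly_pcompose poly_pcompose of_int_hom.map_poly_hom_monom poly_monom y_def)
  have "0 = ipoly_at (p ^ q) x"
    using p0 prime_gt_0_nat[OF assms(1)] by (simp add: hom_distribs power_0_left)
  also have "\<dots> = ipoly_at p y + of_nat q * ipoly_at s x"
    unfolding s using comp[of p] by (simp add: hom_distribs)
  finally have py: "ipoly_at p y = - (of_nat q * ipoly_at s x)" by (simp add: eq_neg_iff_add_eq_0)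
  \<comment> \<open>Chosen so that n = q h(x): the factor p(y) contributes -q s(x), and y = x^q
    turns polynomials in y into polynomials in x. The value h(x) is then a rational algebraic
    integer, hence an integer.\<close>
  define h where "h = - (s * (pderiv r \<circ>\<^sub>p monom 1 q) * monom 1 q)"
  have "ipoly_at h x = - (ipoly_at s x * ipoly_at (pderiv r) y * y)"
    unfolding h_def using comp[of "pderiv r"]
    by (simp add: hom_distribs of_int_hom.map_poly_hom_monom poly_monom y_def)
  then have nq: "of_nat n = of_nat q * ipoly_at h x"
    using n2 py by (simp add: mult_ac)
  then have "ipoly_at h x = of_nat n / of_nat q"
    using prime_gt_0_nat[OF assms(1)] by (simp add: field_simps)
  then have "ipoly_at h x \<in> \<rat>" by simp
  then have "ipoly_at h x \<in> \<int>"
    using ipoly_at_root_of_unity_algebraic_int[OF assms(4,3)] rational_algebraic_int_is_int by blast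
  then obtain z where "ipoly_at h x = of_int z" by (auto elim: Ints_cases)
  then have "(of_int (int n) :: complex) = of_int (int q * z)" using nq by simp
  then have "int n = int q * z" by (simp only: of_int_eq_iff)
  then have "q dvd n" by (metis dvd_triv_left int_dvd_int_iff)
  with assms(2) show False by simp
qed

lemma rat_poly_root_of_unity_coprime_power:
  fixes f :: "rat poly"
  assumes "n > 0" "Rings.coprime k n" "x ^ n = 1" "poly (map_poly of_rat f) (x :: complex) = 0"
  shows "poly (map_poly of_rat f) (x ^ k) = 0"
  using assms
proof (induction k arbitrary: x rule: prime_divisors_induct)
  \<comment> \<open>Coprimality of 0 and \<open>n\<close> forces n = 1, hence x = 1.\<close>
  case zero
  then show ?case by simp
next
  case (unit k)
  then show ?case by simp
next
  case (factor q k)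
  have "Rings.coprime q n" "Rings.coprime k n" using factor.prems(2) by simp_all
  moreover have "\<not> q dvd n"
    using \<open>Rings.coprime q n\<close> factor.hyps(1) by (metis coprime_absorb_left not_prime_unit)
  ultimately have "poly (map_poly of_rat f) (x ^ q) = 0"
    using rat_poly_root_of_unity_prime_power[of q n x f] factor by auto
  moreover have "(x ^ q) ^ n = 1" using factor.prems(3) by (metis power_mult mult.commute power_one)
  ultimately have "poly (map_poly of_rat f) ((x ^ q) ^ k) = 0"
    using factor.IH factor.prems(1) \<open>Rings.coprime k n\<close> by blast
  then show ?case by (simp add: power_mult)
qed

text \<open>The substitute for a Galois automorphism, stated for an arbitrary finite index set so
  that several sums can be merged into one relation.\<close>

lemma rat_relation_coprime_power:
  fixes c :: "'i \<Rightarrow> rat" and m :: "'i \<Rightarrow> nat"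
  assumes "n > 0" "Rings.coprime k n" "x ^ n = 1" "finite J"
    and "(\<Sum>j\<in>J. of_rat (c j) * (x :: complex) ^ m j) = 0"
  shows "(\<Sum>j\<in>J. of_rat (c j) * x ^ (m j * k)) = 0"
proof -
  define f where "f = (\<Sum>j\<in>J. monom (c j) (m j))"
  have f: "poly (map_poly of_rat f) y = (\<Sum>j\<in>J. of_rat (c j) * y ^ m j)" for y :: complex
  proof -
    interpret rat_hom: map_poly_comm_ring_hom "of_rat :: rat \<Rightarrow> complex" ..
    show ?thesis
      by (simp add: f_def rat_hom.hom_sum poly_sum map_poly_monom poly_monom)
  qed
  have "poly (map_poly of_rat f) (x ^ k) = 0"
    using assms by (intro rat_poly_root_of_unity_coprime_power) (auto simp: f)
  then show ?thesis by (simp add: f mult.commute flip: power_mult)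
qed

text \<open>Ramanujan sums, by a sieve over the prime divisors of \<open>n\<close>: removing the
  multiples of one prime subtracts a sum of the same kind in which \<open>d\<close> is replaced by
  \<open>lcm d p\<close>. Hence \<open>sieve\<close> carries a general \<open>d\<close>; with no
  primes left it is a geometric sum over the multiples of \<open>d\<close>.\<close>

lemma units_mod_sum_unity_root_Rats:
  assumes n: "n > 0"
  shows "(\<Sum>k\<in>units_mod n. unity_root n ^ (j * k)) \<in> \<rat>"
proof -
  define \<zeta> where "\<zeta> = unity_root n ^ j"
  have \<zeta>: "\<zeta> ^ n = 1" unfolding \<zeta>_def using n by (metis power_mult mult.commute power_one unity_root_power_self)
  have sieve: "(\<Sum>k\<in>{k. k < n \<and> d dvd k \<and> (\<forall>p\<in>P. \<not> p dvd k)}. \<zeta> ^ k) \<in> \<rat>"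
    if "finite P" "\<forall>p\<in>P. p dvd n" "d dvd n" for P d
    using that
  proof (induction P arbitrary: d rule: finite_induct)
    case empty
    then obtain m where m: "n = d * m" by (elim dvdE) auto
    have d: "d > 0" using m n by (cases d) auto
    have "{k. k < n \<and> d dvd k} = (\<lambda>i. d * i) ` {..<m}"
      using d by (auto simp: m elim!: dvdE)
    then have "(\<Sum>k\<in>{k. k < n \<and> d dvd k}. \<zeta> ^ k) = (\<Sum>i<m. (\<zeta> ^ d) ^ i)"
      using d by (simp add: sum.reindex inj_on_def power_mult)
    also have "\<dots> \<in> \<rat>"
      using \<zeta> by (subst sum_powers_unity) (auto simp: m power_mult)
    finally show ?case by simp
  next
    case (insert p P)
    let ?A = "\<lambda>d. {k. k < n \<and> d dvd k \<and> (\<forall>p\<in>P. \<not> p dvd k)}"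
    have "{k. k < n \<and> d dvd k \<and> (\<forall>p\<in>insert p P. \<not> p dvd k)} = ?A d - ?A (lcm d p)"
      by (auto simp: lcm_least_iff)
    moreover have "?A (lcm d p) \<subseteq> ?A d" by (auto simp: lcm_least_iff)
    ultimately have "(\<Sum>k\<in>{k. k < n \<and> d dvd k \<and> (\<forall>p\<in>insert p P. \<not> p dvd k)}. \<zeta> ^ k)
        = (\<Sum>k\<in>?A d. \<zeta> ^ k) - (\<Sum>k\<in>?A (lcm d p). \<zeta> ^ k)"
      by (simp add: sum_diff)
    also have "\<dots> \<in> \<rat>"
      using insert by (intro Rats_diff insert.IH) auto
    finally show ?case .
  qed
  have "units_mod n = {k. k < n \<and> 1 dvd k \<and> (\<forall>p\<in>prime_factors n. \<not> p dvd k)}"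
  proof -
    have "Rings.coprime k n \<longleftrightarrow> (\<forall>p\<in>prime_factors n. \<not> p dvd k)" for k
    proof
      assume "Rings.coprime k n"
      then show "\<forall>p\<in>prime_factors n. \<not> p dvd k"
        using coprime_common_divisor[of k n] not_prime_unit
        by (metis in_prime_factors_imp_dvd in_prime_factors_imp_prime)
    next
      assume *: "\<forall>p\<in>prime_factors n. \<not> p dvd k"
      show "Rings.coprime k n"
      proof (rule ccontr)
        assume "\<not> Rings.coprime k n"
        then have "gcd k n \<noteq> 1" using coprime_iff_gcd_eq_1 by blast
        then obtain p where "prime p" "p dvd gcd k n" using prime_factor_nat by blast
        then show False using * n by (auto simp: prime_factors_dvd)
      qed
    qed
    then show ?thesis by (auto simp: units_mod_def)
  qed
  then show ?thesis
    using sieve[of "prime_factors n" 1] in_prime_factors_imp_dvd[of _ n]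
    by (simp add: \<zeta>_def power_mult)
qed

section \<open>Gauss sums and the square root of the discriminant\<close>

lemma power_mod_exponent:
  fixes x :: "'a::monoid_mult"
  assumes "x ^ p = 1"
  shows "x ^ (m mod p) = x ^ m"
  by (metis assms mult_div_mod_eq power_add power_mult power_one mult_1)

lemma Legendre_cong:
  assumes "[a = b] (mod p)"
  shows "Legendre a p = Legendre b p"
proof -
  have "[a = 0] (mod p) \<longleftrightarrow> [b = 0] (mod p)" "QuadRes p a \<longleftrightarrow> QuadRes p b"
    unfolding QuadRes_def using assms by (meson cong_sym cong_trans)+
  then show ?thesis by (simp add: Legendre_def)
qed

text \<open>Turns the congruences supplied by Euler's criterion into equalities of symbols.\<close>

lemma small_int_cong_imp_eq:
  fixes x y :: int
  assumes "[x = y] (mod int p)" "2 < p" "x \<in> {-1, 0, 1}" "y \<in> {-1, 0, 1}"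
  shows "x = y"
proof (rule ccontr)
  assume "x \<noteq> y"
  moreover have "int p dvd x - y" using assms(1) by (simp add: cong_iff_dvd_diff)
  ultimately have "int p \<le> \<bar>x - y\<bar>" using dvd_imp_le_int[of "x - y" "int p"] by simp
  then show False using assms by auto
qed

lemma Legendre_values: "Legendre a p \<in> {-1, 0, 1}"
  by (simp add: Legendre_def)

lemma Legendre_mult:
  assumes "prime p" "2 < p"
  shows "Legendre (a * b) (int p) = Legendre a (int p) * Legendre b (int p)"
proof (rule small_int_cong_imp_eq[OF _ assms(2)])
  have "[Legendre (a * b) (int p) = a ^ ((p - 1) div 2) * b ^ ((p - 1) div 2)] (mod int p)"
    using euler_criterion[OF assms, of "a * b"] by (simp add: power_mult_distrib)
  moreover have "[Legendre a (int p) * Legendre b (int p) = a ^ ((p - 1) div 2) * b ^ ((p - 1) div 2)] (mod int p)"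
    by (intro cong_mult euler_criterion assms)
  ultimately show "[Legendre (a * b) (int p) = Legendre a (int p) * Legendre b (int p)] (mod int p)"
    by (meson cong_sym cong_trans)
  show "Legendre a (int p) * Legendre b (int p) \<in> {-1, 0, 1}"
    using Legendre_values[of a "int p"] Legendre_values[of b "int p"] by auto
qed (rule Legendre_values)

lemma Legendre_minus_one:
  assumes "prime p" "2 < p"
  shows "Legendre (-1) (int p) = (-1) ^ ((p - 1) div 2)"
  by (rule small_int_cong_imp_eq[OF euler_criterion[OF assms] assms(2) Legendre_values])
     (metis insertCI minus_one_power_iff)

lemma Legendre_coprime:
  assumes "prime p" "Rings.coprime k p"
  shows "Legendre (int k) (int p) = 1 \<or> Legendre (int k) (int p) = -1"
proof -
  have "\<not> p dvd k" using assms by (metis coprime_absorb_right coprime_common_divisor dvd_refl not_prime_unit)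
  then show ?thesis by (auto simp: Legendre_def cong_0_iff)
qed

lemma Legendre_one:
  assumes "prime p"
  shows "Legendre 1 (int p) = 1"
proof -
  have "QuadRes (int p) 1" unfolding QuadRes_def by (intro exI[of _ 1]) simp
  moreover have "\<not> [1 = 0] (mod int p)"
    using assms by (metis cong_0_iff int_dvd_int_iff not_prime_unit of_nat_1)
  ultimately show ?thesis by (simp add: Legendre_def)
qed

lemma sum_mult_mod_prime:
  fixes F :: "nat \<Rightarrow> 'a::comm_monoid_add"
  assumes p: "prime p" "\<not> p dvd u" and per: "\<And>m. F (m mod p) = F m"
  shows "(\<Sum>b<p. F (u * b)) = (\<Sum>b<p. F b)"
proof -
  have inj: "inj_on (\<lambda>b. u * b mod p) {..<p}"
  proof (rule inj_onI)
    fix x y assume xy: "x \<in> {..<p}" "y \<in> {..<p}" "u * x mod p = u * y mod p"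
    have "Rings.coprime u p" using prime_imp_coprime[OF p] by (simp add: algebraic_semidom_class.coprime_commute)
    then have "[x = y] (mod p)"
      using xy(3) cong_mult_lcancel_nat[of u p x y] by (simp add: Cong.cong_def)
    then show "x = y" using xy by (simp add: Cong.cong_def)
  qed
  have "(\<lambda>b. u * b mod p) ` {..<p} \<subseteq> {..<p}" using prime_gt_0_nat[OF p(1)] by auto
  then have "bij_betw (\<lambda>b. u * b mod p) {..<p} {..<p}"
    using inj by (simp add: bij_betw_def endo_inj_surj)
  from sum.reindex_bij_betw[OF this, of F] show ?thesis by (simp add: per)
qed

text \<open>Squaring on the nonzero residues is not injective, as 1 and p - 1 have the same square
  and differ for p > 2; on a finite set it is then not surjective either.\<close>

lemma exists_nonresidue:
  assumes "prime p" "2 < p"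
  shows "\<exists>u. \<not> p dvd u \<and> Legendre (int u) (int p) = -1"
proof -
  let ?f = "\<lambda>y::nat. y\<^sup>2 mod p"
  let ?A = "{0<..<p}"
  have maps: "?f ` ?A \<subseteq> ?A"
  proof
    fix z assume "z \<in> ?f ` ?A"
    then obtain y where y: "y \<in> ?A" "z = ?f y" by blast
    then have "\<not> p dvd y" by (auto dest: dvd_imp_le)
    then have "\<not> p dvd y\<^sup>2" using assms(1) prime_dvd_power by blast
    then show "z \<in> ?A" using y prime_gt_0_nat[OF assms(1)] by (auto simp: mod_greater_zero_iff_not_dvd)
  qed
  have "\<not> inj_on ?f ?A"
  proof
    assume inj: "inj_on ?f ?A"
    have "int p dvd (int (p - 1))\<^sup>2 - 1"
    proof -
      have "(int (p - 1))\<^sup>2 - 1 = int p * (int p - 2)"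
        using assms(2) by (simp add: power2_eq_square algebra_simps of_nat_diff)
      then show ?thesis by simp
    qed
    then have "[int ((p - 1)\<^sup>2) = int (1\<^sup>2)] (mod int p)" by (simp add: cong_iff_dvd_diff)
    then have "?f (p - 1) = ?f 1" unfolding cong_int_iff by (simp add: Cong.cong_def)
    then have "p - 1 = 1" by (rule inj_onD[OF inj]) (use assms(2) in auto)
    then show False using assms(2) by simp
  qed
  then have "?f ` ?A \<noteq> ?A" by (metis finite_greaterThanLessThan eq_card_imp_inj_on)
  then obtain u where u: "u \<in> ?A" "u \<notin> ?f ` ?A" using maps by blast
  have nd: "\<not> p dvd u" using u(1) by (auto dest: dvd_imp_le)
  have "\<not> QuadRes (int p) (int u)"
  proof
    assume "QuadRes (int p) (int u)"
    then obtain y where y: "[y\<^sup>2 = int u] (mod int p)" unfolding QuadRes_def by blast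
    define z where "z = nat (y mod int p)"
    have z: "int z = y mod int p" using prime_gt_0_nat[OF assms(1)] by (simp add: z_def)
    then have "[(int z)\<^sup>2 = y\<^sup>2] (mod int p)" by (intro cong_pow) (simp add: Cong.cong_def)
    then have "[int (z\<^sup>2) = int u] (mod int p)" using y cong_trans by fastforce
    then have zu: "[z\<^sup>2 = u] (mod p)" by (simp only: cong_int_iff)
    then have "?f z = u" using u(1) by (simp add: Cong.cong_def)
    moreover have "z < p" using z prime_gt_0_nat[OF assms(1)]
      by (metis of_nat_less_iff pos_mod_bound of_nat_0_less_iff)
    moreover have "z \<noteq> 0" using calculation(1) u(1) by (cases "z = 0") auto
    ultimately show False using u(2) by force
  qed
  then have "Legendre (int u) (int p) = -1" using nd by (simp add: Legendre_def cong_0_iff)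
  then show ?thesis using nd by blast
qed

text \<open>The hypothesis on \<open>\<omega>\<close> makes it a primitive \<open>p\<close>-th root
  of unity. The first claim is the substitution of k b for b. For the second, one factor of the
  square is expanded over \<open>a\<close> and its symbol absorbed into the other factor, which
  becomes \<open>g a\<close>; summing over \<open>a\<close> first leaves only b = p - 1, and so the
  symbol of -1.\<close>

lemma quadratic_gauss_sum:
  fixes \<omega> :: complex
  assumes p: "prime p" "2 < p" and \<omega>: "\<And>m. \<omega> ^ m = 1 \<longleftrightarrow> p dvd m"
  defines "g \<equiv> \<lambda>k. \<Sum>b<p. of_int (Legendre (int b) (int p)) * \<omega> ^ (b * k)"
  shows "\<not> p dvd k \<Longrightarrow> g k = of_int (Legendre (int k) (int p)) * g 1"
    and "(g 1)\<^sup>2 = of_int ((-1) ^ ((p - 1) div 2) * int p)"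
proof -
  let ?L = "\<lambda>b. Legendre (int b) (int p)"
  have Lmod: "?L (m mod p) = ?L m" for m
    by (rule Legendre_cong) (simp add: zmod_int)
  have wmod: "\<omega> ^ (m mod p) = \<omega> ^ m" for m
    using \<omega>[of p] by (intro power_mod_exponent) simp
  have Lmul: "?L (a * b) = ?L a * ?L b" for a b
    using Legendre_mult[OF p, of "int a" "int b"] by simp
  have Lsq: "?L k * ?L k = 1" if "\<not> p dvd k" for k
    using that by (auto simp: Legendre_def cong_0_iff)
  have twist: "of_int (?L k) * g k = g 1" if "\<not> p dvd k" for k
  proof -
    have "g 1 = (\<Sum>b<p. of_int (?L (k * b)) * \<omega> ^ (k * b))"
      unfolding g_def by (subst sum_mult_mod_prime[OF p(1) that]) (simp_all add: Lmod wmod)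
    also have "\<dots> = of_int (?L k) * g k"
      unfolding g_def by (simp only: Lmul of_int_mult sum_distrib_left mult_ac)
    finally show ?thesis ..
  qed
  show gk: "g k = of_int (?L k) * g 1" if "\<not> p dvd k" for k
  proof -
    have "of_int (?L k) * (of_int (?L k) * g k) = of_int (?L k * ?L k) * g k"
      by simp
    then show ?thesis using twist[OF that] Lsq[OF that] by simp
  qed
  have L0: "(\<Sum>b<p. ?L b) = 0"
  proof -
    obtain u where u: "\<not> p dvd u" "?L u = -1" using exists_nonresidue[OF p] by blast
    have "(\<Sum>b<p. ?L b) = (\<Sum>b<p. ?L (u * b))"
      by (rule sum_mult_mod_prime[where F = ?L, OF p(1) u(1) Lmod, symmetric])
    also have "\<dots> = - (\<Sum>b<p. ?L b)" by (simp only: Lmul u(2)) (simp add: sum_negf)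
    finally show ?thesis by simp
  qed
  \<comment> \<open>Multiples of \<open>p\<close> are covered as well: the symbol vanishes, and so
    does \<open>g a\<close>, being the sum of all symbols.\<close>
  have ga: "of_int (?L a) * g 1 = g a" for a
  proof (cases "p dvd a")
    case True
    have "\<omega> ^ (b * a) = 1" for b using \<omega> True by simp
    then have "g a = of_int (\<Sum>b<p. ?L b)" by (simp add: g_def)
    moreover have "?L a = 0" using True by (simp add: Legendre_def cong_0_iff)
    ultimately show ?thesis using L0 by simp
  qed (use gk in simp)
  have inner: "(\<Sum>a<p. \<omega> ^ (a + b * a)) = (if b = p - 1 then of_nat p else 0)" if "b < p" for b
  proof -
    have "(\<Sum>a<p. \<omega> ^ (a + b * a)) = (\<Sum>a<p. (\<omega> ^ (b + 1)) ^ a)"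
      by (intro sum.cong refl) (simp add: power_add algebra_simps flip: power_mult)
    also have "\<dots> = (if \<omega> ^ (b + 1) = 1 then of_nat p else 0)"
    proof (rule sum_powers_unity)
      show "(\<omega> ^ (b + 1)) ^ p = 1" unfolding power_mult[symmetric] \<omega> by simp
    qed
    also have "\<omega> ^ (b + 1) = 1 \<longleftrightarrow> b = p - 1"
      unfolding \<omega> using that by (auto dest: dvd_imp_le)
    finally show ?thesis .
  qed
  have "g 1 * x = (\<Sum>a<p. \<omega> ^ a * (of_int (?L a) * x))" for x
    by (simp add: g_def sum_distrib_left mult_ac)
  then have "(g 1)\<^sup>2 = (\<Sum>a<p. \<omega> ^ a * (of_int (?L a) * g 1))"
    unfolding power2_eq_square .
  also have "\<dots> = (\<Sum>a<p. \<Sum>b<p. of_int (?L b) * \<omega> ^ (a + b * a))"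
    unfolding ga by (simp add: g_def sum_distrib_left power_add mult_ac)
  also have "\<dots> = (\<Sum>b<p. of_int (?L b) * (\<Sum>a<p. \<omega> ^ (a + b * a)))"
    by (subst sum.swap) (simp add: sum_distrib_left)
  also have "\<dots> = (\<Sum>b<p. if b = p - 1 then of_int (?L b) * of_nat p else 0)"
    by (intro sum.cong refl) (simp add: inner)
  also have "\<dots> = of_int (?L (p - 1)) * of_nat p"
    using p by simp
  also have "?L (p - 1) = Legendre (-1) (int p)"
    by (rule Legendre_cong) (use p(2) in \<open>simp add: of_nat_diff cong_iff_dvd_diff\<close>)
  finally show "(g 1)\<^sup>2 = of_int ((-1) ^ ((p - 1) div 2) * int p)"
    using Legendre_minus_one[OF p] by simp
qed

text \<open>Expresses through values of one integer polynomial that raising roots of unity to the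
  k-th power multiplies a square root of \<open>d\<close> by \<open>\<epsilon> k\<close>. The
  property is multiplicative in \<open>d\<close> and \<open>\<epsilon>\<close>, so Delta can be
  treated factor by factor.\<close>

definition sqrt_rep :: "nat \<Rightarrow> (nat \<Rightarrow> int) \<Rightarrow> int \<Rightarrow> bool" where
  "sqrt_rep n \<epsilon> d \<longleftrightarrow> (\<exists>F \<tau>. \<tau>\<^sup>2 = of_int d \<and>
     (\<forall>k. Rings.coprime k n \<longrightarrow> ipoly_at F (unity_root n ^ k) = of_int (\<epsilon> k) * \<tau>))"

lemma sqrt_rep_one: "sqrt_rep n (\<lambda>_. 1) 1"
  unfolding sqrt_rep_def by (intro exI[of _ 1]) simp

lemma sqrt_rep_mult:
  assumes "sqrt_rep n \<epsilon> d" "sqrt_rep n \<psi> d'"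
  shows "sqrt_rep n (\<lambda>k. \<epsilon> k * \<psi> k) (d * d')"
proof -
  obtain F \<tau> F' \<tau>' where "\<tau>\<^sup>2 = of_int d" "\<tau>'\<^sup>2 = of_int d'"
    "\<forall>k. Rings.coprime k n \<longrightarrow> ipoly_at F (unity_root n ^ k) = of_int (\<epsilon> k) * \<tau>"
    "\<forall>k. Rings.coprime k n \<longrightarrow> ipoly_at F' (unity_root n ^ k) = of_int (\<psi> k) * \<tau>'"
    using assms unfolding sqrt_rep_def by blast
  then show ?thesis
    unfolding sqrt_rep_def
    by (intro exI[of _ "F * F'"] exI[of _ "\<tau> * \<tau>'"]) (simp add: power_mult_distrib hom_distribs)
qed

lemma sqrt_rep_prod:
  assumes "\<And>p. p \<in> A \<Longrightarrow> sqrt_rep n (\<epsilon> p) (d p)"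
  shows "sqrt_rep n (\<lambda>k. \<Prod>p\<in>A. \<epsilon> p k) (\<Prod>p\<in>A. d p)"
  using assms
proof (induction A rule: infinite_finite_induct)
  case (insert p A)
  then show ?case using sqrt_rep_mult[of n "\<epsilon> p" "d p"] by simp
qed (simp_all add: sqrt_rep_one)

lemma unity_root_quotient_power:
  assumes "n > 0" "m dvd n"
  shows "(unity_root n ^ (n div m)) ^ j = 1 \<longleftrightarrow> m dvd j"
proof -
  obtain l where l: "n = m * l" using assms(2) by (elim dvdE)
  have ml: "m > 0" "l > 0" using assms(1) l by auto
  have "(unity_root n ^ (n div m)) ^ j = unity_root n ^ (l * j)"
    using ml by (simp add: l power_mult)
  moreover have "unity_root n ^ (l * j) = 1 \<longleftrightarrow> n dvd l * j"
    using unity_root_power_eq_iff[OF assms(1), of "l * j" 0] by (simp add: cong_0_iff)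
  moreover have "n dvd l * j \<longleftrightarrow> m dvd j"
    using ml by (simp add: l mult.commute[of m])
  ultimately show ?thesis by simp
qed

lemma sqrt_rep_prime:
  assumes "n > 0" "prime p" "odd p" "p dvd n"
  shows "sqrt_rep n (\<lambda>k. Legendre (int k) (int p)) ((-1) ^ ((p - 1) div 2) * int p)"
proof -
  have p2: "2 < p" using prime_ge_2_nat[OF assms(2)] assms(3) by (cases "p = 2") auto
  define \<omega> where "\<omega> = unity_root n ^ (n div p)"
  have \<omega>: "\<omega> ^ m = 1 \<longleftrightarrow> p dvd m" for m
    unfolding \<omega>_def by (rule unity_root_quotient_power[OF assms(1,4)])
  \<comment> \<open>The Gauss sum of \<open>\<omega>\<close>, read as a polynomial in
    \<open>unity_root n\<close>.\<close>
  define F where "F = (\<Sum>b<p. monom (Legendre (int b) (int p)) (n div p * b))"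
  define g where "g k = (\<Sum>b<p. of_int (Legendre (int b) (int p)) * \<omega> ^ (b * k))" for k
  have F: "ipoly_at F (unity_root n ^ k) = g k" for k
  proof -
    have "ipoly_at F x = (\<Sum>b<p. of_int (Legendre (int b) (int p)) * x ^ (n div p * b))" for x
      by (simp add: F_def hom_distribs poly_sum of_int_hom.map_poly_hom_monom poly_monom)
    then show ?thesis
      by (simp add: g_def \<omega>_def mult_ac flip: power_mult)
  qed
  have "g k = of_int (Legendre (int k) (int p)) * g 1" if "Rings.coprime k n" for k
  proof -
    have "\<not> p dvd k"
      using that assms(2,4) by (metis coprime_common_divisor not_prime_unit)
    then show ?thesis
      unfolding g_def by (rule quadratic_gauss_sum(1)[OF assms(2) p2 \<omega>])
  qed
  moreover have "(g 1)\<^sup>2 = of_int ((-1) ^ ((p - 1) div 2) * int p)"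
    unfolding g_def by (rule quadratic_gauss_sum(2)[OF assms(2) p2 \<omega>])
  ultimately show ?thesis
    unfolding sqrt_rep_def F[symmetric] by blast
qed

lemma odd_of_coprime_even: "Rings.coprime k n \<Longrightarrow> even n \<Longrightarrow> odd (k::nat)"
  using coprime_common_divisor[of k n 2] by auto

text \<open>A primitive fourth root of unity is a square root of -1, and its k-th power depends only
  on k modulo 4.\<close>

lemma sqrt_rep_minus_one:
  assumes "n > 0" "4 dvd n"
  shows "sqrt_rep n sym4 (-1)"
proof -
  define \<omega> where "\<omega> = unity_root n ^ (n div 4)"
  have \<omega>: "\<omega> ^ m = 1 \<longleftrightarrow> 4 dvd m" for m
    unfolding \<omega>_def by (rule unity_root_quotient_power[OF assms])
  have "(\<omega>\<^sup>2 - 1) * (\<omega>\<^sup>2 + 1) = 0"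
    using \<omega>[of 4] by (simp add: algebra_simps flip: power_add)
  moreover have "\<omega>\<^sup>2 \<noteq> 1" using \<omega>[of 2] by simp
  ultimately have sq: "\<omega>\<^sup>2 = -1" by (simp add: eq_neg_iff_add_eq_0)
  have "\<omega> ^ k = of_int (sym4 k) * \<omega>" if "odd k" for k
  proof -
    have "\<omega> ^ k = \<omega> ^ (k mod 4)"
      using \<omega>[of 4] power_mod_exponent[of \<omega> 4 k] by simp
    moreover have "k mod 4 = 1 \<or> k mod 4 = 3" using that by presburger
    moreover have "\<omega> ^ 3 = - \<omega>" using sq by (simp add: power3_eq_cube power2_eq_square)
    ultimately show ?thesis by (auto simp: sym4_def)
  qed
  moreover have "odd k" if "Rings.coprime k n" for k
    using that assms(2) by (intro odd_of_coprime_even[OF that]) auto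
  ultimately show ?thesis
    unfolding sqrt_rep_def using sq
    by (intro exI[of _ "monom 1 (n div 4)"] exI[of _ \<omega>])
       (simp add: of_int_hom.map_poly_hom_monom poly_monom \<omega>_def mult.commute flip: power_mult)
qed

lemma sqrt_rep_two:
  assumes "n > 0" "8 dvd n"
  shows "sqrt_rep n chi8 2"
proof -
  define \<omega> where "\<omega> = unity_root n ^ (n div 8)"
  have \<omega>: "\<omega> ^ m = 1 \<longleftrightarrow> 8 dvd m" for m
    unfolding \<omega>_def by (rule unity_root_quotient_power[OF assms])
  have "(\<omega> ^ 4 - 1) * (\<omega> ^ 4 + 1) = 0"
    using \<omega>[of 8] by (simp add: algebra_simps flip: power_add)
  moreover have "\<omega> ^ 4 \<noteq> 1" using \<omega>[of 4] by simp
  ultimately have w4: "\<omega> ^ 4 = -1" by (simp add: eq_neg_iff_add_eq_0)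
  have w: "\<omega> ^ 5 = - \<omega>" "\<omega> ^ 7 = - (\<omega> ^ 3)" "\<omega> ^ 6 = - (\<omega>\<^sup>2)" "\<omega> ^ 8 = 1"
    using w4 power_add[of \<omega> 4 1] power_add[of \<omega> 4 3] power_add[of \<omega> 4 2] power_add[of \<omega> 4 4] by simp_all
  have pmod: "\<omega> ^ m = \<omega> ^ (m mod 8)" for m
    using w(4) power_mod_exponent[of \<omega> 8 m] by simp
  \<comment> \<open>As \<open>\<omega> ^ 7\<close> is the inverse of \<open>\<omega>\<close>, this
    is 2 cos(pi/4).\<close>
  define \<tau> where "\<tau> = \<omega> + \<omega> ^ 7"
  have sq: "\<tau>\<^sup>2 = 2"
  proof -
    have "\<tau>\<^sup>2 = \<omega>\<^sup>2 - 2 * \<omega> ^ 4 + \<omega> ^ 6"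
      unfolding \<tau>_def w(2) by (simp add: power2_eq_square algebra_simps eval_nat_numeral)
    then show ?thesis by (simp add: w w4)
  qed
  have "\<omega> ^ k + \<omega> ^ (7 * k) = of_int (chi8 k) * \<tau>" if "odd k" for k
  proof -
    have "k mod 8 = 1 \<or> k mod 8 = 3 \<or> k mod 8 = 5 \<or> k mod 8 = 7"
      using that by presburger
    moreover have "7 * k mod 8 = 7 * (k mod 8) mod 8" by (simp add: mod_mult_right_eq)
    ultimately show ?thesis
      unfolding pmod[of k] pmod[of "7 * k"] by (auto simp: chi8_def \<tau>_def w)
  qed
  moreover have "odd k" if "Rings.coprime k n" for k
    using that assms(2) by (intro odd_of_coprime_even[OF that]) auto
  ultimately show ?thesis
    unfolding sqrt_rep_def using sq
    by (intro exI[of _ "monom 1 (n div 8) + monom 1 (n div 8 * 7)"] exI[of _ \<tau>])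
       (simp add: hom_distribs of_int_hom.map_poly_hom_monom poly_monom \<omega>_def mult_ac flip: power_mult)
qed

lemma power_dvd_of_multiplicity:
  assumes "\<not> multiplicity 2 n < i" shows "(2::nat) ^ i dvd n"
  using assms by (simp add: multiplicity_dvd')

definition quad_chi :: "nat \<Rightarrow> nat \<Rightarrow> nat set \<Rightarrow> nat \<Rightarrow> int" where
  "quad_chi w0 w W k = chi8 k ^ w0 * sym4 k ^ w * (\<Prod>p\<in>W. Legendre (int k) (int p))"

lemma sqrt_rep_Delta:
  assumes "n > 0" "w0 \<in> {0, 1}" "w \<in> {0, 1}" "W \<subseteq> odd_prime_divs n"
    "multiplicity 2 n < 3 \<Longrightarrow> w0 = 0" "multiplicity 2 n < 2 \<Longrightarrow> w = 0"
  shows "sqrt_rep n (quad_chi w0 w W) (Delta w0 w W)"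
proof -
  have "sqrt_rep n (\<lambda>k. chi8 k ^ w0) (2 ^ w0)"
  proof (cases "w0 = 0")
    case False
    then have "8 dvd n" using assms(2,5) power_dvd_of_multiplicity[of n 3] by auto
    then show ?thesis using sqrt_rep_two[OF assms(1)] False assms(2) by simp
  qed (simp add: sqrt_rep_one)
  moreover have "sqrt_rep n (\<lambda>k. sym4 k ^ w) ((-1) ^ w)"
  proof (cases "w = 0")
    case False
    then have "4 dvd n" using assms(3,6) power_dvd_of_multiplicity[of n 2] by auto
    then show ?thesis using sqrt_rep_minus_one[OF assms(1)] False assms(3) by simp
  qed (simp add: sqrt_rep_one)
  moreover have "sqrt_rep n (\<lambda>k. \<Prod>p\<in>W. Legendre (int k) (int p)) (\<Prod>p\<in>W. (-1) ^ ((p - 1) div 2) * int p)"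
    using assms(1,4) by (intro sqrt_rep_prod sqrt_rep_prime) (auto simp: odd_prime_divs_def)
  ultimately show ?thesis
    unfolding quad_chi_def Delta_def by (intro sqrt_rep_mult)
qed

lemma quad_chi_values:
  assumes "W \<subseteq> odd_prime_divs n" "Rings.coprime k n"
  shows "quad_chi w0 w W k = 1 \<or> quad_chi w0 w W k = -1"
proof -
  have pm: "x * y = 1 \<or> x * y = -1" if "x = 1 \<or> x = -1" "y = 1 \<or> y = -1" for x y :: int
    using that by auto
  have "(\<Prod>p\<in>W. Legendre (int k) (int p)) = 1 \<or> (\<Prod>p\<in>W. Legendre (int k) (int p)) = -1"
    using assms(1)
  proof (induction W rule: infinite_finite_induct)
    case (insert p W)
    have "Legendre (int k) (int p) = 1 \<or> Legendre (int k) (int p) = -1"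
      using insert.prems assms(2) by (intro Legendre_coprime) (auto simp: odd_prime_divs_def elim: coprime_imp_coprime dvd_trans)
    then show ?case using insert pm by simp
  qed auto
  moreover have "chi8 k ^ w0 = 1 \<or> chi8 k ^ w0 = -1" "sym4 k ^ w = 1 \<or> sym4 k ^ w = -1"
    by (auto simp: chi8_def sym4_def minus_one_power_iff)
  ultimately show ?thesis unfolding quad_chi_def by (intro pm)
qed

lemma quad_chi_one:
  assumes "W \<subseteq> odd_prime_divs n"
  shows "quad_chi w0 w W 1 = 1"
proof -
  have "(\<Prod>p\<in>W. Legendre (int 1) (int p)) = (\<Prod>p\<in>W. 1)"
    using assms by (intro prod.cong refl) (auto simp: odd_prime_divs_def Legendre_one)
  then show ?thesis by (simp add: quad_chi_def chi8_def sym4_def)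
qed

text \<open>Up to sign the factors are distinct odd primes and possibly 2. The property is what
  makes \<open>rational_multiple_integral\<close> and \<open>exists_nonkernel\<close> work.\<close>

lemma squarefree_Delta:
  assumes "w0 \<in> {0, 1}" "W \<subseteq> odd_prime_divs n"
  shows "squarefree (Delta w0 w W)"
proof -
  have W: "prime p" "odd p" if "p \<in> W" for p
    using assms(2) that by (auto simp: odd_prime_divs_def)
  have pm: "squarefree ((-1) ^ i * (x::int)) \<longleftrightarrow> squarefree x" for i x
    by (cases "even i") (auto simp: squarefree_minus)
  have cop: "Rings.coprime ((-1) ^ i * (x::int)) y \<longleftrightarrow> Rings.coprime x y" for i x y
    by (cases "even i") auto
  have "squarefree (\<Prod>p\<in>W. (-1) ^ ((p - 1) div 2) * int p)"
  proof (rule squarefree_prod_coprime)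
    fix p q assume pq: "p \<in> W" "q \<in> W" "p \<noteq> q"
    then have "Rings.coprime p q" using W primes_coprime[of p q] by blast
    then have "Rings.coprime (int p) (int q)" by simp
    then show "Rings.coprime ((-1) ^ ((p - 1) div 2) * int p) ((-1) ^ ((q - 1) div 2) * int q)"
      by (simp add: cop coprime_commute)
  next
    fix p assume "p \<in> W"
    then show "squarefree ((-1) ^ ((p - 1) div 2) * int p)"
      using W by (simp add: pm squarefree_prime)
  qed
  moreover have "Rings.coprime (2 ^ w0) (\<Prod>p\<in>W. (-1) ^ ((p - 1) div 2) * int p)"
  proof (rule prod_coprime_right)
    fix p assume "p \<in> W"
    then have "Rings.coprime (int p) (2 ^ w0)" using W by (simp add: coprime_power_right_iff)
    then show "Rings.coprime (2 ^ w0) ((-1) ^ ((p - 1) div 2) * int p)"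
      unfolding algebraic_semidom_class.coprime_commute[of "2 ^ w0"] cop .
  qed
  moreover have "squarefree ((2::int) ^ w0)" using assms(1) by (auto simp: squarefree_prime)
  ultimately have "squarefree (2 ^ w0 * (\<Prod>p\<in>W. (-1) ^ ((p - 1) div 2) * int p))"
    by (intro squarefree_mult_coprime)
  then have "squarefree ((-1) ^ w * (2 ^ w0 * (\<Prod>p\<in>W. (-1) ^ ((p - 1) div 2) * int p)))"
    by (simp only: pm)
  then show ?thesis by (simp add: Delta_def mult_ac)
qed

section \<open>Galois action through a quadratic character\<close>

text \<open>Collects what the eigenvalue argument uses about the discriminant. The polynomial
  \<open>F\<close> ties \<open>\<tau>\<close> to the roots of unity; multiplicativity and
  periodicity of \<open>\<epsilon>\<close> are not assumed but derived from it.\<close>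

locale quadratic_character =
  fixes n :: nat and \<epsilon> :: "nat \<Rightarrow> int" and F :: "int poly" and \<tau> :: complex and d :: int
  assumes n: "n > 0"
    and eps_values: "\<And>k. Rings.coprime k n \<Longrightarrow> \<epsilon> k = 1 \<or> \<epsilon> k = -1"
    and at_one: "\<epsilon> 1 = 1"
    and F_at: "\<And>k. Rings.coprime k n \<Longrightarrow> ipoly_at F (unity_root n ^ k) = of_int (\<epsilon> k) * \<tau>"
    and square: "\<tau>\<^sup>2 = of_int d"
    and sqfree: "squarefree d"
begin

definition kernel :: "nat set" where
  "kernel = {k \<in> units_mod n. \<epsilon> k = 1}"

lemma units_coprime: "k \<in> units_mod n \<Longrightarrow> Rings.coprime k n"
  by (simp add: units_mod_def)

lemma finite_units [simp]: "finite (units_mod n)"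
  by (rule finite_subset[of _ "{..<n}"]) (auto simp: units_mod_def)

lemma d_nonzero: "d \<noteq> 0"
  using sqfree by auto

lemma tau_nonzero: "\<tau> \<noteq> 0"
  using square d_nonzero by auto

lemma F_expand: "ipoly_at F x = (\<Sum>i\<le>degree F. of_rat (of_int (coeff F i)) * x ^ i)"
  by (simp add: poly_altdef degree_map_poly coeff_map_poly)

lemma tau_expand: "\<tau> = (\<Sum>i\<le>degree F. of_rat (of_int (coeff F i)) * unity_root n ^ i)"
  using F_at[of 1] at_one F_expand[of "unity_root n"] by simp

text \<open>The sign of the Gauss sum is never determined: only the square of \<open>\<tau>\<close>
  is known, and both the quadratic field and the set of integer multiples are unaffected by a change
  of sign.\<close>

lemma csqrt_cases: "csqrt (of_int d) = \<tau> \<or> csqrt (of_int d) = - \<tau>"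
  using square power2_csqrt[of "of_int d"] power2_eq_iff[of "csqrt (of_int d)" \<tau>] by simp

lemma quad_field_iff: "x \<in> quad_field d \<longleftrightarrow> (\<exists>a b. x = of_rat a + of_rat b * \<tau>)"
proof -
  have "(\<exists>a b. x = of_rat a - of_rat b * \<tau>) \<longleftrightarrow> (\<exists>a b. x = of_rat a + of_rat b * \<tau>)"
  proof
    assume "\<exists>a b. x = of_rat a - of_rat b * \<tau>"
    then obtain a b where "x = of_rat a + of_rat (- b) * \<tau>" by (auto simp: of_rat_minus)
    then show "\<exists>a b. x = of_rat a + of_rat b * \<tau>" by blast
  next
    assume "\<exists>a b. x = of_rat a + of_rat b * \<tau>"
    then obtain a b where "x = of_rat a + of_rat b * \<tau>" by blast
    then have "x = of_rat a - of_rat (- b) * \<tau>" by (simp add: of_rat_minus)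
    then show "\<exists>a b. x = of_rat a - of_rat b * \<tau>" by blast
  qed
  then show ?thesis
    using csqrt_cases by (elim disjE) (simp_all add: quad_field_def)
qed

text \<open>By the expansion of \<open>\<tau>\<close> the right-hand side is itself a rational
  combination of roots of unity. Moved to the left it yields a single relation for
  \<open>rat_relation_coprime_power\<close>, and the conjugate of \<open>\<tau>\<close> is read off
  from \<open>F_at\<close>.\<close>

lemma galois_transform:
  fixes c :: "'i \<Rightarrow> rat" and m :: "'i \<Rightarrow> nat"
  assumes "finite J" "Rings.coprime k n"
    and eq: "(\<Sum>j\<in>J. of_rat (c j) * unity_root n ^ m j) = of_rat a + of_rat b * \<tau>"
  shows "(\<Sum>j\<in>J. of_rat (c j) * unity_root n ^ (m j * k)) = of_rat a + of_rat b * (of_int (\<epsilon> k) * \<tau>)"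
proof -
  let ?z = "unity_root n"
  let ?D = "degree F"
  \<comment> \<open>The left summand indexes the given sum; on the right, indices up to
    \<open>?D\<close> carry the coefficients of -b F, and the extra index \<open>Suc ?D\<close>
    carries the constant -a with exponent 0.\<close>
  define A where "A = (Inl ` J) \<union> Inr ` {..Suc ?D}"
  define c' where "c' = case_sum c (\<lambda>i. if i \<le> ?D then - b * of_int (coeff F i) else - a)"
  define m' where "m' = case_sum m (\<lambda>i. if i \<le> ?D then i else 0)"
  have split: "(\<Sum>j\<in>A. of_rat (c' j) * x ^ (m' j * l))
      = (\<Sum>j\<in>J. of_rat (c j) * x ^ (m j * l)) - of_rat b * (\<Sum>i\<le>?D. of_rat (of_int (coeff F i)) * x ^ (i * l)) - of_rat a"
    for x :: complex and l :: nat
  proof -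
    have "(\<Sum>j\<in>A. of_rat (c' j) * x ^ (m' j * l))
        = (\<Sum>j\<in>Inl ` J. of_rat (c' j) * x ^ (m' j * l)) + (\<Sum>j\<in>Inr ` {..Suc ?D}. of_rat (c' j) * x ^ (m' j * l))"
      unfolding A_def using assms(1) by (intro sum.union_disjoint) auto
    also have "(\<Sum>j\<in>Inl ` J. of_rat (c' j) * x ^ (m' j * l)) = (\<Sum>j\<in>J. of_rat (c j) * x ^ (m j * l))"
      by (subst sum.reindex) (auto simp: c'_def m'_def)
    also have "(\<Sum>j\<in>Inr ` {..Suc ?D}. of_rat (c' j) * x ^ (m' j * l))
        = (\<Sum>i\<le>?D. of_rat (- b * of_int (coeff F i)) * x ^ (i * l)) - of_rat a"
      by (subst sum.reindex) (auto simp: c'_def m'_def of_rat_minus)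
    finally show ?thesis by (simp add: of_rat_mult of_rat_minus sum_distrib_left sum_negf mult.assoc)
  qed
  have fin: "finite A" using assms(1) by (simp add: A_def)
  have "(\<Sum>j\<in>A. of_rat (c' j) * ?z ^ m' j) = 0"
    using split[of ?z 1] eq tau_expand by simp
  from rat_relation_coprime_power[OF n assms(2) _ fin this]
  have "(\<Sum>j\<in>A. of_rat (c' j) * ?z ^ (m' j * k)) = 0" using n by simp
  then have "(\<Sum>j\<in>J. of_rat (c j) * ?z ^ (m j * k))
      = of_rat b * (\<Sum>i\<le>?D. of_rat (of_int (coeff F i)) * ?z ^ (i * k)) + of_rat a"
    unfolding split by (simp add: algebra_simps)
  also have "(\<Sum>i\<le>?D. of_rat (of_int (coeff F i)) * ?z ^ (i * k)) = ipoly_at F (?z ^ k)"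
    unfolding F_expand by (simp add: mult.commute flip: power_mult)
  finally show ?thesis using F_at[OF assms(2)] by simp
qed

text \<open>Raising to the k-th and then to the l-th power multiplies \<open>\<tau>\<close> by both
  signs, while \<open>F_at\<close> at the product k l gives the sign of the product.\<close>

lemma eps_mult:
  assumes "Rings.coprime k n" "Rings.coprime l n"
  shows "\<epsilon> (k * l) = \<epsilon> k * \<epsilon> l"
proof -
  let ?c = "\<lambda>i. of_int (coeff F i) :: rat"
  have "(\<Sum>i\<le>degree F. of_rat (?c i) * unity_root n ^ (i * k)) = ipoly_at F (unity_root n ^ k)" for k
    unfolding F_expand by (simp add: mult.commute flip: power_mult)
  note ev = this
  have "(\<Sum>i\<le>degree F. of_rat (?c i) * unity_root n ^ (i * k)) = of_rat 0 + of_rat (of_int (\<epsilon> k)) * \<tau>"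
    using ev F_at[OF assms(1)] by simp
  from galois_transform[OF _ assms(2) this]
  have "ipoly_at F (unity_root n ^ (k * l)) = of_int (\<epsilon> k) * (of_int (\<epsilon> l) * \<tau>)"
    using ev[of "k * l"] by (simp add: mult.assoc)
  then have "of_int (\<epsilon> (k * l)) * \<tau> = of_int (\<epsilon> k * \<epsilon> l) * \<tau>"
    using F_at[of "k * l"] assms by simp
  then have "(of_int (\<epsilon> (k * l)) :: complex) = of_int (\<epsilon> k * \<epsilon> l)"
    using tau_nonzero by simp
  then show ?thesis by (simp only: of_int_eq_iff)
qed

lemma eps_mod:
  assumes "Rings.coprime k n"
  shows "\<epsilon> (k mod n) = \<epsilon> k"
proof -
  have "Rings.coprime (k mod n) n" using assms n by simp
  then have "of_int (\<epsilon> (k mod n)) * \<tau> = of_int (\<epsilon> k) * \<tau>"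
    using F_at[OF assms] F_at[of "k mod n"] power_mod_exponent[of "unity_root n" n k] n by auto
  then show ?thesis using tau_nonzero by simp
qed

lemma sum_units_Rats: "(\<Sum>k\<in>units_mod n. unity_root n ^ (j * k)) \<in> \<rat>"
  by (rule units_mod_sum_unity_root_Rats[OF n])

text \<open>Multiplication by \<open>\<tau>\<close> turns each sign into a value of
  \<open>F\<close>, so the product is an integer combination of Ramanujan sums and hence rational;
  since \<open>\<tau>\<close> squares to \<open>d\<close>, the sum itself is a rational multiple of
  \<open>\<tau>\<close>.\<close>

lemma eps_sum_units:
  "\<exists>b. (\<Sum>k\<in>units_mod n. of_int (\<epsilon> k) * unity_root n ^ (j * k)) = of_rat b * \<tau>"
proof -
  let ?z = "unity_root n"
  define S where "S = (\<Sum>k\<in>units_mod n. of_int (\<epsilon> k) * ?z ^ (j * k))"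
  have "S * \<tau> = (\<Sum>k\<in>units_mod n. ?z ^ (j * k) * ipoly_at F (?z ^ k))"
    unfolding S_def sum_distrib_right using F_at units_coprime by (intro sum.cong) (auto simp: mult_ac)
  also have "\<dots> = (\<Sum>k\<in>units_mod n. \<Sum>i\<le>degree F. of_rat (of_int (coeff F i)) * ?z ^ ((j + i) * k))"
    by (intro sum.cong refl)
       (simp add: F_expand sum_distrib_left power_add algebra_simps flip: power_mult)
  also have "\<dots> = (\<Sum>i\<le>degree F. of_rat (of_int (coeff F i)) * (\<Sum>k\<in>units_mod n. ?z ^ ((j + i) * k)))"
    by (subst sum.swap) (simp add: sum_distrib_left)
  also have "\<dots> \<in> \<rat>"
    by (rule Rats_sum) (rule Rats_mult[OF Rats_of_rat sum_units_Rats])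
  finally obtain q where q: "S * \<tau> = of_rat q" by (auto elim: Rats_cases)
  have "S * of_int d = of_rat q * \<tau>"
    unfolding q[symmetric] square[symmetric] by (simp add: power2_eq_square)
  then have "S = of_rat (q / of_int d) * \<tau>"
    using d_nonzero by (simp add: of_rat_divide field_simps)
  then show ?thesis unfolding S_def by blast
qed

text \<open>The square is b^2 d, a rational algebraic integer and so an integer. With b = x / y in
  lowest terms, y^2 divides d, which forces y = 1.\<close>

lemma rational_multiple_integral:
  assumes "algebraic_int ((of_rat b * \<tau>)\<^sup>2)"
  shows "b \<in> \<int>"
proof -
  have "(of_rat b * \<tau>)\<^sup>2 = of_rat (b\<^sup>2 * of_int d)"
    by (simp add: power_mult_distrib square of_rat_mult of_rat_power)
  from assms[unfolded this] have "(of_rat (b\<^sup>2 * of_int d) :: complex) \<in> \<int>"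
    by (rule rational_algebraic_int_is_int) (rule Rats_of_rat)
  then obtain z where "(of_rat (b\<^sup>2 * of_int d) :: complex) = of_rat (of_int z)" by (auto elim: Ints_cases)
  then have z: "b\<^sup>2 * of_int d = of_int z" by (simp only: of_rat_eq_iff)
  obtain x y where xy: "b = of_int x / of_int y" "y > 0" "Rings.coprime x y"
    by (metis quotient_of_div quotient_of_coprime quotient_of_denom_pos surj_pair)
  have "of_int (x\<^sup>2 * d) = (of_int (z * y\<^sup>2) :: rat)"
    using z xy(2) unfolding xy(1) by (simp add: field_simps power2_eq_square)
  then have "x\<^sup>2 * d = z * y\<^sup>2" by (simp only: of_int_eq_iff)
  then have "y\<^sup>2 dvd x\<^sup>2 * d" by simp
  moreover have "Rings.coprime (y\<^sup>2) (x\<^sup>2)" using xy(3) by (simp add: algebraic_semidom_class.coprime_commute)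
  ultimately have "y\<^sup>2 dvd d" by (simp add: coprime_dvd_mult_right_iff)
  then have "y dvd 1" using squarefreeD[OF sqfree] by blast
  then have "y = 1" using xy(2) by simp
  then show ?thesis using xy(1) by simp
qed

text \<open>For n = 1 the only element of \<open>units_mod n\<close> is 0, so the unit is written
  \<open>1 mod n\<close>.\<close>

lemma one_mod_unit: "1 mod n \<in> kernel"
  using n eps_mod[of 1] at_one by (auto simp: kernel_def units_mod_def)

text \<open>If \<open>\<epsilon>\<close> were 1 on all units, \<open>F\<close> would take the value
  \<open>\<tau>\<close> at all primitive roots, and the sum of these values is a combination of
  Ramanujan sums. So \<open>\<tau>\<close> would be rational, whereas a squarefree \<open>d\<close>
  other than 1 has no rational square root.\<close>

lemma exists_nonkernel:
  assumes "d \<noteq> 1"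
  shows "\<exists>k. k \<in> units_mod n - kernel"
proof (rule ccontr)
  assume "\<nexists>k. k \<in> units_mod n - kernel"
  then have all: "\<epsilon> k = 1" if "k \<in> units_mod n" for k using that by (auto simp: kernel_def)
  have "of_nat (card (units_mod n)) * \<tau> = (\<Sum>k\<in>units_mod n. ipoly_at F (unity_root n ^ k))"
    using all F_at units_coprime by simp
  also have "\<dots> = (\<Sum>k\<in>units_mod n. \<Sum>i\<le>degree F. of_rat (of_int (coeff F i)) * unity_root n ^ (i * k))"
    by (intro sum.cong refl) (simp add: F_expand mult.commute flip: power_mult)
  also have "\<dots> = (\<Sum>i\<le>degree F. of_rat (of_int (coeff F i)) * (\<Sum>k\<in>units_mod n. unity_root n ^ (i * k)))"
    by (subst sum.swap) (simp add: sum_distrib_left)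
  also have "\<dots> \<in> \<rat>" by (rule Rats_sum) (rule Rats_mult[OF Rats_of_rat sum_units_Rats])
  finally have "of_nat (card (units_mod n)) * \<tau> / of_nat (card (units_mod n)) \<in> \<rat>"
    by (intro Rats_divide) auto
  moreover have "card (units_mod n) \<noteq> 0"
    using one_mod_unit by (auto simp: kernel_def)
  ultimately have "\<tau> \<in> \<rat>" by simp
  then obtain t where t: "\<tau> = of_rat t" by (auto elim: Rats_cases)
  have "of_rat (t\<^sup>2) = (of_rat (of_int d) :: complex)" using square t by (simp add: of_rat_power)
  then have td: "t\<^sup>2 = of_int d" by (simp only: of_rat_eq_iff)
  \<comment> \<open>Integrality is applied to the rational number 1 / t, whose product with
    \<open>\<tau>\<close> is 1; it gives t = 1 / z with an integer z, and then z^2 d = 1.\<close>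
  have "(of_rat (1 / t) * \<tau>)\<^sup>2 = 1" using t tau_nonzero by (simp add: of_rat_divide)
  then have "1 / t \<in> \<int>" using rational_multiple_integral by simp
  then obtain z where z: "1 / t = of_int z" by (auto elim: Ints_cases)
  have "t \<noteq> 0" using t tau_nonzero by auto
  then have "of_int z * t = 1" using z by (simp add: field_simps)
  moreover have "of_int (z\<^sup>2 * d) = (of_int z * t)\<^sup>2" by (simp add: power_mult_distrib td)
  ultimately have "of_int (z\<^sup>2 * d) = (of_int 1 :: rat)" by simp
  then have "z\<^sup>2 * d = 1" by (simp only: of_int_eq_iff)
  moreover from this have "z\<^sup>2 = 1" using zmult_eq_1_iff[of "z\<^sup>2" d] zero_le_power2[of z] by linarith
  ultimately have "d = 1" by simp
  with assms show False by simp
qed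

text \<open>The power n - 1 is complex conjugation on roots of unity, and \<open>F\<close> has real
  coefficients, so conjugation multiplies \<open>\<tau>\<close> by the sign in question. That sign
  times \<open>d\<close> is the squared modulus of \<open>\<tau>\<close>, hence positive.\<close>

lemma eps_minus_one:
  assumes "n > 1"
  shows "\<epsilon> (n - 1) = (if d < 0 then -1 else 1)"
proof -
  let ?z = "unity_root n"
  have cop: "Rings.coprime (n - 1) n" using n by (rule coprime_diff_one_left_nat)
  have "?z ^ (n - 1) * ?z = 1"
    using n by (simp flip: power_Suc2)
  moreover have "cnj ?z * ?z = 1" by (simp add: unity_root_def cis_cnj cis_mult)
  ultimately have inv: "?z ^ (n - 1) = cnj ?z" by (metis unity_root_nonzero mult_right_cancel)
  have "cnj (ipoly_at F ?z) = ipoly_at F (cnj ?z)"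
    unfolding F_expand by simp
  then have conj: "cnj \<tau> = of_int (\<epsilon> (n - 1)) * \<tau>"
    using F_at[OF cop] F_at[of 1] at_one inv by simp
  have sq: "cnj \<tau> * \<tau> = of_int (\<epsilon> (n - 1) * d)"
    unfolding conj using square by (simp add: power2_eq_square mult.assoc)
  have "cnj \<tau> * \<tau> = of_real ((cmod \<tau>)\<^sup>2)"
    by (simp only: complex_norm_square mult.commute)
  then have "(of_real (of_int (\<epsilon> (n - 1) * d)) :: complex) = of_real ((cmod \<tau>)\<^sup>2)"
    using sq by simp
  then have "real_of_int (\<epsilon> (n - 1) * d) = (cmod \<tau>)\<^sup>2" by (simp only: of_real_eq_iff)
  moreover have "(cmod \<tau>)\<^sup>2 > 0" using tau_nonzero by simp
  ultimately have "\<epsilon> (n - 1) * d > 0" by (metis of_int_0_less_iff)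
  then show ?thesis using eps_values[OF cop] by (auto split: if_splits)
qed

end

section \<open>Eigenvalues of class functions\<close>

context finite_group
begin

section \<open>The exponent and the power maps of the group\<close>

lemma grp_exponent_pos: "grp_exponent G > 0"
  and pow_grp_exponent: "g \<in> carrier G \<Longrightarrow> g [^] grp_exponent G = \<one>"
proof -
  have "Coset.order G > 0 \<and> (\<forall>g\<in>carrier G. g [^] Coset.order G = \<one>)"
    using pow_order_eq_1 order_gt_0_iff_finite by auto
  from LeastI[of "\<lambda>n. 0 < n \<and> (\<forall>g\<in>carrier G. g [^] n = \<one>)", OF this]
  show "grp_exponent G > 0" "g \<in> carrier G \<Longrightarrow> g [^] grp_exponent G = \<one>"
    unfolding grp_exponent_def by auto
qed

lemma pow_mod_exponent:
  assumes "g \<in> carrier G"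
  shows "g [^] (k mod grp_exponent G) = g [^] k"
proof -
  let ?n = "grp_exponent G"
  have "g [^] k = g [^] (?n * (k div ?n) + k mod ?n)" by simp
  also have "\<dots> = (g [^] ?n) [^] (k div ?n) \<otimes> g [^] (k mod ?n)"
    using assms by (simp only: nat_pow_mult nat_pow_pow)
  finally show ?thesis using assms by (simp add: pow_grp_exponent)
qed

lemma pow_cong_exponent:
  "g \<in> carrier G \<Longrightarrow> [k = l] (mod grp_exponent G) \<Longrightarrow> g [^] k = g [^] l"
  by (metis pow_mod_exponent Cong.cong_def)

lemma coprime_inverse_exponent:
  assumes "Rings.coprime k (grp_exponent G)"
  shows "\<exists>l. Rings.coprime l (grp_exponent G) \<and> [k * l = 1] (mod grp_exponent G) \<and>
    (\<forall>g\<in>carrier G. (g [^] k) [^] l = g \<and> (g [^] l) [^] k = g)"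
proof -
  obtain l where l: "[k * l = 1] (mod grp_exponent G)"
    using cong_solve_coprime_nat[OF assms] by auto
  have "Rings.coprime (k * l) (grp_exponent G)"
    using l cong_imp_coprime[of 1 "k * l"] by (simp add: cong_sym)
  then have "Rings.coprime l (grp_exponent G)" by simp
  moreover have "(g [^] k) [^] l = g" "(g [^] l) [^] k = g" if "g \<in> carrier G" for g
    using pow_cong_exponent[OF that l] that by (simp_all add: nat_pow_pow mult.commute)
  ultimately show ?thesis using l by blast
qed

lemma bij_pow:
  assumes "Rings.coprime k (grp_exponent G)"
  shows "bij_betw (\<lambda>g. g [^] k) (carrier G) (carrier G)"
proof -
  obtain l :: nat where "\<forall>g\<in>carrier G. (g [^] k) [^] l = g \<and> (g [^] l) [^] k = g"
    using coprime_inverse_exponent[OF assms] by blast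
  then show ?thesis by (intro bij_betw_byWitness[where f' = "\<lambda>g. g [^] l"]) auto
qed

lemma conj_pow:
  assumes "x \<in> carrier G" "g \<in> carrier G"
  shows "(x \<otimes> g \<otimes> inv x) [^] (k::nat) = x \<otimes> g [^] k \<otimes> inv x"
proof (induction k)
  case (Suc k)
  have "x \<otimes> g [^] k \<otimes> inv x \<otimes> (x \<otimes> g \<otimes> inv x) = x \<otimes> (g [^] k \<otimes> g) \<otimes> inv x"
    using assms by (simp add: m_assoc)
  then show ?case using Suc by simp
qed (use assms in simp)

lemma pow_exponent_minus_one:
  assumes "g \<in> carrier G"
  shows "g [^] (grp_exponent G - 1) = inv g"
proof (rule inv_equality[symmetric])
  have "g [^] (grp_exponent G - 1) \<otimes> g = g [^] Suc (grp_exponent G - 1)" by simp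
  also have "Suc (grp_exponent G - 1) = grp_exponent G" using grp_exponent_pos by simp
  finally show "g [^] (grp_exponent G - 1) \<otimes> g = \<one>" using assms pow_grp_exponent by simp
qed (use assms in auto)

section \<open>From the matrix to convolution and trace formulas\<close>

definition lift_fun :: "('a \<Rightarrow> int) \<Rightarrow> 'a \<Rightarrow> complex" where
  "lift_fun f x = (if x \<in> carrier G then of_int (f x) else 0)"

lemma class_fun_lift:
  assumes "\<And>g x. g \<in> carrier G \<Longrightarrow> x \<in> carrier G \<Longrightarrow> f (x \<otimes> g \<otimes> inv x) = f g"
  shows "class_fun (lift_fun f)"
  using assms by (auto simp: class_fun_def supp_def lift_fun_def)

text \<open>Since the (a, b) entry is f at \<open>b \<otimes> inv a\<close>, the matrix acts on
  \<open>w\<close> as right convolution by \<open>f\<close> acts on the function sending x to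
  \<open>w (inv x)\<close>; centrality of \<open>f\<close> moves it to the left.\<close>

lemma eigenvalue_on_iff_conv:
  assumes f: "class_fun (lift_fun f)"
  shows "eigenvalue_on (carrier G) (\<lambda>a b. f (b \<otimes> inv a)) \<theta> \<longleftrightarrow>
    (\<exists>v. supp v \<and> v \<noteq> (\<lambda>x. 0) \<and> lift_fun f \<star> v = (\<lambda>x. \<theta> * v x))"
proof
  assume "eigenvalue_on (carrier G) (\<lambda>a b. f (b \<otimes> inv a)) \<theta>"
  then obtain w x where x: "x \<in> carrier G" "w x \<noteq> 0"
    and w: "\<And>a. a \<in> carrier G \<Longrightarrow> (\<Sum>b\<in>carrier G. of_int (f (b \<otimes> inv a)) * w b) = \<theta> * w a"
    unfolding eigenvalue_on_def by blast
  define v where "v x = (if x \<in> carrier G then w (inv x) else 0)" for x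
  have "v (inv x) \<noteq> 0" using x by (simp add: v_def)
  then have "v \<noteq> (\<lambda>x. 0)" by auto
  moreover have "(lift_fun f \<star> v) z = \<theta> * v z" for z
  proof (cases "z \<in> carrier G")
    case z: True
    have "(lift_fun f \<star> v) z = (v \<star> lift_fun f) z" by (simp only: class_fun_conv_commute[OF f])
    also have "\<dots> = (\<Sum>y\<in>carrier G. of_int (f (inv y \<otimes> z)) * w (inv y))"
      using z by (simp add: conv_def v_def lift_fun_def mult.commute)
    also have "\<dots> = (\<Sum>b\<in>carrier G. of_int (f (b \<otimes> z)) * w b)"
      by (rule sum.reindex_bij_betw[OF bij_inv])
    also have "\<dots> = \<theta> * w (inv z)" using w[of "inv z"] z by simp
    finally show ?thesis using z by (simp add: v_def)
  qed (simp add: conv_def v_def)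
  ultimately show "\<exists>v. supp v \<and> v \<noteq> (\<lambda>x. 0) \<and> lift_fun f \<star> v = (\<lambda>x. \<theta> * v x)"
    by (intro exI[of _ v]) (auto simp: supp_def v_def)
next
  assume "\<exists>v. supp v \<and> v \<noteq> (\<lambda>x. 0) \<and> lift_fun f \<star> v = (\<lambda>x. \<theta> * v x)"
  then obtain v where v: "supp v" "v \<noteq> (\<lambda>x. 0)" "lift_fun f \<star> v = (\<lambda>x. \<theta> * v x)" by blast
  then obtain x where x: "v x \<noteq> 0" by auto
  then have "x \<in> carrier G" using v(1) by (auto simp: supp_def)
  have "(\<Sum>b\<in>carrier G. of_int (f (b \<otimes> inv a)) * v (inv b)) = \<theta> * v (inv a)" if a: "a \<in> carrier G" for a
  proof -
    have "(\<Sum>b\<in>carrier G. of_int (f (b \<otimes> inv a)) * v (inv b))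
        = (\<Sum>y\<in>carrier G. of_int (f (inv y \<otimes> inv a)) * v (inv (inv y)))"
      by (rule sum.reindex_bij_betw[OF bij_inv, symmetric])
    also have "\<dots> = (v \<star> lift_fun f) (inv a)"
      using a by (simp add: conv_def lift_fun_def mult.commute)
    also have "\<dots> = (lift_fun f \<star> v) (inv a)" by (simp only: class_fun_conv_commute[OF f])
    finally show ?thesis using v(3) by simp
  qed
  then show "eigenvalue_on (carrier G) (\<lambda>a b. f (b \<otimes> inv a)) \<theta>"
    unfolding eigenvalue_on_def using x \<open>x \<in> carrier G\<close>
    by (intro exI[of _ "\<lambda>x. v (inv x)"]) (auto intro!: bexI[of _ "inv x"])
qed

text \<open>\<open>T g\<close> is \<open>e (inv g)\<close> and \<open>t\<close> is
  \<open>e \<one>\<close>. Evaluation at the identity gives the trace formula for every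
  \<open>a\<close> that acts on \<open>e\<close> by a scalar, and the expansion at exponent 0 shows
  that \<open>t\<close> is rational.\<close>

lemma idempotent_trace:
  assumes e: "class_fun e" "e \<star> e = e" "e \<noteq> (\<lambda>x. 0)"
  obtains T and c :: "'a \<Rightarrow> nat \<Rightarrow> rat" and t :: rat where
    "\<And>g (k::nat). g \<in> carrier G \<Longrightarrow>
       T (g [^] k) = (\<Sum>j<grp_exponent G. of_rat (c g j) * unity_root (grp_exponent G) ^ (j * k))"
    "t \<noteq> 0"
    "\<And>a \<theta>. a \<star> e = (\<lambda>x. \<theta> * e x) \<Longrightarrow> (\<Sum>g\<in>carrier G. a g * T g) = \<theta> * of_rat t"
proof -
  let ?n = "grp_exponent G"
  have "\<forall>g\<in>carrier G. \<exists>c :: nat \<Rightarrow> rat. \<forall>k::nat.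
      e (inv (g [^] k)) = (\<Sum>j<?n. of_rat (c j) * unity_root ?n ^ (j * k))"
    using idempotent_trace_expansion[OF e(1,2) _ grp_exponent_pos pow_grp_exponent] by blast
  then obtain c :: "'a \<Rightarrow> nat \<Rightarrow> rat" where c: "\<And>g k. g \<in> carrier G \<Longrightarrow>
      e (inv (g [^] (k::nat))) = (\<Sum>j<?n. of_rat (c g j) * unity_root ?n ^ (j * k))"
    by metis
  define t where "t = (\<Sum>j<?n. c \<one> j)"
  have t: "e \<one> = of_rat t"
    using c[of \<one> 0] by (simp add: t_def of_rat_sum)
  show thesis
  proof (rule that[of "\<lambda>g. e (inv g)" c t])
    show "t \<noteq> 0" using class_fun_idempotent_at_one[OF e] t by auto
    fix a \<theta> assume "a \<star> e = (\<lambda>x. \<theta> * e x)"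
    then have "(a \<star> e) \<one> = \<theta> * of_rat t" by (simp add: t)
    then show "(\<Sum>g\<in>carrier G. a g * e (inv g)) = \<theta> * of_rat t" by (simp add: conv_def)
  qed (rule c)
qed

end

lemma eigenvalue_on_square_algebraic_int:
  assumes "finite V" "eigenvalue_on V M \<mu>"
  shows "algebraic_int (\<mu>\<^sup>2)"
proof (rule eigenvalue_on_imp_algebraic_int[OF assms(1)])
  obtain v where v: "\<exists>x\<in>V. v x \<noteq> 0" "\<And>a. a \<in> V \<Longrightarrow> (\<Sum>b\<in>V. of_int (M a b) * v b) = \<mu> * v a"
    using assms(2) unfolding eigenvalue_on_def by blast
  have "(\<Sum>b\<in>V. of_int (\<Sum>c\<in>V. M a c * M c b) * v b) = \<mu>\<^sup>2 * v a" if "a \<in> V" for a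
  proof -
    have "(\<Sum>b\<in>V. of_int (\<Sum>c\<in>V. M a c * M c b) * v b) = (\<Sum>b\<in>V. \<Sum>c\<in>V. of_int (M a c) * (of_int (M c b) * v b))"
      by (simp add: sum_distrib_right mult.assoc)
    also have "\<dots> = (\<Sum>c\<in>V. of_int (M a c) * (\<Sum>b\<in>V. of_int (M c b) * v b))"
      by (subst sum.swap) (simp add: sum_distrib_left)
    also have "\<dots> = (\<Sum>c\<in>V. \<mu> * (of_int (M a c) * v c))"
      using v(2) by (intro sum.cong) auto
    also have "\<dots> = \<mu> * (\<Sum>c\<in>V. of_int (M a c) * v c)" by (simp add: sum_distrib_left)
    finally show ?thesis using v(2)[OF that] by (simp add: power2_eq_square)
  qed
  then show "eigenvalue_on V (\<lambda>a b. \<Sum>c\<in>V. M a c * M c b) (\<mu>\<^sup>2)"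
    unfolding eigenvalue_on_def using v(1) by blast
qed

locale group_with_character = finite_group G + quadratic_character "grp_exponent G" \<epsilon> F \<tau> d
  for G (structure) and \<epsilon> F \<tau> d
begin

text \<open>Applying the automorphism that raises roots of unity to the \<open>k\<close>-th power to the trace of \<open>f\<close> on
  a joint eigenspace of \<open>f\<close> and \<open>x \<mapsto> f (x ^ l) - s f x\<close>, with \<open>l\<close> inverse to \<open>k\<close>, kills
  the latter function.\<close>

lemma eigenvalues_imp_power_relation:
  assumes f: "class_fun (lift_fun f)" and k: "Rings.coprime k (grp_exponent G)"
    and ev: "\<And>\<theta>. eigenvalue_on (carrier G) (\<lambda>a b. f (b \<otimes> inv a)) \<theta> \<Longrightarrow>
       \<exists>a b. \<theta> = of_rat a + of_rat b * \<tau> \<and> of_rat a + of_rat b * (of_int (\<epsilon> k) * \<tau>) = of_int s * \<theta>"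
    and g: "g \<in> carrier G"
  shows "f g = s * f (g [^] k)"
proof -
  let ?n = "grp_exponent G"
  let ?z = "unity_root ?n"
  obtain l :: nat where "\<forall>g\<in>carrier G. (g [^] k) [^] l = g \<and> (g [^] l) [^] k = g"
    using coprime_inverse_exponent[OF k] by blast
  then have l: "\<And>g. g \<in> carrier G \<Longrightarrow> (g [^] k) [^] l = g" by blast
  define D where "D h = (if h \<in> carrier G then lift_fun f (h [^] l) - of_int s * lift_fun f h else 0)" for h
  have D: "class_fun D"
    unfolding class_fun_def
  proof (intro conjI ballI)
    show "supp D" by (simp add: supp_def D_def)
    fix h x assume "h \<in> carrier G" "x \<in> carrier G"
    then show "D (x \<otimes> h \<otimes> inv x) = D h"
      using f by (simp add: D_def conj_pow class_fun_def)
  qed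
  have "D = (\<lambda>x. 0)"
  proof (rule ccontr)
    assume "D \<noteq> (\<lambda>x. 0)"
    then obtain e \<nu> \<theta> where e: "class_fun e" "e \<star> e = e" "e \<noteq> (\<lambda>x. 0)"
      "lift_fun f \<star> e = (\<lambda>x. \<theta> * e x)" "D \<star> e = (\<lambda>x. \<nu> * e x)" "\<nu> \<noteq> 0"
      using joint_eigenvalue_idempotent[OF f D] by blast
    obtain T c t where T: "\<And>g (k::nat). g \<in> carrier G \<Longrightarrow>
         T (g [^] k) = (\<Sum>j<?n. of_rat (c g j) * ?z ^ (j * k))"
      and t: "t \<noteq> 0"
      and tr: "\<And>a \<theta>. a \<star> e = (\<lambda>x. \<theta> * e x) \<Longrightarrow> (\<Sum>g\<in>carrier G. a g * T g) = \<theta> * of_rat t"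
      using idempotent_trace[OF e(1-3)] by blast
    have "eigenvalue_on (carrier G) (\<lambda>a b. f (b \<otimes> inv a)) \<theta>"
      using eigenvalue_on_iff_conv[OF f] e(3,4) class_fun_supp[OF e(1)] by blast
    then obtain a b where ab: "\<theta> = of_rat a + of_rat b * \<tau>"
      "of_rat a + of_rat b * (of_int (\<epsilon> k) * \<tau>) = of_int s * \<theta>" using ev by blast
    \<comment> \<open>Kept general in \<open>i\<close>: the instances 1 and \<open>k\<close> are the
      premise and the conclusion of one use of \<open>galois_transform\<close>.\<close>
    have expand: "(\<Sum>g\<in>carrier G. lift_fun f g * T (g [^] i))
        = (\<Sum>(g, j)\<in>carrier G \<times> {..<?n}. of_rat (of_int (f g) * c g j) * ?z ^ (j * i))" for i :: nat
      using T by (simp add: sum.cartesian_product[symmetric] lift_fun_def sum_distrib_left of_rat_mult mult.assoc)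
    have "(\<Sum>(g, j)\<in>carrier G \<times> {..<?n}. of_rat (of_int (f g) * c g j) * ?z ^ j) = of_rat (a * t) + of_rat (b * t) * \<tau>"
    proof -
      have "(\<Sum>g\<in>carrier G. lift_fun f g * T (g [^] (1::nat))) = \<theta> * of_rat t"
        using tr[OF e(4)] by simp
      then show ?thesis unfolding expand ab(1) by (simp add: of_rat_mult algebra_simps)
    qed
    then have "(\<Sum>(g, j)\<in>carrier G \<times> {..<?n}. of_rat (of_int (f g) * c g j) * ?z ^ (j * k))
        = of_rat (a * t) + of_rat (b * t) * (of_int (\<epsilon> k) * \<tau>)"
      using galois_transform[of "carrier G \<times> {..<?n}" k "\<lambda>(g, j). of_int (f g) * c g j" snd "a * t" "b * t"] k
      by (simp add: case_prod_unfold)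
    also have "\<dots> = of_int s * \<theta> * of_rat t"
      unfolding ab(2)[symmetric] by (simp add: of_rat_mult algebra_simps)
    finally have conj: "(\<Sum>g\<in>carrier G. lift_fun f g * T (g [^] k)) = of_int s * \<theta> * of_rat t"
      unfolding expand .
    \<comment> \<open>Substituting g^k for h moves the power from the function to the trace.\<close>
    have "(\<Sum>h\<in>carrier G. lift_fun f (h [^] l) * T h) = (\<Sum>g\<in>carrier G. lift_fun f ((g [^] k) [^] l) * T (g [^] k))"
      by (rule sum.reindex_bij_betw[OF bij_pow[OF k], symmetric])
    also have "\<dots> = (\<Sum>g\<in>carrier G. lift_fun f g * T (g [^] k))"
      by (intro sum.cong refl) (simp add: l)
    finally have shift: "(\<Sum>h\<in>carrier G. lift_fun f (h [^] l) * T h) = of_int s * \<theta> * of_rat t"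
      using conj by simp
    have "\<nu> * of_rat t = (\<Sum>h\<in>carrier G. D h * T h)"
      by (rule tr[OF e(5), symmetric])
    also have "\<dots> = (\<Sum>h\<in>carrier G. lift_fun f (h [^] l) * T h) - of_int s * (\<Sum>h\<in>carrier G. lift_fun f h * T h)"
      by (simp add: D_def algebra_simps sum_subtractf sum_distrib_left)
    also have "\<dots> = 0" unfolding shift tr[OF e(4)] by simp
    finally show False using e(6) t by simp
  qed
  then have "D (g [^] k) = 0" by simp
  then have "(of_int (f g) :: complex) = of_int (s * f (g [^] k))"
    using g l[OF g] by (simp add: D_def lift_fun_def)
  then show ?thesis by (simp only: of_int_eq_iff)
qed

text \<open>Averaging: for each k in \<open>S\<close> the trace formula holds with T(g^k) in place
  of T(g) at the price of the sign \<open>s k\<close>; summed over \<open>S\<close>, the roots of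
  unity enter only through the sums in \<open>AB\<close>. It is used for the kernel with signs 1,
  and for all units with signs \<open>\<epsilon> k\<close>, where every \<open>A j\<close> is
  0.\<close>

lemma power_relation_imp_eigenvalues:
  assumes f: "class_fun (lift_fun f)"
    and S: "S \<subseteq> units_mod (grp_exponent G)" "S \<noteq> {}"
    and rel: "\<And>k g. k \<in> S \<Longrightarrow> g \<in> carrier G \<Longrightarrow> f g = s k * f (g [^] k)"
    and AB: "\<And>j. (\<Sum>k\<in>S. of_int (s k) * unity_root (grp_exponent G) ^ (j * k)) = of_rat (A j) + of_rat (B j) * \<tau>"
    and sq: "\<And>k. k \<in> S \<Longrightarrow> s k * s k = 1"
    and ev: "eigenvalue_on (carrier G) (\<lambda>a b. f (b \<otimes> inv a)) \<theta>"
  obtains a b where "\<theta> = of_rat a + of_rat b * \<tau>" "(\<And>j. A j = 0) \<Longrightarrow> a = 0"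
proof -
  let ?n = "grp_exponent G"
  let ?z = "unity_root ?n"
  obtain v where "supp v" "v \<noteq> (\<lambda>x. 0)" "lift_fun f \<star> v = (\<lambda>x. \<theta> * v x)"
    using ev eigenvalue_on_iff_conv[OF f] by blast
  then obtain e where e: "class_fun e" "e \<star> e = e" "e \<noteq> (\<lambda>x. 0)" "lift_fun f \<star> e = (\<lambda>x. \<theta> * e x)"
    using eigenvalue_idempotent[OF f] by blast
  obtain T c t where T: "\<And>g (k::nat). g \<in> carrier G \<Longrightarrow>
       T (g [^] k) = (\<Sum>j<?n. of_rat (c g j) * ?z ^ (j * k))"
    and t: "t \<noteq> 0"
    and tr: "\<And>a \<theta>. a \<star> e = (\<lambda>x. \<theta> * e x) \<Longrightarrow> (\<Sum>g\<in>carrier G. a g * T g) = \<theta> * of_rat t"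
    using idempotent_trace[OF e(1-3)] by blast
  have finS: "finite S" using S(1) finite_units finite_subset by blast
  define q where "q g j = of_int (f g) * c g j" for g j
  define a where "a = (\<Sum>g\<in>carrier G. \<Sum>j<?n. q g j * A j)"
  define b where "b = (\<Sum>g\<in>carrier G. \<Sum>j<?n. q g j * B j)"
  have each: "(\<Sum>g\<in>carrier G. of_int (s k) * lift_fun f g * T (g [^] k)) = \<theta> * of_rat t" if k: "k \<in> S" for k
  proof -
    have "(\<Sum>g\<in>carrier G. of_int (s k) * lift_fun f g * T (g [^] k))
        = (\<Sum>g\<in>carrier G. lift_fun f (g [^] k) * T (g [^] k))"
    proof (intro sum.cong refl)
      fix g assume g: "g \<in> carrier G"
      have "s k * f g = f (g [^] k)"
        using rel[OF k g] sq[OF k] by (metis mult.assoc mult_1)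
      then have "of_int (s k) * lift_fun f g = lift_fun f (g [^] k)"
        using g by (simp add: lift_fun_def flip: of_int_mult)
      then show "of_int (s k) * lift_fun f g * T (g [^] k) = lift_fun f (g [^] k) * T (g [^] k)" by simp
    qed
    also have "\<dots> = (\<Sum>h\<in>carrier G. lift_fun f h * T h)"
      using k S(1) by (intro sum.reindex_bij_betw bij_pow) (auto simp: units_mod_def)
    finally show ?thesis using tr[OF e(4)] by simp
  qed
  have "of_nat (card S) * (\<theta> * of_rat t) = (\<Sum>k\<in>S. \<Sum>g\<in>carrier G. of_int (s k) * lift_fun f g * T (g [^] k))"
    using each by simp
  also have "\<dots> = (\<Sum>k\<in>S. \<Sum>g\<in>carrier G. \<Sum>j<?n. of_rat (q g j) * (of_int (s k) * ?z ^ (j * k)))"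
    by (intro sum.cong refl) (simp add: T lift_fun_def q_def of_rat_mult sum_distrib_left mult_ac)
  also have "\<dots> = (\<Sum>g\<in>carrier G. \<Sum>j<?n. \<Sum>k\<in>S. of_rat (q g j) * (of_int (s k) * ?z ^ (j * k)))"
    by (subst sum.swap) (intro sum.cong refl sum.swap)
  also have "\<dots> = (\<Sum>g\<in>carrier G. \<Sum>j<?n. of_rat (q g j) * (of_rat (A j) + of_rat (B j) * \<tau>))"
    unfolding sum_distrib_left[symmetric] AB ..
  also have "\<dots> = of_rat a + of_rat b * \<tau>"
    by (simp add: a_def b_def of_rat_sum of_rat_mult sum_distrib_left sum_distrib_right algebra_simps sum.distrib)
  finally have eq: "of_rat (of_nat (card S) * t) * \<theta> = of_rat a + of_rat b * \<tau>"
    by (simp add: of_rat_mult mult_ac)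
  define r where "r = of_nat (card S) * t"
  have r: "r \<noteq> 0" using t finS S(2) by (simp add: r_def)
  have "\<theta> = of_rat (a / r) + of_rat (b / r) * \<tau>"
    using eq r unfolding r_def[symmetric] by (simp add: of_rat_divide field_simps)
  moreover have "a / r = 0" if "\<And>j. A j = 0" using that by (simp add: a_def)
  ultimately show thesis using that by blast
qed

lemma kernel_invariant_imp_quad_field:
  assumes f: "class_fun (lift_fun f)"
    and rel: "\<And>k g. k \<in> kernel \<Longrightarrow> g \<in> carrier G \<Longrightarrow> f (g [^] k) = f g"
    and ev: "eigenvalue_on (carrier G) (\<lambda>a b. f (b \<otimes> inv a)) \<theta>"
  shows "\<theta> \<in> quad_field d"
proof -
  let ?n = "grp_exponent G"
  let ?z = "unity_root ?n"
  have "\<exists>a b. (\<Sum>k\<in>kernel. of_int 1 * ?z ^ (j * k)) = of_rat a + of_rat b * \<tau>" for j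
  proof -
    obtain a where a: "(\<Sum>k\<in>units_mod ?n. ?z ^ (j * k)) = of_rat a"
      using sum_units_Rats[of j] by (auto elim: Rats_cases)
    obtain b where b: "(\<Sum>k\<in>units_mod ?n. of_int (\<epsilon> k) * ?z ^ (j * k)) = of_rat b * \<tau>"
      using eps_sum_units[of j] by blast
    have "(\<Sum>k\<in>kernel. ?z ^ (j * k)) = (\<Sum>k\<in>units_mod ?n. if \<epsilon> k = 1 then ?z ^ (j * k) else 0)"
      unfolding kernel_def by (simp add: sum.inter_filter)
    \<comment> \<open>On units, the indicator of the kernel is (1 + \<epsilon> k) / 2.\<close>
    also have "\<dots> = (\<Sum>k\<in>units_mod ?n. (?z ^ (j * k) + of_int (\<epsilon> k) * ?z ^ (j * k)) / 2)"
      using eps_values units_coprime by (intro sum.cong refl) force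
    also have "\<dots> = (of_rat a + of_rat b * \<tau>) / 2"
      by (simp add: sum_divide_distrib[symmetric] sum.distrib a b)
    finally have "(\<Sum>k\<in>kernel. of_int 1 * ?z ^ (j * k)) = of_rat (a / 2) + of_rat (b / 2) * \<tau>"
      by (simp add: of_rat_divide field_simps)
    then show ?thesis by blast
  qed
  then obtain A B where AB: "\<And>j. (\<Sum>k\<in>kernel. of_int 1 * ?z ^ (j * k)) = of_rat (A j) + of_rat (B j) * \<tau>"
    by metis
  obtain a b where "\<theta> = of_rat a + of_rat b * \<tau>"
    using one_mod_unit rel
    by (rule_tac power_relation_imp_eigenvalues[OF f _ _ _ AB _ ev, of thesis]) (auto simp: kernel_def)
  then show ?thesis unfolding quad_field_iff by blast
qed

text \<open>Weighting the average by \<open>\<epsilon>\<close> kills the rational part, leaving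
  \<open>\<theta>\<close> as a rational multiple of \<open>\<tau>\<close>. Its square is an
  eigenvalue of the squared integer matrix, so the multiple is integral; the sign between
  \<open>\<tau>\<close> and \<open>csqrt\<close> is absorbed in \<open>z\<close>.\<close>

lemma eps_semi_invariant_imp_multiple:
  assumes f: "class_fun (lift_fun f)"
    and rel: "\<And>k g. k \<in> units_mod (grp_exponent G) \<Longrightarrow> g \<in> carrier G \<Longrightarrow> f g = \<epsilon> k * f (g [^] k)"
    and ev: "eigenvalue_on (carrier G) (\<lambda>a b. f (b \<otimes> inv a)) \<theta>"
  shows "\<exists>z::int. \<theta> = of_int z * csqrt (of_int d)"
proof -
  let ?n = "grp_exponent G"
  let ?z = "unity_root ?n"
  obtain B where "\<And>j. (\<Sum>k\<in>units_mod ?n. of_int (\<epsilon> k) * ?z ^ (j * k)) = of_rat (B j) * \<tau>"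
    using eps_sum_units by metis
  then have B: "\<And>j. (\<Sum>k\<in>units_mod ?n. of_int (\<epsilon> k) * ?z ^ (j * k)) = of_rat ((\<lambda>_. 0) j) + of_rat (B j) * \<tau>"
    by simp
  have sq: "\<epsilon> k * \<epsilon> k = 1" if "k \<in> units_mod ?n" for k
    using eps_values[OF units_coprime[OF that]] by auto
  have ne: "units_mod ?n \<noteq> {}" using one_mod_unit by (auto simp: kernel_def)
  obtain a b where ab: "\<theta> = of_rat a + of_rat b * \<tau>" "a = 0"
    by (rule power_relation_imp_eigenvalues[OF f subset_refl ne rel B sq ev]) auto
  have "algebraic_int (\<theta>\<^sup>2)"
    by (rule eigenvalue_on_square_algebraic_int[OF fin ev])
  then have "b \<in> \<int>" using ab by (intro rational_multiple_integral) simp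
  then obtain z where "b = of_int z" by (auto elim: Ints_cases)
  then have z: "\<theta> = of_int z * \<tau>" using ab by simp
  show ?thesis
  proof (cases "csqrt (of_int d) = \<tau>")
    case False
    then have "\<theta> = of_int (- z) * csqrt (of_int d)" using csqrt_cases z by simp
    then show ?thesis by blast
  qed (use z in blast)
qed

end

section \<open>Signed normal Cayley graphs\<close>

lemma (in finite_group) normal_set_conj_iff:
  assumes C: "normal_set G C" and "g \<in> carrier G" "x \<in> carrier G"
  shows "x \<otimes> g \<otimes> inv x \<in> C \<longleftrightarrow> g \<in> C"
proof
  assume *: "x \<otimes> g \<otimes> inv x \<in> C"
  have "inv x \<otimes> (x \<otimes> g \<otimes> inv x) \<otimes> inv (inv x) \<in> C"
    using C * assms(3) inv_closed unfolding normal_set_def by blast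
  moreover have "inv x \<otimes> (x \<otimes> g \<otimes> inv x) \<otimes> inv (inv x) = g"
    using assms(2,3) by (simp add: m_assoc)
  ultimately show "g \<in> C" by simp
qed (use assms in \<open>auto simp: normal_set_def\<close>)

text \<open>Normality absorbs the conjugation in \<open>sim_Delta\<close>, so that only invariance
  under the power maps remains.\<close>

lemma (in finite_group) union_of_classes_iff:
  assumes C: "normal_set G C"
  shows "union_of_classes G w0 w W C \<longleftrightarrow>
    (\<forall>k\<in>H_Delta (grp_exponent G) w0 w W. \<forall>h\<in>carrier G. h [^] k \<in> C \<longleftrightarrow> h \<in> C)"
proof
  assume U: "union_of_classes G w0 w W C"
  show "\<forall>k\<in>H_Delta (grp_exponent G) w0 w W. \<forall>h\<in>carrier G. h [^] k \<in> C \<longleftrightarrow> h \<in> C"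
  proof (intro ballI)
    fix k h assume kh: "k \<in> H_Delta (grp_exponent G) w0 w W" "h \<in> carrier G"
    have "Defs.conjugate G (h [^] k) (h [^] k)"
      unfolding Defs.conjugate_def using kh by (intro bexI[of _ \<one>]) auto
    then have "sim_Delta G w0 w W (h [^] k) h" unfolding sim_Delta_def using kh(1) by blast
    then show "h [^] k \<in> C \<longleftrightarrow> h \<in> C" using U kh unfolding union_of_classes_def by blast
  qed
next
  assume inv: "\<forall>k\<in>H_Delta (grp_exponent G) w0 w W. \<forall>h\<in>carrier G. h [^] k \<in> C \<longleftrightarrow> h \<in> C"
  show "union_of_classes G w0 w W C"
    unfolding union_of_classes_def
  proof (intro conjI ballI impI)
    show "C \<subseteq> carrier G" using C by (simp add: normal_set_def)
    fix g h assume gh: "g \<in> carrier G" "h \<in> carrier G" "sim_Delta G w0 w W g h"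
    then obtain k x where "k \<in> H_Delta (grp_exponent G) w0 w W" "x \<in> carrier G" "g = x \<otimes> h [^] k \<otimes> inv x"
      unfolding sim_Delta_def Defs.conjugate_def by blast
    then show "g \<in> C \<longleftrightarrow> h \<in> C" using normal_set_conj_iff[OF C] inv gh by simp
  qed
qed

context group_with_character
begin

text \<open>The kernel holds only residues below the exponent; products of units, which the argument
  for (ii) forms, have to be reduced first.\<close>

lemma coprime_pow_kernel:
  assumes "Rings.coprime k (grp_exponent G)" "\<epsilon> k = 1" "g \<in> carrier G"
    and "\<And>k h. k \<in> kernel \<Longrightarrow> h \<in> carrier G \<Longrightarrow> h [^] k \<in> C \<longleftrightarrow> h \<in> C"
  shows "g [^] k \<in> C \<longleftrightarrow> g \<in> C"
proof -
  have "k mod grp_exponent G \<in> kernel"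
    using assms(1,2) n eps_mod[OF assms(1)] by (simp add: kernel_def units_mod_def)
  then show ?thesis using assms(3,4) pow_mod_exponent[of g k] by metis
qed

section \<open>The spectrum attached to a pair of disjoint normal sets\<close>

context
  fixes C1 C2
  assumes C1: "normal_set G C1" and C2: "normal_set G C2" and disj: "C1 \<inter> C2 = {}"
begin

definition signed_ind :: "'a \<Rightarrow> int" where
  "signed_ind g = (if g \<in> C1 then 1 else 0) - (if g \<in> C2 then 1 else 0)"

lemma signed_ind_iff:
  "g \<in> C1 \<longleftrightarrow> signed_ind g = 1" "g \<in> C2 \<longleftrightarrow> signed_ind g = -1"
  using disj by (auto simp: signed_ind_def)

lemma class_fun_signed_ind: "class_fun (lift_fun signed_ind)"
  by (rule class_fun_lift) (simp add: signed_ind_def normal_set_conj_iff[OF C1] normal_set_conj_iff[OF C2])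

abbreviation spec :: "complex \<Rightarrow> bool" where
  "spec \<equiv> eigenvalue_on (carrier G) (\<lambda>a b. signed_ind (b \<otimes> inv a))"

text \<open>For k in the kernel, conjugation fixes every a + b \<tau>, so
  \<open>eigenvalues_imp_power_relation\<close> applies with s = 1. The values 1 and -1 of
  \<open>signed_ind\<close> single out \<open>C1\<close> and \<open>C2\<close>, so invariance of the
  function is invariance of both sets.\<close>

lemma quad_field_iff_kernel_invariant:
  "(\<forall>\<mu>. spec \<mu> \<longrightarrow> \<mu> \<in> quad_field d) \<longleftrightarrow>
   (\<forall>k\<in>kernel. \<forall>h\<in>carrier G. h [^] k \<in> C1 \<longleftrightarrow> h \<in> C1) \<and>
   (\<forall>k\<in>kernel. \<forall>h\<in>carrier G. h [^] k \<in> C2 \<longleftrightarrow> h \<in> C2)"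
proof
  assume ev: "\<forall>\<mu>. spec \<mu> \<longrightarrow> \<mu> \<in> quad_field d"
  have "signed_ind h = signed_ind (h [^] k)" if "k \<in> kernel" "h \<in> carrier G" for k h
  proof -
    have k: "Rings.coprime k (grp_exponent G)" "\<epsilon> k = 1"
      using that(1) by (auto simp: kernel_def units_mod_def)
    have "signed_ind h = 1 * signed_ind (h [^] k)"
    proof (rule eigenvalues_imp_power_relation[OF class_fun_signed_ind k(1) _ that(2)])
      fix \<theta> assume "spec \<theta>"
      then show "\<exists>a b. \<theta> = of_rat a + of_rat b * \<tau> \<and>
          of_rat a + of_rat b * (of_int (\<epsilon> k) * \<tau>) = of_int 1 * \<theta>"
        using ev k(2) unfolding quad_field_iff by fastforce
    qed
    then show ?thesis by simp
  qed
  then show "(\<forall>k\<in>kernel. \<forall>h\<in>carrier G. h [^] k \<in> C1 \<longleftrightarrow> h \<in> C1) \<and>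
      (\<forall>k\<in>kernel. \<forall>h\<in>carrier G. h [^] k \<in> C2 \<longleftrightarrow> h \<in> C2)"
    unfolding signed_ind_iff by simp
next
  assume "(\<forall>k\<in>kernel. \<forall>h\<in>carrier G. h [^] k \<in> C1 \<longleftrightarrow> h \<in> C1) \<and>
      (\<forall>k\<in>kernel. \<forall>h\<in>carrier G. h [^] k \<in> C2 \<longleftrightarrow> h \<in> C2)"
  then have "signed_ind (h [^] k) = signed_ind h" if "k \<in> kernel" "h \<in> carrier G" for k h
    using that by (simp add: signed_ind_def)
  then show "\<forall>\<mu>. spec \<mu> \<longrightarrow> \<mu> \<in> quad_field d"
    using kernel_invariant_imp_quad_field[OF class_fun_signed_ind] by blast
qed

text \<open>Conjugation multiplies every integer multiple of \<open>\<tau>\<close> by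
  \<open>\<epsilon> k\<close>, so this sign takes the part of s in
  \<open>eigenvalues_imp_power_relation\<close>.\<close>

lemma multiples_imp_semi_invariant:
  assumes ev: "\<forall>\<mu>. spec \<mu> \<longrightarrow> (\<exists>z::int. \<mu> = of_int z * csqrt (of_int d))"
    and k: "Rings.coprime k (grp_exponent G)" and h: "h \<in> carrier G"
  shows "signed_ind h = \<epsilon> k * signed_ind (h [^] k)"
proof (rule eigenvalues_imp_power_relation[OF class_fun_signed_ind k _ h])
  fix \<theta> assume "spec \<theta>"
  then obtain z :: int where "\<theta> = of_int z * csqrt (of_int d)" using ev by blast
  then have "\<theta> = of_int z * \<tau> \<or> \<theta> = of_int (- z) * \<tau>" using csqrt_cases by auto
  then obtain y :: int where "\<theta> = of_int y * \<tau>" by blast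
  then have "\<theta> = of_rat 0 + of_rat (of_int y) * \<tau>" by simp
  moreover from this have "of_rat 0 + of_rat (of_int y) * (of_int (\<epsilon> k) * \<tau>) = of_int (\<epsilon> k) * \<theta>"
    by simp
  ultimately show "\<exists>a b. \<theta> = of_rat a + of_rat b * \<tau> \<and>
      of_rat a + of_rat b * (of_int (\<epsilon> k) * \<tau>) = of_int (\<epsilon> k) * \<theta>" by blast
qed

lemma multiples_imp_quad_field:
  assumes "\<forall>\<mu>. spec \<mu> \<longrightarrow> (\<exists>z::int. \<mu> = of_int z * csqrt (of_int d))"
  shows "\<forall>\<mu>. spec \<mu> \<longrightarrow> \<mu> \<in> quad_field d"
proof (intro allI impI)
  fix \<mu> assume "spec \<mu>"
  then obtain z :: int where "\<mu> = of_rat 0 + of_rat (of_int z) * csqrt (of_int d)" using assms by auto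
  then show "\<mu> \<in> quad_field d" unfolding quad_field_def by blast
qed

text \<open>The kernel has index two. With \<open>l\<close> inverse to \<open>m\<close> modulo the
  exponent, h lies in \<open>C2\<close> exactly if h^l lies in \<open>C1\<close>; a power map with
  sign -1 differs from that of \<open>m\<close> by one with sign 1, and so exchanges the two
  sets.\<close>

lemma power_image_imp_semi_invariant:
  assumes inv: "\<forall>k\<in>kernel. \<forall>h\<in>carrier G. h [^] k \<in> C1 \<longleftrightarrow> h \<in> C1"
    and m: "m \<in> units_mod (grp_exponent G) - kernel" and C2_eq: "C2 = (\<lambda>g. g [^] m) ` C1"
    and k: "Rings.coprime k (grp_exponent G)" and g: "g \<in> carrier G"
  shows "signed_ind g = \<epsilon> k * signed_ind (g [^] k)"
proof -
  have mc: "Rings.coprime m (grp_exponent G)" using m by (simp add: units_mod_def)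
  have em: "\<epsilon> m = -1" using m eps_values[OF mc] by (auto simp: kernel_def)
  obtain l :: nat where l: "Rings.coprime l (grp_exponent G)" "[m * l = 1] (mod grp_exponent G)"
    "\<forall>g\<in>carrier G. (g [^] m) [^] l = g \<and> (g [^] l) [^] m = g"
    using coprime_inverse_exponent[OF mc] by blast
  have "\<epsilon> m * \<epsilon> l = 1"
  proof -
    have "\<epsilon> m * \<epsilon> l = \<epsilon> (m * l mod grp_exponent G)"
      using eps_mult[OF mc l(1)] eps_mod[of "m * l"] mc l(1) by simp
    also have "\<dots> = \<epsilon> (1 mod grp_exponent G)" using l(2) by (simp add: Cong.cong_def)
    also have "\<dots> = 1" using eps_mod[of 1] at_one by simp
    finally show ?thesis .
  qed
  then have el: "\<epsilon> l = -1" using em by simp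
  have C1_sub: "C1 \<subseteq> carrier G" using C1 by (simp add: normal_set_def)
  have C2_iff: "h \<in> C2 \<longleftrightarrow> h [^] l \<in> C1" if "h \<in> carrier G" for h
  proof
    assume "h \<in> C2"
    then show "h [^] l \<in> C1" using C2_eq C1_sub l(3) by auto
  next
    assume "h [^] l \<in> C1"
    then have "(h [^] l) [^] m \<in> C2" using C2_eq by blast
    then show "h \<in> C2" using l(3) that by simp
  qed
  have kinv: "h [^] i \<in> C1 \<longleftrightarrow> h \<in> C1" if "Rings.coprime i (grp_exponent G)" "\<epsilon> i = 1" "h \<in> carrier G" for i h
    by (rule coprime_pow_kernel[OF that]) (use inv in blast)
  consider "\<epsilon> k = 1" | "\<epsilon> k = -1" using eps_values[OF k] by blast
  then show ?thesis
  proof cases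
    case 1
    have "g [^] k \<in> C1 \<longleftrightarrow> g \<in> C1" by (rule kinv[OF k 1 g])
    moreover have "g [^] k \<in> C2 \<longleftrightarrow> g \<in> C2"
    proof -
      have "(g [^] k) [^] l = (g [^] l) [^] k" using g by (simp add: nat_pow_pow mult.commute)
      then show ?thesis using C2_iff g kinv[OF k 1, of "g [^] l"] by simp
    qed
    ultimately show ?thesis using 1 by (simp add: signed_ind_def)
  next
    case 2
    \<comment> \<open>The l-th power of g^k is g^(k l), and k l has sign 1.\<close>
    have "g [^] k \<in> C2 \<longleftrightarrow> g \<in> C1"
    proof -
      have "\<epsilon> (k * l) = 1" using eps_mult[OF k l(1)] 2 el by simp
      moreover have "(g [^] k) [^] l = g [^] (k * l)" using g by (simp add: nat_pow_pow)
      ultimately show ?thesis using C2_iff[of "g [^] k"] kinv[of "k * l" g] k l(1) g by simp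
    qed
    \<comment> \<open>Here g^k is written as the (m k)-th power of g^l, and m k has sign 1.\<close>
    moreover have "g [^] k \<in> C1 \<longleftrightarrow> g \<in> C2"
    proof -
      have "\<epsilon> (m * k) = 1" using eps_mult[OF mc k] 2 em by simp
      moreover have "(g [^] l) [^] (m * k) = g [^] k"
      proof -
        have "(g [^] l) [^] (m * k) = ((g [^] l) [^] m) [^] k" using g by (simp add: nat_pow_pow mult.assoc)
        then show ?thesis using l(3) g by simp
      qed
      ultimately show ?thesis using C2_iff[OF g] kinv[of "m * k" "g [^] l"] mc k g by simp
    qed
    ultimately show ?thesis using 2 by (simp add: signed_ind_def)
  qed
qed

lemma multiples_iff:
  "(\<forall>\<mu>. spec \<mu> \<longrightarrow> (\<exists>z::int. \<mu> = of_int z * csqrt (of_int d))) \<longleftrightarrow>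
   (d = 1 \<and> (\<forall>k\<in>kernel. \<forall>h\<in>carrier G. h [^] k \<in> C1 \<longleftrightarrow> h \<in> C1) \<and>
     (\<forall>k\<in>kernel. \<forall>h\<in>carrier G. h [^] k \<in> C2 \<longleftrightarrow> h \<in> C2)) \<or>
   (d \<noteq> 1 \<and> (\<forall>k\<in>kernel. \<forall>h\<in>carrier G. h [^] k \<in> C1 \<longleftrightarrow> h \<in> C1) \<and>
     (\<exists>k\<in>units_mod (grp_exponent G) - kernel. C2 = (\<lambda>g. g [^] k) ` C1))"
  (is "?L \<longleftrightarrow> ?A \<or> ?B")
proof
  assume ev: ?L
  \<comment> \<open>Integer multiples of the square root lie in the quadratic field, so invariance
    under the kernel comes from the first equivalence.\<close>
  note inv = multiples_imp_quad_field[OF ev, unfolded quad_field_iff_kernel_invariant]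
  show "?A \<or> ?B"
  proof (cases "d = 1")
    case False
    then obtain k where k: "k \<in> units_mod (grp_exponent G) - kernel" using exists_nonkernel by blast
    then have kc: "Rings.coprime k (grp_exponent G)" by (simp add: units_mod_def)
    then have "\<epsilon> k = -1" using k eps_values by (auto simp: kernel_def)
    then have neg: "signed_ind h = - signed_ind (h [^] k)" if "h \<in> carrier G" for h
      using multiples_imp_semi_invariant[OF ev kc that] by simp
    obtain l :: nat where l: "\<forall>g\<in>carrier G. (g [^] k) [^] l = g \<and> (g [^] l) [^] k = g"
      using coprime_inverse_exponent[OF kc] by blast
    have sub: "C1 \<subseteq> carrier G" "C2 \<subseteq> carrier G" using C1 C2 by (auto simp: normal_set_def)
    have "C2 = (\<lambda>g. g [^] k) ` C1"
    proof (intro equalityI subsetI)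
      fix h assume h: "h \<in> C2"
      then have hc: "h \<in> carrier G" using sub by blast
      have "signed_ind (h [^] l) = 1"
        using neg[of "h [^] l"] l hc h unfolding signed_ind_iff(2) by simp
      then have "h [^] l \<in> C1" unfolding signed_ind_iff .
      moreover have "h = (h [^] l) [^] k" using l hc by simp
      ultimately show "h \<in> (\<lambda>g. g [^] k) ` C1" by blast
    next
      fix h assume "h \<in> (\<lambda>g. g [^] k) ` C1"
      then obtain g where g: "g \<in> C1" "h = g [^] k" by blast
      then have "g \<in> carrier G" using sub by blast
      then show "h \<in> C2" using neg[of g] g unfolding signed_ind_iff by simp
    qed
    then show ?thesis using False inv k by blast
  qed (use inv in blast)
next
  assume "?A \<or> ?B"
  then show ?L
  proof
    assume A: ?A
    \<comment> \<open>For d = 1 the field is that of the rationals, where algebraic integers are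
      integers.\<close>
    have qf: "\<forall>\<mu>. spec \<mu> \<longrightarrow> \<mu> \<in> quad_field d"
      unfolding quad_field_iff_kernel_invariant by (rule conjunct2[OF A])
    show ?L
    proof (intro allI impI)
      fix \<mu> assume ev: "spec \<mu>"
      have "\<mu> \<in> quad_field d" using qf ev by blast
      then have "\<mu> \<in> \<rat>" using A unfolding quad_field_def by auto
      moreover have "algebraic_int \<mu>" by (rule eigenvalue_on_imp_algebraic_int[OF fin ev])
      ultimately have "\<mu> \<in> \<int>" using rational_algebraic_int_is_int by blast
      then show "\<exists>z::int. \<mu> = of_int z * csqrt (of_int d)" using A by (auto elim: Ints_cases)
    qed
  next
    assume B: ?B
    then obtain m where m: "m \<in> units_mod (grp_exponent G) - kernel" "C2 = (\<lambda>g. g [^] m) ` C1" by blast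
    have "signed_ind g = \<epsilon> k * signed_ind (g [^] k)" if "k \<in> units_mod (grp_exponent G)" "g \<in> carrier G" for k g
      using power_image_imp_semi_invariant[OF _ m units_coprime[OF that(1)] that(2)] B by blast
    then show ?L
      using eps_semi_invariant_imp_multiple[OF class_fun_signed_ind] by blast
  qed
qed

text \<open>Inversion is the power map for the exponent minus 1, whose sign is that of
  \<open>d\<close>. Exponent 1 is excluded because \<open>d \<noteq> 1\<close> provides a unit
  outside the kernel.\<close>

lemma multiples_inv:
  assumes ev: "\<forall>\<mu>. spec \<mu> \<longrightarrow> (\<exists>z::int. \<mu> = of_int z * csqrt (of_int d))" and d: "d \<noteq> 1"
    and g: "g \<in> carrier G"
  shows "signed_ind g = (if d < 0 then -1 else 1) * signed_ind (inv g)"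
proof -
  have n1: "grp_exponent G > 1"
  proof (rule ccontr)
    assume "\<not> grp_exponent G > 1"
    then have one: "grp_exponent G = 1" using n by simp
    obtain k where k: "k \<in> units_mod (grp_exponent G) - kernel" using exists_nonkernel[OF d] by blast
    then have "k = 1 mod grp_exponent G" using one by (simp add: units_mod_def)
    then show False using k one_mod_unit by blast
  qed
  have "Rings.coprime (grp_exponent G - 1) (grp_exponent G)"
    using n by (rule coprime_diff_one_left_nat)
  from multiples_imp_semi_invariant[OF ev this g] show ?thesis
    unfolding eps_minus_one[OF n1] pow_exponent_minus_one[OF g] .
qed

end

end

theorem theorem9p2:
  fixes G (structure) and w0 w :: nat and W :: "nat set" and C1 C2 :: "'a set"
  assumes "group G" and "finite (carrier G)"
    and "w0 \<in> {0, 1}" and "w \<in> {0, 1}" and "W \<subseteq> odd_prime_divs (grp_exponent G)"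
    and "multiplicity 2 (grp_exponent G) < 3 \<Longrightarrow> w0 = 0"
    and "multiplicity 2 (grp_exponent G) < 2 \<Longrightarrow> w = 0"
    and "normal_set G C1" and "normal_set G C2" and "C1 \<inter> C2 = {}"
    and "\<one> \<notin> C1 \<union> C2"
  defines "M \<equiv> (\<lambda>a b. adjA G C1 a b - adjA G C2 a b)"
    and "\<Delta> \<equiv> Delta w0 w W"
    and "H \<equiv> H_Delta (grp_exponent G) w0 w W"
  shows
    "((\<forall>\<mu>. eigenvalue_on (carrier G) M \<mu> \<longrightarrow> \<mu> \<in> quad_field \<Delta>) \<longleftrightarrow>
        union_of_classes G w0 w W C1 \<and> union_of_classes G w0 w W C2)
   \<and> ((\<forall>\<mu>. eigenvalue_on (carrier G) M \<mu> \<longrightarrow>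
          (\<exists>z::int. \<mu> = of_int z * csqrt (of_int \<Delta>))) \<longleftrightarrow>
        (\<Delta> = 1 \<and> union_of_classes G w0 w W C1 \<and> union_of_classes G w0 w W C2)
        \<or> (\<Delta> \<noteq> 1 \<and> union_of_classes G w0 w W C1 \<and>
           (\<exists>k \<in> units_mod (grp_exponent G) - H. C2 = (\<lambda>g. g [^] k) ` C1)))
   \<and> (((\<forall>\<mu>. eigenvalue_on (carrier G) M \<mu> \<longrightarrow>
          (\<exists>z::int. \<mu> = of_int z * csqrt (of_int \<Delta>))) \<and> \<Delta> \<noteq> 1) \<longrightarrow>
        (\<Delta> < 0 \<longrightarrow> (\<exists>C. normal_set G C \<and> \<one> \<notin> C \<and> C \<inter> (\<lambda>g. inv g) ` C = {} \<and>
              (\<forall>a\<in>carrier G. \<forall>b\<in>carrier G. M a b = adjA G C a b - adjA G C b a)))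
      \<and> (\<Delta> > 0 \<longrightarrow> (\<exists>D1 D2. normal_set G D1 \<and> normal_set G D2 \<and> D1 \<inter> D2 = {} \<and>
              \<one> \<notin> D1 \<union> D2 \<and> (\<lambda>g. inv g) ` D1 = D1 \<and> (\<lambda>g. inv g) ` D2 = D2 \<and>
              (\<forall>a\<in>carrier G. \<forall>b\<in>carrier G. M a b = adjA G D1 a b - adjA G D2 a b))))"
proof -
  interpret finite_group G
    using assms(1,2) by (simp add: finite_group_def finite_group_axioms_def)
  let ?n = "grp_exponent G"
  let ?\<epsilon> = "quad_chi w0 w W"
  obtain F \<tau> where F: "\<tau>\<^sup>2 = of_int \<Delta>"
    "\<forall>k. Rings.coprime k ?n \<longrightarrow> ipoly_at F (unity_root ?n ^ k) = of_int (?\<epsilon> k) * \<tau>"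
    using sqrt_rep_Delta[OF grp_exponent_pos assms(3-7)] unfolding sqrt_rep_def \<Delta>_def by blast
  interpret group_with_character G ?\<epsilon> F \<tau> \<Delta>
  proof unfold_locales
    show "?n > 0" by (rule grp_exponent_pos)
    show "?\<epsilon> k = 1 \<or> ?\<epsilon> k = -1" if "Rings.coprime k ?n" for k
      by (rule quad_chi_values[OF assms(5) that])
    show "?\<epsilon> 1 = 1" by (rule quad_chi_one[OF assms(5)])
    show "ipoly_at F (unity_root ?n ^ k) = of_int (?\<epsilon> k) * \<tau>" if "Rings.coprime k ?n" for k
      using F(2) that by blast
    show "\<tau>\<^sup>2 = of_int \<Delta>" by (rule F(1))
    show "squarefree \<Delta>" unfolding \<Delta>_def by (rule squarefree_Delta[OF assms(3,5)])
  qed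
  have H: "H = kernel" by (simp add: H_def H_Delta_def kernel_def quad_chi_def)
  let ?f = "signed_ind C1 C2"
  have M: "M = (\<lambda>a b. ?f (b \<otimes> inv a))"
    by (intro ext) (simp add: M_def adjA_def signed_ind_def[OF assms(8-10)])
  note U = union_of_classes_iff[OF assms(8), of w0 w W, folded H_def, unfolded H]
    union_of_classes_iff[OF assms(9), of w0 w W, folded H_def, unfolded H]
  have sub: "C1 \<subseteq> carrier G" "C2 \<subseteq> carrier G" using assms(8,9) by (auto simp: normal_set_def)
  show ?thesis
  proof (intro conjI impI)
    show "(\<forall>\<mu>. eigenvalue_on (carrier G) M \<mu> \<longrightarrow> \<mu> \<in> quad_field \<Delta>) \<longleftrightarrow>
        union_of_classes G w0 w W C1 \<and> union_of_classes G w0 w W C2"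
      unfolding M U by (rule quad_field_iff_kernel_invariant[OF assms(8-10)])
    show "(\<forall>\<mu>. eigenvalue_on (carrier G) M \<mu> \<longrightarrow> (\<exists>z::int. \<mu> = of_int z * csqrt (of_int \<Delta>))) \<longleftrightarrow>
        (\<Delta> = 1 \<and> union_of_classes G w0 w W C1 \<and> union_of_classes G w0 w W C2)
        \<or> (\<Delta> \<noteq> 1 \<and> union_of_classes G w0 w W C1 \<and>
           (\<exists>k \<in> units_mod ?n - H. C2 = (\<lambda>g. g [^] k) ` C1))"
      unfolding M U H by (rule multiples_iff[OF assms(8-10)])
  next
    assume ev: "(\<forall>\<mu>. eigenvalue_on (carrier G) M \<mu> \<longrightarrow>
        (\<exists>z::int. \<mu> = of_int z * csqrt (of_int \<Delta>))) \<and> \<Delta> \<noteq> 1" and neg: "\<Delta> < 0"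
    have f_inv: "?f g = - ?f (inv g)" if "g \<in> carrier G" for g
      using multiples_inv[OF assms(8-10) _ _ that] ev neg unfolding M by simp
    \<comment> \<open>For negative \<open>\<Delta>\<close> the function is odd under inversion, so
      \<open>C2\<close> consists of the inverses of \<open>C1\<close>, and \<open>C1\<close> itself
      is the connection set of the oriented graph.\<close>
    have C2_iff: "g \<in> C2 \<longleftrightarrow> inv g \<in> C1" if "g \<in> carrier G" for g
      using f_inv[OF that] unfolding signed_ind_iff[OF assms(8-10)] by auto
    have "M a b = adjA G C1 a b - adjA G C1 b a" if "a \<in> carrier G" "b \<in> carrier G" for a b
    proof -
      have "inv (b \<otimes> inv a) = a \<otimes> inv b" using that by (simp add: inv_mult_group)
      then show ?thesis using C2_iff[of "b \<otimes> inv a"] that by (simp add: M_def adjA_def)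
    qed
    moreover have "C1 \<inter> (\<lambda>g. inv g) ` C1 = {}"
      using C2_iff sub assms(10) by force
    ultimately show "\<exists>C. normal_set G C \<and> \<one> \<notin> C \<and> C \<inter> (\<lambda>g. inv g) ` C = {} \<and>
        (\<forall>a\<in>carrier G. \<forall>b\<in>carrier G. M a b = adjA G C a b - adjA G C b a)"
      using assms(8,11) by blast
  next
    assume ev: "(\<forall>\<mu>. eigenvalue_on (carrier G) M \<mu> \<longrightarrow>
        (\<exists>z::int. \<mu> = of_int z * csqrt (of_int \<Delta>))) \<and> \<Delta> \<noteq> 1" and pos: "\<Delta> > 0"
    have f_inv: "?f g = ?f (inv g)" if "g \<in> carrier G" for g
      using multiples_inv[OF assms(8-10) _ _ that] ev pos unfolding M by simp
    \<comment> \<open>For positive \<open>\<Delta>\<close> the function is even under inversion, so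
      both sets are inverse-closed and serve as \<open>D1\<close> and \<open>D2\<close>.\<close>
    have iff: "inv g \<in> C1 \<longleftrightarrow> g \<in> C1" "inv g \<in> C2 \<longleftrightarrow> g \<in> C2" if "g \<in> carrier G" for g
      by (simp_all only: signed_ind_iff[OF assms(8-10)] f_inv[OF that])
    have img: "(\<lambda>g. inv g) ` C = C" if C: "C \<subseteq> carrier G" and i: "\<And>g. g \<in> carrier G \<Longrightarrow> inv g \<in> C \<longleftrightarrow> g \<in> C" for C
    proof (intro equalityI subsetI)
      fix g assume g: "g \<in> C"
      then have "g = inv (inv g)" "inv g \<in> C" using C i by auto
      then show "g \<in> (\<lambda>g. inv g) ` C" by blast
    qed (use C i in auto)
    show "\<exists>D1 D2. normal_set G D1 \<and> normal_set G D2 \<and> D1 \<inter> D2 = {} \<and>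
        \<one> \<notin> D1 \<union> D2 \<and> (\<lambda>g. inv g) ` D1 = D1 \<and> (\<lambda>g. inv g) ` D2 = D2 \<and>
        (\<forall>a\<in>carrier G. \<forall>b\<in>carrier G. M a b = adjA G D1 a b - adjA G D2 a b)"
      using assms(8-11) img[OF sub(1) iff(1)] img[OF sub(2) iff(2)]
      by (intro exI[of _ C1] exI[of _ C2]) (simp add: M_def)
  qed
qed

end
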